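(* Let $\mathbf X_1,\dots,\mathbf X_n$ be independent uniform points in $\mathcal S_n$ with hidden embedding $\Psi(v)=\mathbf X_v$, and suppose we are given only the family of vertex orderings $(\tau_v:v\in V)$, each as a linked list. There is an algorithm running in linear time (in $n$) that outputs an embedding $\Phi:V\to\mathbb R^2$ such that whp $d^*(\Psi,\Phi)<1.197\sqrt{\log n}$.
   Context: For a positive integer $n$ let $\mathcal S_n=[-\sqrt n/2,\sqrt n/2]^2$ and $V=[n]$. For each $v\in V$, $\tau_v$ is the ordering of all vertices of $V$ by increasing Euclidean distance $\|\mathbf X_w-\mathbf X_v\|_2$ (ties occur with probability $0$); the computational model assumes the successor of a given element in a given list $\tau_u$ can be found in constant time and real arithmetic has unit cost. For maps $\Phi_1,\Phi_2:V\to\mathbb R^2$, $d^*(\Phi_1,\Phi_2)=\min_\sigma \max_{v\in V}\|\sigma(\Phi_1(v))-\Phi_2(v)\|_2$, the minimum over the 8 symmetries $\sigma$ of the square $\mathcal S_n$. "whp" means with probability tending to $1$ as $n\to\infty$. *)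

theory Defs
  imports "HOL-Probability.Probability"
begin

definition sq :: "nat \<Rightarrow> (real \<times> real) set" where
  "sq n = {-sqrt (real n)/2 .. sqrt (real n)/2} \<times> {-sqrt (real n)/2 .. sqrt (real n)/2}"

definition square_syms :: "((real \<times> real) \<Rightarrow> (real \<times> real)) set" where
  "square_syms = {(\<lambda>(x,y). (x,y)), (\<lambda>(x,y). (-x,y)), (\<lambda>(x,y). (x,-y)), (\<lambda>(x,y). (-x,-y)),
                  (\<lambda>(x,y). (y,x)), (\<lambda>(x,y). (-y,x)), (\<lambda>(x,y). (y,-x)), (\<lambda>(x,y). (-y,-x))}"

definition dstar :: "nat set \<Rightarrow> (nat \<Rightarrow> real \<times> real) \<Rightarrow> (nat \<Rightarrow> real \<times> real) \<Rightarrow> real" where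
  "dstar V \<Phi>1 \<Phi>2 = Min ((\<lambda>\<sigma>. Max ((\<lambda>v. dist (\<sigma> (\<Phi>1 v)) (\<Phi>2 v)) ` V)) ` square_syms)"

text \<open>tau_u: the vertices 1..n ordered by increasing distance from X u
  (ties, a null event, broken by vertex index since sort_key is stable);
  the empty list for u outside [n].\<close>
definition tau :: "nat \<Rightarrow> (nat \<Rightarrow> real \<times> real) \<Rightarrow> nat \<Rightarrow> nat list" where
  "tau n X u = (if u \<in> {1..n} then sort_key (\<lambda>w. dist (X w) (X u)) [1..<n+1] else [])"

text \<open>Linked-list access: head of a list and successor of an element (0 = nil).\<close>
definition lhead :: "(nat \<Rightarrow> nat list) \<Rightarrow> nat \<Rightarrow> nat" where
  "lhead \<tau> u = (case \<tau> u of [] \<Rightarrow> 0 | w # _ \<Rightarrow> w)"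

definition lsucc :: "(nat \<Rightarrow> nat list) \<Rightarrow> nat \<Rightarrow> nat \<Rightarrow> nat" where
  "lsucc \<tau> u w = (if \<exists>i. Suc i < length (\<tau> u) \<and> \<tau> u ! i = w
                  then \<tau> u ! Suc (LEAST i. Suc i < length (\<tau> u) \<and> \<tau> u ! i = w) else 0)"

text \<open>Real RAM with unit-cost arithmetic, indirect addressing and oracle
  access to the linked lists tau_u.  Program constants are integers.\<close>
datatype instr =
    Const nat int
  | Add nat nat nat | Sub nat nat nat | Mul nat nat nat | Dv nat nat nat
  | Sqrt nat nat | Floor nat nat
  | Load nat nat | Store nat nat
  | Jlt nat nat nat | Jmp nat
  | Head nat nat | Succ nat nat nat
  | Halt

type_synonym prog = "instr list"
type_synonym conf = "nat \<times> (nat \<Rightarrow> real)"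

definition addr :: "real \<Rightarrow> nat" where "addr r = nat \<lfloor>r\<rfloor>"

definition cur :: "prog \<Rightarrow> nat \<Rightarrow> instr" where
  "cur P pc = (if pc < length P then P ! pc else Halt)"

fun step :: "prog \<Rightarrow> (nat \<Rightarrow> nat list) \<Rightarrow> conf \<Rightarrow> conf" where
  "step P \<tau> (pc, m) = (case cur P pc of
       Const a c \<Rightarrow> (Suc pc, m(a := of_int c))
     | Add a b c \<Rightarrow> (Suc pc, m(a := m b + m c))
     | Sub a b c \<Rightarrow> (Suc pc, m(a := m b - m c))
     | Mul a b c \<Rightarrow> (Suc pc, m(a := m b * m c))
     | Dv a b c \<Rightarrow> (Suc pc, m(a := m b / m c))
     | Sqrt a b \<Rightarrow> (Suc pc, m(a := sqrt (m b)))
     | Floor a b \<Rightarrow> (Suc pc, m(a := of_int \<lfloor>m b\<rfloor>))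
     | Load a b \<Rightarrow> (Suc pc, m(a := m (addr (m b))))
     | Store a b \<Rightarrow> (Suc pc, m(addr (m a) := m b))
     | Jlt a b l \<Rightarrow> (if m a < m b then (l, m) else (Suc pc, m))
     | Jmp l \<Rightarrow> (l, m)
     | Head a b \<Rightarrow> (Suc pc, m(a := real (lhead \<tau> (addr (m b)))))
     | Succ a b c \<Rightarrow> (Suc pc, m(a := real (lsucc \<tau> (addr (m b)) (addr (m c)))))
     | Halt \<Rightarrow> (pc, m))"

definition run :: "prog \<Rightarrow> (nat \<Rightarrow> nat list) \<Rightarrow> nat \<Rightarrow> conf \<Rightarrow> conf" where
  "run P \<tau> k = step P \<tau> ^^ k"

definition init :: "nat \<Rightarrow> conf" where
  "init n = (0, (\<lambda>_. 0)(0 := real n))"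

definition halted :: "prog \<Rightarrow> conf \<Rightarrow> bool" where
  "halted P c = (cur P (fst c) = Halt)"

definition halts_within :: "prog \<Rightarrow> (nat \<Rightarrow> nat list) \<Rightarrow> nat \<Rightarrow> nat \<Rightarrow> bool" where
  "halts_within P \<tau> n t = (\<exists>k\<le>t. halted P (run P \<tau> k (init n)))"

definition ram_output :: "prog \<Rightarrow> (nat \<Rightarrow> nat list) \<Rightarrow> nat \<Rightarrow> nat \<Rightarrow> nat \<Rightarrow> real \<times> real" where
  "ram_output P \<tau> n t v = (snd (run P \<tau> t (init n)) (2 * v), snd (run P \<tau> t (init n)) (2 * v + 1))"

definition pts :: "nat \<Rightarrow> (nat \<Rightarrow> real \<times> real) measure" where
  "pts n = PiM {1..n} (\<lambda>_. uniform_measure lborel (sq n))"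

end

theory Submission
  imports Defs "HOL-Real_Asymp.Real_Asymp"
begin

text \<open>Rescale the square to \<open>[0,1]\<^sup>2\<close>. The vertex farthest from any given point lies next to a corner, so
  vertices \<open>a, b, c, d\<close> next to the four corners are found by walking to the ends of a few lists; only
  one vertex near a corner other than those of \<open>a\<close> and \<open>c\<close> is needed in addition, and it is
  the maximiser of the smaller of the ranks in \<open>\<tau>\<^sub>a\<close> and \<open>\<tau>\<^sub>c\<close>. By uniform concentration of the number of
  points in discs around a corner, the rank of \<open>v\<close> in \<open>\<tau>\<^sub>a\<close> is, up to a small multiple of \<open>sqrt (n ln n)\<close>,
  \<open>n\<close> times the area \<open>F (r)\<close> of the part of the disc of radius \<open>r = |v - a|\<close> inside the square, and
  \<open>F (r) = \<kappa> r\<^sup>2\<close> for \<open>r \<le> 1\<close>; the unknown \<open>\<kappa>\<close> is the relative rank of \<open>b\<close> in \<open>\<tau>\<^sub>a\<close>. Squared distances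
  to two adjacent corners determine a coordinate linearly.

  For \<open>r > 1\<close> the function \<open>F\<close> is not inverted but calibrated: for points in the lens at distance at most 1
  from both \<open>a\<close> and \<open>c\<close>, the British flag theorem \<open>r\<^sub>a\<^sup>2 + r\<^sub>c\<^sup>2 = r\<^sub>b\<^sup>2 + r\<^sub>d\<^sup>2\<close> gives \<open>r\<^sub>b\<^sup>2\<close> from
  ranks that are quadratic in the distance, and any other vertex takes over the value of the last lens
  vertex preceding it in \<open>\<tau>\<^sub>b\<close>.

  The concentration bound splits the radii into a bounded number of coarse ones, where the deviation
  allowed is \<open>sqrt (ln n)\<close> standard deviations, and linearly many fine ones, where the increment
  over the coarse radius has variance so small that Chernoff's bound beats the union bound. Hence the
  constant in front of \<open>sqrt (ln n)\<close> can be made arbitrarily small.\<close>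

section \<open>A structured language compiled to the RAM\<close>

text \<open>The calibrated value of a lens vertex also uses its rank in the list of the opposite
  corner, so that rank has to be quadratic in the distance too. The flag identity ensures this: if
  both neighbouring squared distances are at most about 1 and \<open>r\<^sub>b\<^sup>2\<close> is at
  least about 1, then \<open>r\<^sub>d\<^sup>2\<close> is at most about 1. The lens is only
  controlled for radii below 6/5, and distances are estimated up to 113/100. Hence each coordinate
  is read off from the two ends of the nearer side of the square, at distance at most sqrt (1 +
  0.51^2); ranks decide which side is nearer and may err by 1/100. The geometric part is generous
  with constants and ends with an error of 10^6 \<epsilon>. This is paid for by taking \<epsilon> as
  10^-6 sqrt (ln n / n), which gives the constant 1 in place of 1.197. At that scale the deviation
  bound for a full disc is only a tiny negative power of n, so just boundedly many full discs can be
  afforded in a union bound. Machine and geometry meet in the predicate \<open>alg\<close>: the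
  former sees the lists as mere permutations, the latter never sees the machine.\<close>

datatype com = Blk "instr list" | Seq com com (infixr "%;" 60) | Ite nat nat com com | Whl nat nat com

fun basic :: "instr \<Rightarrow> bool" where
  "basic (Jlt a b l) = False" | "basic (Jmp l) = False" | "basic Halt = False" | "basic _ = True"

fun eff :: "(nat \<Rightarrow> nat list) \<Rightarrow> instr \<Rightarrow> (nat \<Rightarrow> real) \<Rightarrow> (nat \<Rightarrow> real)" where
  "eff \<tau> (Const a c) m = m(a := of_int c)"
| "eff \<tau> (Add a b c) m = m(a := m b + m c)"
| "eff \<tau> (Sub a b c) m = m(a := m b - m c)"
| "eff \<tau> (Mul a b c) m = m(a := m b * m c)"
| "eff \<tau> (Dv a b c) m = m(a := m b / m c)"
| "eff \<tau> (Sqrt a b) m = m(a := sqrt (m b))"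
| "eff \<tau> (Floor a b) m = m(a := of_int \<lfloor>m b\<rfloor>)"
| "eff \<tau> (Load a b) m = m(a := m (addr (m b)))"
| "eff \<tau> (Store a b) m = m(addr (m a) := m b)"
| "eff \<tau> (Head a b) m = m(a := real (lhead \<tau> (addr (m b))))"
| "eff \<tau> (Succ a b c) m = m(a := real (lsucc \<tau> (addr (m b)) (addr (m c))))"
| "eff \<tau> _ m = m"

text \<open>Jump targets are absolute, so the code depends on its start address \<open>p\<close>.
  \<open>Jlt\<close> falls through when its test fails: the else branch therefore comes first, and a
  loop needs a separate exit jump.\<close>

fun compile :: "nat \<Rightarrow> com \<Rightarrow> instr list" where
  "compile p (Blk is) = is"
| "compile p (Seq c d) = compile p c @ compile (p + length (compile p c)) d"
| "compile p (Ite a b c d) =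
     (let ed = compile (p + 1) d; q = p + 2 + length ed; ec = compile q c
      in Jlt a b q # ed @ Jmp (q + length ec) # ec)"
| "compile p (Whl a b c) =
     (let ec = compile (p + 2) c in Jlt a b (p + 2) # Jmp (p + 3 + length ec) # ec @ [Jmp p])"

definition code_at :: "prog \<Rightarrow> nat \<Rightarrow> instr list \<Rightarrow> bool" where
  "code_at P p is = (\<exists>xs ys. P = xs @ is @ ys \<and> length xs = p)"

lemma code_at_append: "code_at P p (is @ js) \<longleftrightarrow> code_at P p is \<and> code_at P (p + length is) js"
proof
  assume "code_at P p (is @ js)"
  then obtain xs ys where "P = xs @ (is @ js) @ ys" "length xs = p" by (auto simp: code_at_def)
  then have "P = xs @ is @ (js @ ys)" "P = (xs @ is) @ js @ ys" "length (xs @ is) = p + length is" by auto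
  then show "code_at P p is \<and> code_at P (p + length is) js"
    unfolding code_at_def using \<open>length xs = p\<close> by blast
next
  assume "code_at P p is \<and> code_at P (p + length is) js"
  then obtain xs ys xs' ys' where 1: "P = xs @ is @ ys" "length xs = p"
    and 2: "P = xs' @ js @ ys'" "length xs' = p + length is" unfolding code_at_def by blast
  have "xs' = take (p + length is) P" using 2 by simp
  also have "\<dots> = xs @ is" using 1 by simp
  finally show "code_at P p (is @ js)" using 1 2 by (auto simp: code_at_def)
qed

lemma code_at_Cons: "code_at P p (i # is) \<longleftrightarrow> cur P p = i \<and> p < length P \<and> code_at P (Suc p) is"
proof -
  have "code_at P p [i] \<longleftrightarrow> cur P p = i \<and> p < length P"
  proof
    assume "cur P p = i \<and> p < length P"
    then have "P = take p P @ [i] @ drop (Suc p) P" "length (take p P) = p"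
      by (auto simp: cur_def id_take_nth_drop)
    then show "code_at P p [i]" unfolding code_at_def by blast
  qed (auto simp: code_at_def cur_def nth_append)
  then show ?thesis using code_at_append[of P p "[i]" "is"] by simp
qed

text \<open>Quantifying over every program and address that contain the code makes the judgement
  compositional; \<open>t\<close> only bounds the number of steps, so costs may be rounded
  up.\<close>

definition exec :: "(nat \<Rightarrow> nat list) \<Rightarrow> com \<Rightarrow> (nat \<Rightarrow> real) \<Rightarrow> nat \<Rightarrow> (nat \<Rightarrow> real) \<Rightarrow> bool" where
  "exec \<tau> c m t m' \<longleftrightarrow> (\<forall>P p. code_at P p (compile p c) \<longrightarrow>
     (\<exists>k\<le>t. run P \<tau> k (p, m) = (p + length (compile p c), m')))"

lemma run_add: "run P \<tau> (j + k) s = run P \<tau> k (run P \<tau> j s)"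
  unfolding run_def by (metis add.commute comp_apply funpow_add)

lemma run_0 [simp]: "run P \<tau> 0 s = s"
  by (simp add: run_def)

lemma run_Suc: "run P \<tau> (Suc k) s = run P \<tau> k (step P \<tau> s)"
  unfolding run_def by (simp only: funpow_Suc_right comp_apply)

lemma step_basic: "basic (cur P p) \<Longrightarrow> step P \<tau> (p, m) = (Suc p, eff \<tau> (cur P p) m)"
  by (cases "cur P p") auto

lemma exec_Blk:
  assumes "list_all basic is" "length is \<le> t"
  shows "exec \<tau> (Blk is) m t (fold (eff \<tau>) is m)"
proof -
  have "code_at P p is \<Longrightarrow> run P \<tau> (length is) (p, m) = (p + length is, fold (eff \<tau>) is m)" for P p
    using assms(1)
  proof (induction "is" arbitrary: p m)
    case (Cons i js)
    then have "cur P p = i" "code_at P (Suc p) js" "basic i" by (auto simp: code_at_Cons)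
    then show ?case using Cons.IH[of "Suc p" "eff \<tau> i m"] Cons.prems
      by (simp add: run_Suc step_basic del: step.simps)
  qed simp
  then show ?thesis using assms(2) unfolding exec_def by fastforce
qed

lemma exec_Seq:
  assumes "exec \<tau> c m t1 m1" "exec \<tau> d m1 t2 m2" "t1 + t2 \<le> t"
  shows "exec \<tau> (Seq c d) m t m2"
  unfolding exec_def
proof (intro allI impI)
  fix P p assume "code_at P p (compile p (Seq c d))"
  then have c: "code_at P p (compile p c)" "code_at P (p + length (compile p c)) (compile (p + length (compile p c)) d)"
    by (auto simp: code_at_append)
  obtain k1 where "k1 \<le> t1" "run P \<tau> k1 (p, m) = (p + length (compile p c), m1)"
    using assms(1) c(1) unfolding exec_def by blast
  moreover obtain k2 where "k2 \<le> t2" "run P \<tau> k2 (p + length (compile p c), m1) =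
      (p + length (compile p c) + length (compile (p + length (compile p c)) d), m2)"
    using assms(2) c(2) unfolding exec_def by blast
  ultimately show "\<exists>k\<le>t. run P \<tau> k (p, m) = (p + length (compile p (Seq c d)), m2)"
    using assms(3) by (intro exI[of _ "k1 + k2"]) (simp add: run_add)
qed

lemma exec_Ite:
  assumes "m a < m b \<Longrightarrow> exec \<tau> c m t m'" "\<not> m a < m b \<Longrightarrow> exec \<tau> d m t m'" "t + 2 \<le> t'"
  shows "exec \<tau> (Ite a b c d) m t' m'"
  unfolding exec_def
proof (intro allI impI)
  fix P p assume A: "code_at P p (compile p (Ite a b c d))"
  define ed where "ed = compile (p + 1) d"
  define q where "q = p + 2 + length ed"
  define ec where "ec = compile q c"
  have cmp: "compile p (Ite a b c d) = Jlt a b q # ed @ Jmp (q + length ec) # ec"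
    by (simp add: ed_def q_def ec_def Let_def)
  have A': "cur P p = Jlt a b q" "code_at P (Suc p) ed"
    "cur P (Suc p + length ed) = Jmp (q + length ec)" "code_at P q ec"
    using A unfolding cmp by (auto simp: code_at_append code_at_Cons q_def)
  have len: "p + length (compile p (Ite a b c d)) = q + length ec"
    unfolding cmp by (simp add: q_def)
  show "\<exists>k\<le>t'. run P \<tau> k (p, m) = (p + length (compile p (Ite a b c d)), m')"
  proof (cases "m a < m b")
    case True
    then obtain k where "k \<le> t" "run P \<tau> k (q, m) = (q + length ec, m')"
      using assms(1) A' unfolding exec_def ec_def by blast
    then show ?thesis using True A' assms(3) unfolding len
      by (intro exI[of _ "Suc k"]) (simp add: run_Suc)
  next
    case False
    then obtain k where k: "k \<le> t" "run P \<tau> k (Suc p, m) = (Suc p + length ed, m')"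
      using assms(2) A' unfolding exec_def ed_def by (metis Suc_eq_plus1)
    have "run P \<tau> (Suc (k + 1)) (p, m) = run P \<tau> 1 (run P \<tau> k (Suc p, m))"
      using False A' by (simp only: run_Suc run_add) simp
    also have "\<dots> = (q + length ec, m')"
      unfolding k using A' by (simp add: run_Suc)
    finally show ?thesis using k assms(3) unfolding len
      by (intro exI[of _ "Suc (k + 1)"]) simp
  qed
qed

text \<open>The number \<open>N\<close> of rounds is known beforehand. A round costs the body, one
  test and one jump back; the failing test at the end and the exit jump account for the last
  2.\<close>

lemma exec_Whl:
  assumes "I 0 m" "\<And>i m. i < N \<Longrightarrow> I i m \<Longrightarrow> m a < m b \<and> (\<exists>m'. exec \<tau> c m T m' \<and> I (Suc i) m')"
    "\<And>m. I N m \<Longrightarrow> \<not> m a < m b"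
  shows "\<exists>m'. exec \<tau> (Whl a b c) m (N * (T + 2) + 2) m' \<and> I N m'"
proof -
  \<comment> \<open>Induction on the number \<open>j\<close> of rounds still to come.\<close>
  have "\<exists>m'. exec \<tau> (Whl a b c) m (j * (T + 2) + 2) m' \<and> I N m'"
    if "I (N - j) m" "j \<le> N" for j m
    using that
  proof (induction j arbitrary: m)
    case 0
    have "exec \<tau> (Whl a b c) m 2 m"
      unfolding exec_def
    proof (intro allI impI)
      fix P p assume A: "code_at P p (compile p (Whl a b c))"
      show "\<exists>k\<le>2. run P \<tau> k (p, m) = (p + length (compile p (Whl a b c)), m)"
        using A assms(3)[of m] 0 
        by (intro exI[of _ 2]) (auto simp: Let_def code_at_Cons run_Suc eval_nat_numeral)
    qed
    then show ?case using 0 by (intro exI[of _ m]) (simp add: numeral_2_eq_2)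
  next
    case (Suc j)
    have "N - Suc j < N" and e: "Suc (N - Suc j) = N - j" using Suc.prems by auto
    then obtain m1 where lt: "m a < m b" and c: "exec \<tau> c m T m1" and "I (N - j) m1"
      using assms(2)[OF _ Suc.prems(1)] by auto
    with Suc.IH[of m1] Suc.prems obtain m2 where
      w: "exec \<tau> (Whl a b c) m1 (j * (T + 2) + 2) m2" and "I N m2" by auto
    have "exec \<tau> (Whl a b c) m (Suc j * (T + 2) + 2) m2"
      unfolding exec_def
    proof (intro allI impI)
      fix P p assume A: "code_at P p (compile p (Whl a b c))"
      then have A': "cur P p = Jlt a b (p + 2)" "code_at P (p + 2) (compile (p + 2) c)"
        "cur P (p + 2 + length (compile (p + 2) c)) = Jmp p"
        by (auto simp: Let_def code_at_Cons code_at_append)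
      obtain k1 where k1: "k1 \<le> T" "run P \<tau> k1 (p + 2, m) = (p + 2 + length (compile (p + 2) c), m1)"
        using c A' unfolding exec_def by blast
      obtain k2 where k2: "k2 \<le> j * (T + 2) + 2" "run P \<tau> k2 (p, m1) = (p + length (compile p (Whl a b c)), m2)"
        using w A unfolding exec_def by blast
      have "run P \<tau> (Suc (k1 + Suc k2)) (p, m) = run P \<tau> (Suc k2) (run P \<tau> k1 (p + 2, m))"
        using A' lt by (simp only: run_Suc run_add) simp
      also have "\<dots> = run P \<tau> k2 (p, m1)"
        unfolding k1 using A' by (simp add: run_Suc)
      finally show "\<exists>k\<le>Suc j * (T + 2) + 2. run P \<tau> k (p, m) = (p + length (compile p (Whl a b c)), m2)"
        using k1 k2 by (intro exI[of _ "Suc (k1 + Suc k2)"]) simp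
    qed
    then show ?case using \<open>I N m2\<close> by blast
  qed
  from this[of N m] assms(1) show ?thesis by simp
qed

section \<open>The program\<close>

lemma addr_simps [simp]:
  "addr (real a) = a" "addr (real a + real b) = a + b" "addr (real a + 1) = a + 1" "addr 1 = 1"
  "addr (numeral k) = numeral k" "addr (real a + numeral k) = a + numeral k"
proof -
  have 1: "addr (real k) = k" for k by (simp add: addr_def)
  show "addr (real a) = a" by (rule 1)
  show "addr (real a + real b) = a + b" using 1[of "a + b"] by simp
  show "addr (real a + 1) = a + 1" using 1[of "a + 1"] by (simp add: add.commute)
  show "addr 1 = 1" using 1[of 1] by simp
  show "addr (numeral k) = numeral k" using 1[of "numeral k"] by simp
  show "addr (real a + numeral k) = a + numeral k" using 1[of "a + numeral k"] by simp
qed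

text \<open>All that the machine part assumes about the lists; distances and ties enter only through
  \<open>tau\<close>.\<close>

definition perm_lists :: "nat \<Rightarrow> (nat \<Rightarrow> nat list) \<Rightarrow> bool" where
  "perm_lists n \<tau> \<longleftrightarrow> (\<forall>u\<in>{1..n}. distinct (\<tau> u) \<and> set (\<tau> u) = {1..n})"

lemma perm_listsD:
  assumes "perm_lists n \<tau>" "u \<in> {1..n}"
  shows "distinct (\<tau> u)" "set (\<tau> u) = {1..n}" "length (\<tau> u) = n"
  using assms distinct_card[of "\<tau> u"] by (auto simp: perm_lists_def)

definition pos :: "nat list \<Rightarrow> nat \<Rightarrow> nat" where
  "pos l w = (THE i. i < length l \<and> l ! i = w)"

lemma pos_nth: "distinct l \<Longrightarrow> i < length l \<Longrightarrow> pos l (l ! i) = i"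
  unfolding pos_def by (rule the_equality) (auto simp: nth_eq_iff_index_eq)

lemma nth_pos: "distinct l \<Longrightarrow> w \<in> set l \<Longrightarrow> pos l w < length l \<and> l ! pos l w = w"
  by (metis in_set_conv_nth pos_nth)

lemma lsucc_nth:
  assumes "distinct (\<tau> u)" "i < length (\<tau> u)"
  shows "lsucc \<tau> u (\<tau> u ! i) = (if Suc i < length (\<tau> u) then \<tau> u ! Suc i else 0)"
proof -
  have *: "(Suc j < length (\<tau> u) \<and> \<tau> u ! j = \<tau> u ! i) \<longleftrightarrow> (Suc i < length (\<tau> u) \<and> j = i)" for j
    using assms by (auto simp: nth_eq_iff_index_eq)
  show ?thesis unfolding lsucc_def * using Least_equality[of "\<lambda>j. j = i" i] by auto
qed

lemma lhead_nth: "\<tau> u \<noteq> [] \<Longrightarrow> lhead \<tau> u = \<tau> u ! 0"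
  by (auto simp: lhead_def split: list.split)

text \<open>Cells below 40 are registers. Register \<open>20 + j\<close> holds the base of array \<open>j\<close>: arrays 0 to 3 are the
  ranks with respect to \<open>a, b, c, d\<close>, arrays 4 to 7 the calibrated ranks, array 9 is a dummy.
  The output cells of the first vertices are registers, so the output is collected in array 8 and
  moved to its place at the very end.\<close>
definition base :: "nat \<Rightarrow> nat \<Rightarrow> nat" where "base n j = (2 * n + 100) * (j + 1)"

definition scratch :: "nat set" where
  "scratch = {2, 3, 4, 5, 8, 9, 16, 18} \<union> {31..39}"

text \<open>Frame condition of a loop that writes array \<open>j\<close>. The block reaches up to
  offset 2n + 1 because the output array stores two cells per vertex, at offsets
  \<open>2 * v\<close> and \<open>2 * v + 1\<close>.\<close>

definition agree :: "nat \<Rightarrow> nat \<Rightarrow> (nat \<Rightarrow> real) \<Rightarrow> (nat \<Rightarrow> real) \<Rightarrow> bool" where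
  "agree n j m m' \<longleftrightarrow> (\<forall>x. x \<notin> scratch \<and> x \<notin> {base n j + 1..base n j + (2 * n + 1)} \<longrightarrow> m' x = m x)"

text \<open>Register 6 holds 0 so that \<open>Add\<close> doubles as a copy instruction; register 7
  is the exclusive upper bound of loops over vertices.\<close>

definition regs_ok :: "nat \<Rightarrow> (nat \<Rightarrow> real) \<Rightarrow> bool" where
  "regs_ok n m \<longleftrightarrow> m 0 = real n \<and> m 1 = 1 \<and> m 6 = 0 \<and> m 7 = real n + 1 \<and>
     (\<forall>j<10. m (20 + j) = real (base n j))"

definition arr :: "nat \<Rightarrow> nat \<Rightarrow> (nat \<Rightarrow> real) \<Rightarrow> (nat \<Rightarrow> real) \<Rightarrow> bool" where
  "arr n j f m \<longleftrightarrow> (\<forall>w\<in>{1..n}. m (base n j + w) = f w)"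

lemma base_ge: "base n j \<ge> 100"
  by (simp add: base_def)

lemma base_ne [simp]: "k < 100 \<Longrightarrow> (base n j + w = k) = False"
  using base_ge[of n j] by auto

text \<open>The arrays have stride 2n + 100, so the quotient of an address by the stride identifies
  the array.\<close>

lemma base_distinct:
  assumes "base n j + w = base n j' + w'" "w < 2 * n + 100" "w' < 2 * n + 100"
  shows "j = j'"
proof -
  have "(base n j + w) div (2 * n + 100) = j + 1" "(base n j' + w') div (2 * n + 100) = j' + 1"
    unfolding base_def using assms(2,3) by (simp_all add: div_mult_self3 del: mult_Suc_right mult_Suc)
  then show ?thesis using assms(1) by simp
qed

lemma agree_arr: "agree n j m m' \<Longrightarrow> j \<noteq> j' \<Longrightarrow> arr n j' f m \<Longrightarrow> arr n j' f m'"
proof -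
  assume a: "agree n j m m'" "j \<noteq> j'" "arr n j' f m"
  have "m' (base n j' + w) = m (base n j' + w)" if "w \<in> {1..n}" for w
  proof -
    have "base n j' + w \<notin> {base n j + 1..base n j + (2 * n + 1)}"
    proof
      assume "base n j' + w \<in> {base n j + 1..base n j + (2 * n + 1)}"
      then obtain w' where "base n j' + w = base n j + w'" "w' \<le> 2 * n + 1"
        by (intro that[of "base n j' + w - base n j"]) auto
      with base_distinct[of n j' w j w'] that a(2) show False by auto
    qed
    moreover have "base n j' + w \<notin> scratch" using base_ge[of n j'] by (auto simp: scratch_def)
    ultimately show ?thesis using a(1) by (auto simp: agree_def)
  qed
  then show ?thesis using a(3) by (simp add: arr_def)
qed

lemma agree_reg: "agree n j m m' \<Longrightarrow> x \<notin> scratch \<Longrightarrow> x < 100 \<Longrightarrow> m' x = m x"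
  using base_ge[of n j] by (auto simp: agree_def)

lemma agree_regs_ok: "agree n j m m' \<Longrightarrow> regs_ok n m \<Longrightarrow> regs_ok n m'"
  by (auto simp: regs_ok_def agree_reg[of n j m m'] scratch_def)

lemma agree_trans: "agree n j m m' \<Longrightarrow> agree n j m' m'' \<Longrightarrow> agree n j m m''"
  by (simp add: agree_def)

lemma exec_BlkI:
  assumes "list_all basic is" "length is \<le> t" "fold (eff \<tau>) is m = m'"
  shows "exec \<tau> (Blk is) m t m'"
  using exec_Blk[OF assms(1,2)] assms(3) by blast

lemma exec_Blk_ex:
  assumes "list_all basic is" "length is \<le> t" "Q (fold (eff \<tau>) is m)"
  shows "\<exists>m'. exec \<tau> (Blk is) m t m' \<and> Q m'"
  using exec_Blk[OF assms(1,2)] assms(3) by blast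

section \<open>The loops of the program and their invariants\<close>

definition walk :: "nat \<Rightarrow> nat \<Rightarrow> com" where
  "walk u b = Blk [Const 2 0, Head 3 u] %;
     Whl 2 0 (Blk [Add 4 b 3, Store 4 2, Add 5 3 6, Succ 3 u 3, Add 2 2 1])"

text \<open>One pass serves two purposes: it fills a rank table and finds the farthest vertex, the
  last entry seen. Where only the latter is wanted, the table goes to the dummy array.\<close>

lemma exec_walk:
  assumes pl: "perm_lists n \<tau>" and u0: "u0 \<in> {1..n}" and ok: "regs_ok n m"
    and u: "m u = real u0" "u \<notin> scratch" "u < 40" and j: "j < 10"
  shows "\<exists>m'. exec \<tau> (walk u (20 + j)) m (9 * n + 10) m' \<and> agree n j m m' \<and>
    m' 5 = real (last (\<tau> u0)) \<and> arr n j (\<lambda>w. real (pos (\<tau> u0) w)) m'"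
proof -
  let ?is = "[Add 4 (20 + j) 3, Store 4 2, Add 5 3 6, Succ 3 u 3, Add 2 2 1]"
  define l where "l = \<tau> u0"
  note L = perm_listsD[OF pl u0, folded l_def]
  have n: "n > 0" using u0 by auto
  have lne: "l \<noteq> []" using L n by auto
  define B where "B = base n j"
  have B: "B \<ge> 100" by (simp add: B_def base_ge)
  have us: "u \<noteq> 2" "u \<noteq> 3" "u \<noteq> 4" "u \<noteq> 5" using u by (auto simp: scratch_def)
  have uB: "u \<noteq> B + x" for x using u B by auto
  have mem: "l ! i \<in> {1..n}" if "i < n" for i using that L nth_mem by metis
  define I where "I = (\<lambda>i m'. (\<forall>x. x \<notin> {2, 3, 4, 5} \<and> x \<notin> {B + 1..B + n} \<longrightarrow> m' x = m x) \<and>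
     m' 2 = real i \<and> m' 3 = real (if i < n then l ! i else 0) \<and>
     (i > 0 \<longrightarrow> m' 5 = real (l ! (i - 1))) \<and> (\<forall>k<i. m' (B + l ! k) = real k))"
  define m0 where "m0 = fold (eff \<tau>) [Const 2 0, Head 3 u] m"
  have 0: "exec \<tau> (Blk [Const 2 0, Head 3 u]) m 2 m0"
    unfolding m0_def by (rule exec_Blk) simp_all
  have I0: "I 0 m0"
    using n us u lhead_nth[of \<tau> u0] lne unfolding I_def m0_def by (simp add: l_def)
  have regI: "m' 0 = real n" "m' 1 = 1" "m' 6 = 0" "m' u = real u0" "m' (20 + j) = real B"
    if "I i m'" for i m'
    using that ok u us B j unfolding I_def regs_ok_def by (auto simp: B_def)
  have "\<exists>m'. exec \<tau> (Whl 2 0 (Blk ?is)) m0 (n * (5 + 2) + 2) m' \<and> I n m'"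
  proof (rule exec_Whl[where I = I])
    show "I 0 m0" by (rule I0)
  next
    fix i m' assume i: "i < n" and I: "I i m'"
    note r = regI[OF I]
    have m2: "m' 2 = real i" "m' 3 = real (l ! i)" using I i by (auto simp: I_def)
    have li: "l ! i \<in> {1..n}" by (rule mem[OF i])
    have suc: "lsucc \<tau> u0 (l ! i) = (if Suc i < n then l ! Suc i else 0)"
      using lsucc_nth[of \<tau> u0 i] L i by (simp add: l_def)
    have ne: "l ! k \<noteq> l ! i" if "k < i" for k
      using that i L by (simp add: nth_eq_iff_index_eq)
    have "I (Suc i) (fold (eff \<tau>) ?is m')"
      using I r m2 us uB B li ne suc j unfolding I_def
      by (auto simp: less_Suc_eq)
    then show "m' 2 < m' 0 \<and> (\<exists>m''. exec \<tau> (Blk ?is) m' 5 m'' \<and> I (Suc i) m'')"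
      using r m2 i by (intro conjI exec_Blk_ex) simp_all
  next
    fix m' assume "I n m'"
    with regI[OF this] show "\<not> m' 2 < m' 0" by (simp add: I_def)
  qed
  then obtain m' where m': "exec \<tau> (Whl 2 0 (Blk ?is)) m0 (n * (5 + 2) + 2) m'" "I n m'" by blast
  have "exec \<tau> (walk u (20 + j)) m (9 * n + 10) m'"
    unfolding walk_def by (rule exec_Seq[OF 0 m'(1)]) simp
  moreover have "agree n j m m'"
    using m'(2) by (auto simp: I_def agree_def scratch_def B_def)
  moreover have "m' 5 = real (last (\<tau> u0))"
    using m'(2) n L lne by (simp add: I_def last_conv_nth flip: l_def)
  moreover have "arr n j (\<lambda>w. real (pos (\<tau> u0) w)) m'"
    unfolding arr_def using m'(2) nth_pos[OF L(1)] L by (metis I_def B_def l_def)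
  ultimately show ?thesis by blast
qed

definition maxmin_body :: com where
  "maxmin_body =
     Blk [Add 4 20 2, Load 8 4, Add 4 22 2, Load 9 4] %;
       Ite 9 8 (Blk [Add 8 9 6]) (Blk []) %;
       Ite 3 8 (Blk [Add 3 8 6, Add 5 2 6]) (Blk []) %;
       Blk [Add 2 2 1]"

text \<open>The start value -1 lies below every rank, so the first vertex always replaces
  it.\<close>

definition maxmin :: com where
  "maxmin = Blk [Const 2 1, Const 3 (-1), Const 5 1] %;
     Whl 2 7 maxmin_body"

lemma exec_maxmin:
  assumes n: "n \<ge> 1" and ok: "regs_ok n m" and f: "arr n 0 f m" and g: "arr n 2 g m"
    and pos: "\<And>w. f w \<ge> 0" "\<And>w. g w \<ge> 0"
  shows "\<exists>m' w. exec \<tau> maxmin m (20 * n + 10) m' \<and> agree n 9 m m' \<and>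
    w \<in> {1..n} \<and> m' 5 = real w \<and> (\<forall>v\<in>{1..n}. min (f v) (g v) \<le> min (f w) (g w))"
proof -
  let ?body = "maxmin_body"
  define I where "I = (\<lambda>i m'. (\<forall>x. x \<notin> {2, 3, 4, 5, 8, 9} \<longrightarrow> m' x = m x) \<and>
     m' 2 = real (Suc i) \<and> (if i = 0 then m' 3 = -1 else
     (\<exists>w\<in>{1..n}. m' 5 = real w \<and> m' 3 = min (f w) (g w) \<and>
     (\<forall>v\<in>{1..i}. min (f v) (g v) \<le> min (f w) (g w)))))"
  define m0 where "m0 = fold (eff \<tau>) [Const 2 1, Const 3 (-1), Const 5 1] m"
  have 0: "exec \<tau> (Blk [Const 2 1, Const 3 (-1), Const 5 1]) m 3 m0"
    unfolding m0_def by (rule exec_Blk) simp_all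
  have I0: "I 0 m0" unfolding I_def m0_def by simp
  have "\<exists>m'. exec \<tau> (Whl 2 7 ?body) m0 (n * (13 + 2) + 2) m' \<and> I n m'"
  proof (rule exec_Whl[where I = I])
    show "I 0 m0" by (rule I0)
  next
    fix i m' assume i: "i < n" and I: "I i m'"
    have r: "m' 6 = 0" "m' 1 = 1" "m' 7 = real n + 1" "m' 20 = real (base n 0)" "m' 22 = real (base n 2)" "m' 2 = real (Suc i)"
      using I ok unfolding I_def regs_ok_def
      using spec[of "\<lambda>j. j < 10 \<longrightarrow> m (20 + j) = real (base n j)" 0]
        spec[of "\<lambda>j. j < 10 \<longrightarrow> m (20 + j) = real (base n j)" 2] by simp_all
    have fr: "m' (base n k + w) = m (base n k + w)" for k w
      using I base_ge[of n k] by (auto simp: I_def)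
    have fg: "m' (base n 0 + Suc i) = f (Suc i)" "m' (base n 2 + Suc i) = g (Suc i)"
      using f g i unfolding fr arr_def by (simp_all del: add_Suc_right)
    define m1 where "m1 = m'(8 := f (Suc i), 4 := real (base n 2) + real (Suc i), 9 := g (Suc i))"
    have e1: "exec \<tau> (Blk [Add 4 20 2, Load 8 4, Add 4 22 2, Load 9 4]) m' 4 m1"
    proof -
      have "fold (eff \<tau>) [Add 4 20 2, Load 8 4, Add 4 22 2, Load 9 4] m' = m1"
        unfolding m1_def using fg r by (simp del: of_nat_Suc add_Suc_right)
      then show ?thesis by (rule exec_BlkI[rotated 2]) simp_all
    qed
    define x where "x = min (f (Suc i)) (g (Suc i))"
    define m2 where "m2 = m1(8 := x)"
    have e2: "exec \<tau> (Ite 9 8 (Blk [Add 8 9 6]) (Blk [])) m1 3 m2"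
    proof (rule exec_Ite[where t = 1])
      assume "m1 9 < m1 8"
      then have "fold (eff \<tau>) [Add 8 9 6] m1 = m2"
        using r by (simp add: m1_def m2_def x_def min_def)
      then show "exec \<tau> (Blk [Add 8 9 6]) m1 1 m2" by (rule exec_BlkI[rotated 2]) simp_all
    next
      assume "\<not> m1 9 < m1 8"
      then have "fold (eff \<tau>) [] m1 = m2"
        using r by (simp add: fun_eq_iff m1_def m2_def x_def min_def)
      then show "exec \<tau> (Blk []) m1 1 m2" by (rule exec_BlkI[rotated 2]) simp_all
    qed simp
    define m3 where "m3 = (if m' 3 < x then m2(3 := x, 5 := real (Suc i)) else m2)"
    have e3: "exec \<tau> (Ite 3 8 (Blk [Add 3 8 6, Add 5 2 6]) (Blk [])) m2 4 m3"
    proof (rule exec_Ite[where t = 2])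
      assume "m2 3 < m2 8"
      then have "fold (eff \<tau>) [Add 3 8 6, Add 5 2 6] m2 = m3"
        using r by (simp add: m1_def m2_def m3_def)
      then show "exec \<tau> (Blk [Add 3 8 6, Add 5 2 6]) m2 2 m3" by (rule exec_BlkI[rotated 2]) simp_all
    next
      assume "\<not> m2 3 < m2 8"
      then have "fold (eff \<tau>) [] m2 = m3"
        using r by (simp add: m1_def m2_def m3_def)
      then show "exec \<tau> (Blk []) m2 2 m3" by (rule exec_BlkI[rotated 2]) simp_all
    qed simp
    define m4 where "m4 = m3(2 := real (Suc (Suc i)))"
    have e4: "exec \<tau> (Blk [Add 2 2 1]) m3 1 m4"
    proof -
      have "fold (eff \<tau>) [Add 2 2 1] m3 = m4"
        using r by (simp add: m1_def m2_def m3_def m4_def)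
      then show ?thesis by (rule exec_BlkI[rotated 2]) simp_all
    qed
    have "exec \<tau> ?body m' 13 m4" unfolding maxmin_body_def
      by (rule exec_Seq[OF e1 exec_Seq[OF e2 exec_Seq[OF e3 e4 order_refl] order_refl]]) simp
    moreover have "I (Suc i) m4"
    proof -
      have fr: "\<forall>x. x \<notin> {2, 3, 4, 5, 8, 9} \<longrightarrow> m4 x = m x"
        using I unfolding I_def m4_def m3_def m2_def m1_def by auto
      have x0: "x \<ge> 0" using pos by (simp add: x_def)
      show ?thesis
      proof (cases "i = 0")
        case True
        then have "m' 3 = -1" using I by (simp add: I_def)
        then have "m4 5 = real 1 \<and> m4 3 = min (f 1) (g 1)" 
          using x0 True by (simp add: m4_def m3_def x_def)
        then show ?thesis unfolding I_def using fr True n by (auto simp: m4_def intro!: bexI[of _ 1])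
      next
        case False
        then obtain w where w: "w \<in> {1..n}" "m' 5 = real w" "m' 3 = min (f w) (g w)"
          "\<And>v. v \<in> {1..i} \<Longrightarrow> min (f v) (g v) \<le> min (f w) (g w)" using I by (auto simp: I_def)
        show ?thesis
        proof (cases "m' 3 < x")
          case True
          have "min (f v) (g v) \<le> x" if "v \<in> {1..Suc i}" for v
            using w(4)[of v] that True w(3) by (cases "v = Suc i") (auto simp: x_def)
          then show ?thesis unfolding I_def using fr True i
            by (auto simp: m4_def m3_def x_def intro!: bexI[of _ "Suc i"])
        next
          case False
          have "min (f v) (g v) \<le> min (f w) (g w)" if "v \<in> {1..Suc i}" for v
            using w(4)[of v] that False w(3) by (cases "v = Suc i") (auto simp: x_def)
          then show ?thesis unfolding I_def using fr False w
            by (auto simp: m4_def m3_def m2_def m1_def intro!: bexI[of _ w])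
        qed
      qed
    qed
    ultimately show "m' 2 < m' 7 \<and> (\<exists>m''. exec \<tau> ?body m' 13 m'' \<and> I (Suc i) m'')"
      using r i by auto
  next
    fix m' assume "I n m'"
    then show "\<not> m' 2 < m' 7" using ok by (simp add: I_def regs_ok_def)
  qed
  then obtain m' where m': "exec \<tau> (Whl 2 7 ?body) m0 (n * (13 + 2) + 2) m'" "I n m'" by blast
  have "exec \<tau> maxmin m (20 * n + 10) m'"
    unfolding maxmin_def by (rule exec_Seq[OF 0 m'(1)]) simp
  moreover have "agree n 9 m m'"
    using m'(2) by (auto simp: I_def agree_def scratch_def)
  ultimately show ?thesis using m'(2) n unfolding I_def by auto
qed

text \<open>The recursion mirrors a register that carries the most recent lens value down the list.
  The default 0 belongs to entries before the first lens vertex; \<open>est_bound\<close> shows that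
  a lens vertex precedes the vertices it treats.\<close>

primrec cal :: "(nat \<Rightarrow> bool) \<Rightarrow> (nat \<Rightarrow> real) \<Rightarrow> nat list \<Rightarrow> nat \<Rightarrow> real" where
  "cal S f l 0 = 0"
| "cal S f l (Suc i) = (if S (l ! i) then f (l ! i) else cal S f l i)"

text \<open>A rank up to the reference \<open>K\<close> means a radius of at most about 1, where the
  rank is itself the estimate; \<open>f w + g w - h w\<close> is the flag identity solved for the
  wanted square. \<open>Suc (pos l w)\<close> includes the entry \<open>w\<close>, so a lens vertex
  gets its own value.\<close>

definition qval :: "real \<Rightarrow> (nat \<Rightarrow> real) \<Rightarrow> (nat \<Rightarrow> real) \<Rightarrow> (nat \<Rightarrow> real) \<Rightarrow> nat list \<Rightarrow> nat \<Rightarrow> real" where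
  "qval K f g h l w = (if K < real (pos l w)
     then cal (\<lambda>w. f w < K \<and> g w < K) (\<lambda>w. f w + g w - h w) l (Suc (pos l w)) else real (pos l w))"

definition calib_body :: "nat \<Rightarrow> nat \<Rightarrow> nat \<Rightarrow> nat \<Rightarrow> nat \<Rightarrow> com" where
  "calib_body u bl br bo bq =
     Blk [Add 4 bl 3, Load 8 4, Add 4 br 3, Load 9 4, Add 4 bo 3, Load 16 4] %;
       Ite 8 15 (Ite 9 15 (Blk [Add 5 8 9, Sub 5 5 16]) (Blk [])) (Blk []) %;
       Blk [Add 4 bq 3] %;
       Ite 15 2 (Blk [Store 4 5]) (Blk [Store 4 2]) %;
       Blk [Succ 3 u 3, Add 2 2 1]"

definition calib :: "nat \<Rightarrow> nat \<Rightarrow> nat \<Rightarrow> nat \<Rightarrow> nat \<Rightarrow> com" where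
  "calib u bl br bo bq = Blk [Const 2 0, Const 5 0, Head 3 u] %;
     Whl 2 0 (calib_body u bl br bo bq)"

lemma exec_calib:
  assumes pl: "perm_lists n \<tau>" and u0: "u0 \<in> {1..n}" and ok: "regs_ok n m"
    and u: "m u = real u0" "u \<notin> scratch" "u < 40" and K: "m 15 = K"
    and j: "jl < 10" "jr < 10" "jo < 10" "jq < 10" "jq \<noteq> jl" "jq \<noteq> jr" "jq \<noteq> jo"
    and f: "arr n jl f m" and g: "arr n jr g m" and h: "arr n jo h m"
  shows "\<exists>m'. exec \<tau> (calib u (20 + jl) (20 + jr) (20 + jo) (20 + jq)) m (25 * n + 10) m' \<and>
    agree n jq m m' \<and> arr n jq (qval K f g h (\<tau> u0)) m'"
proof -
  let ?body = "calib_body u (20 + jl) (20 + jr) (20 + jo) (20 + jq)"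
  define l where "l = \<tau> u0"
  note L = perm_listsD[OF pl u0, folded l_def]
  have n: "n > 0" using u0 by auto
  have lne: "l \<noteq> []" using L n by auto
  define B where "B = base n jq"
  have B: "B \<ge> 100" by (simp add: B_def base_ge)
  have us: "u \<noteq> 2" "u \<noteq> 3" "u \<noteq> 4" "u \<noteq> 5" "u \<noteq> 8" "u \<noteq> 9" "u \<noteq> 16" using u by (auto simp: scratch_def)
  have uB: "u \<noteq> B + x" for x using u B by auto
  have mem: "l ! i \<in> {1..n}" if "i < n" for i using that L nth_mem by metis
  define t where "t = cal (\<lambda>w. f w < K \<and> g w < K) (\<lambda>w. f w + g w - h w) l"
  \<comment> \<open>Register 5 is updated before the store, hence \<open>t (Suc i)\<close> and not
    \<open>t i\<close>.\<close>
  define q where "q = (\<lambda>i. if K < real i then t (Suc i) else real i)"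
  define I where "I = (\<lambda>i m'. (\<forall>x. x \<notin> {2, 3, 4, 5, 8, 9, 16} \<and> x \<notin> {B + 1..B + n} \<longrightarrow> m' x = m x) \<and>
     m' 2 = real i \<and> m' 3 = real (if i < n then l ! i else 0) \<and>
     m' 5 = t i \<and> (\<forall>k<i. m' (B + l ! k) = q k))"
  define m0 where "m0 = fold (eff \<tau>) [Const 2 0, Const 5 0, Head 3 u] m"
  have 0: "exec \<tau> (Blk [Const 2 0, Const 5 0, Head 3 u]) m 3 m0"
    unfolding m0_def by (rule exec_Blk) simp_all
  have I0: "I 0 m0"
    using n us u lhead_nth[of \<tau> u0] lne unfolding I_def m0_def t_def by (simp add: l_def)
  have "\<exists>m'. exec \<tau> (Whl 2 0 ?body) m0 (n * (20 + 2) + 2) m' \<and> I n m'"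
  proof (rule exec_Whl[where I = I])
    show "I 0 m0" by (rule I0)
  next
    fix i m' assume i: "i < n" and I: "I i m'"
    have reg: "m' x = m x" if "x \<notin> {2, 3, 4, 5, 8, 9, 16}" "x < 100" for x
      using I that B by (auto simp: I_def)
    have r: "m' 0 = real n" "m' 1 = 1" "m' 6 = 0" "m' u = real u0" "m' 15 = K"
      "m' (20 + jl) = real (base n jl)" "m' (20 + jr) = real (base n jr)" "m' (20 + jo) = real (base n jo)"
      "m' (20 + jq) = real B"
      using reg ok u us K j unfolding regs_ok_def B_def by simp_all
    have m2: "m' 2 = real i" "m' 3 = real (l ! i)" "m' 5 = t i" using I i by (auto simp: I_def)
    have li: "l ! i \<in> {1..n}" by (rule mem[OF i])
    have ag: "agree n jq m m'" using I by (auto simp: I_def agree_def scratch_def B_def)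
    have fgh: "m' (base n jl + l ! i) = f (l ! i)" "m' (base n jr + l ! i) = g (l ! i)" "m' (base n jo + l ! i) = h (l ! i)"
      using agree_arr[OF ag _ f] agree_arr[OF ag _ g] agree_arr[OF ag _ h] j li by (simp_all add: arr_def)
    have suc: "lsucc \<tau> u0 (l ! i) = (if Suc i < n then l ! Suc i else 0)"
      using lsucc_nth[of \<tau> u0 i] L i by (simp add: l_def)
    have ne: "l ! k \<noteq> l ! i" if "k < i" for k
      using that i L by (simp add: nth_eq_iff_index_eq)
    define m1 where "m1 = m'(8 := f (l ! i), 9 := g (l ! i), 4 := real (base n jo) + real (l ! i), 16 := h (l ! i))"
    have e1: "exec \<tau> (Blk [Add 4 (20 + jl) 3, Load 8 4, Add 4 (20 + jr) 3, Load 9 4, Add 4 (20 + jo) 3, Load 16 4]) m' 6 m1"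
      using fgh r m2 by (intro exec_BlkI) (simp_all add: m1_def fun_eq_iff)
    define m2 where "m2 = m1(5 := t (Suc i))"
    have e2: "exec \<tau> (Ite 8 15 (Ite 9 15 (Blk [Add 5 8 9, Sub 5 5 16]) (Blk [])) (Blk [])) m1 6 m2"
      apply (rule exec_Ite[where t = 4], rule exec_Ite[where t = 2])
      by ((rule exec_BlkI)?; simp add: m1_def m2_def t_def fun_eq_iff r \<open>m' 5 = t i\<close>[unfolded t_def])+
    define m3 where "m3 = m2(4 := real B + real (l ! i))"
    have e3: "exec \<tau> (Blk [Add 4 (20 + jq) 3]) m2 1 m3"
      using r \<open>m' 3 = _\<close> by (intro exec_BlkI) (simp_all add: m1_def m2_def m3_def)
    define m4 where "m4 = m3(B + l ! i := q i)"
    have e4: "exec \<tau> (Ite 15 2 (Blk [Store 4 5]) (Blk [Store 4 2])) m3 3 m4"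
      apply (rule exec_Ite[where t = 1])
      by ((rule exec_BlkI)?; simp add: m1_def m2_def m3_def m4_def q_def r \<open>m' 2 = _\<close>)+
    define m5 where "m5 = m4(3 := real (if Suc i < n then l ! Suc i else 0), 2 := real i + 1)"
    have Bne: "k < 100 \<Longrightarrow> (B + w = k) = False" "k < 100 \<Longrightarrow> (k = B + w) = False" for k w using B by auto
    have e5: "exec \<tau> (Blk [Succ 3 u 3, Add 2 2 1]) m4 2 m5"
      using r \<open>m' 2 = _\<close> \<open>m' 3 = _\<close> suc us uB
      by (intro exec_BlkI) (simp_all add: m1_def m2_def m3_def m4_def m5_def Bne)
    have "exec \<tau> ?body m' 20 m5" unfolding calib_body_def
      by (rule exec_Seq[OF e1 exec_Seq[OF e2 exec_Seq[OF e3 exec_Seq[OF e4 e5 order_refl] order_refl] order_refl]]) simp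
    moreover have "I (Suc i) m5"
      unfolding I_def
    proof (intro conjI allI impI)
      fix x assume x: "x \<notin> {2, 3, 4, 5, 8, 9, 16} \<and> x \<notin> {B + 1..B + n}"
      then have "x \<noteq> B + l ! i" using li by auto
      then have "m5 x = m' x" using x by (simp add: m1_def m2_def m3_def m4_def m5_def)
      also have "\<dots> = m x" using I x by (auto simp: I_def)
      finally show "m5 x = m x" .
    next
      fix k assume "k < Suc i"
      then show "m5 (B + l ! k) = q k"
        using ne[of k] I by (cases "k = i") (auto simp: I_def m1_def m2_def m3_def m4_def m5_def Bne)
    qed (simp_all add: m1_def m2_def m3_def m4_def m5_def Bne)
    ultimately show "m' 2 < m' 0 \<and> (\<exists>m''. exec \<tau> ?body m' 20 m'' \<and> I (Suc i) m'')"
      using r \<open>m' 2 = _\<close> i by auto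
  next
    fix m' assume "I n m'"
    then show "\<not> m' 2 < m' 0" using ok B by (simp add: I_def regs_ok_def)
  qed
  then obtain m' where m': "exec \<tau> (Whl 2 0 ?body) m0 (n * (20 + 2) + 2) m'" "I n m'" by blast
  have "exec \<tau> (calib u (20 + jl) (20 + jr) (20 + jo) (20 + jq)) m (25 * n + 10) m'"
    unfolding calib_def by (rule exec_Seq[OF 0 m'(1)]) simp
  moreover have "agree n jq m m'"
    using m'(2) by (auto simp: I_def agree_def scratch_def B_def)
  moreover have "arr n jq (qval K f g h (\<tau> u0)) m'"
    unfolding arr_def
  proof
    fix w assume "w \<in> {1..n}"
    then have p: "pos l w < n" "l ! pos l w = w" using nth_pos[OF L(1), of w] L by auto
    then have "m' (B + l ! pos l w) = q (pos l w)" using m'(2) unfolding I_def by blast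
    then show "m' (base n jq + w) = qval K f g h (\<tau> u0) w"
      unfolding p(2) by (simp add: B_def q_def t_def qval_def l_def)
  qed
  ultimately show ?thesis by blast
qed

definition outloop_body :: com where
  "outloop_body =
     Blk [Add 4 20 2, Load 31 4, Add 4 21 2, Load 32 4, Add 4 23 2, Load 33 4, Add 4 24 2, Load 34 4,
         Add 4 25 2, Load 35 4, Add 4 26 2, Load 36 4, Add 4 27 2, Load 37 4] %;
       Ite 31 33 (Blk [Sub 8 34 35]) (Blk [Sub 8 37 36]) %;
       Ite 31 32 (Blk [Sub 9 34 37]) (Blk [Sub 9 35 36]) %;
       Blk [Mul 8 8 17, Mul 9 9 17, Add 4 28 2, Add 4 4 2, Store 4 8, Add 4 4 1, Store 4 9, Add 2 2 1]"

definition outloop :: com where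
  "outloop = Blk [Const 2 1] %;
     Whl 2 7 outloop_body"

lemma exec_outloop:
  assumes n: "n \<ge> 1" and ok: "regs_ok n m" and s: "m 17 = s"
    and k: "arr n 0 k0 m" "arr n 1 k1 m" "arr n 3 k3 m"
    and q: "arr n 4 q0 m" "arr n 5 q1 m" "arr n 6 q2 m" "arr n 7 q3 m"
  shows "\<exists>m'. exec \<tau> outloop m (40 * n + 10) m' \<and> agree n 8 m m' \<and>
    (\<forall>v\<in>{1..n}. m' (base n 8 + 2 * v) = (if k0 v < k3 v then q0 v - q1 v else q3 v - q2 v) * s \<and>
       m' (base n 8 + 2 * v + 1) = (if k0 v < k1 v then q0 v - q3 v else q1 v - q2 v) * s)"
proof -
  let ?body = "outloop_body"
  define X where "X v = (if k0 v < k3 v then q0 v - q1 v else q3 v - q2 v)" for v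
  define Y where "Y v = (if k0 v < k1 v then q0 v - q3 v else q1 v - q2 v)" for v
  define B where "B = base n 8"
  have B: "B \<ge> 100" by (simp add: B_def base_ge)
  have Bne: "k < 100 \<Longrightarrow> (B + w = k) = False" "k < 100 \<Longrightarrow> (k = B + w) = False"
     "k < 100 \<Longrightarrow> (Suc (B + w) = k) = False" for k w using B by auto
  define I where "I = (\<lambda>i m'. agree n 8 m m' \<and> m' 2 = real (Suc i) \<and>
     (\<forall>v\<in>{1..i}. m' (B + 2 * v) = X v * s \<and> m' (B + 2 * v + 1) = Y v * s))"
  define m0 where "m0 = m(2 := 1)"
  have 0: "exec \<tau> (Blk [Const 2 1]) m 1 m0"
    unfolding m0_def by (rule exec_BlkI) simp_all
  have I0: "I 0 m0" unfolding I_def m0_def by (simp add: agree_def scratch_def)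
  have "\<exists>m'. exec \<tau> (Whl 2 7 ?body) m0 (n * (28 + 2) + 2) m' \<and> I n m'"
  proof (rule exec_Whl[where I = I])
    show "I 0 m0" by (rule I0)
  next
    fix i m' assume i: "i < n" and I: "I i m'"
    define v where "v = Suc i"
    have v: "v \<in> {1..n}" using i by (simp add: v_def)
    have ag: "agree n 8 m m'" using I by (simp add: I_def)
    have ok': "regs_ok n m'" by (rule agree_regs_ok[OF ag ok])
    have bse: "m' (20 + j) = real (base n j)" if "j < 10" for j using ok' that by (simp add: regs_ok_def)
    have r: "m' (Suc 0) = 1" "m' 7 = real n + 1" "m' 2 = real v" "m' 17 = s"
      "m' 20 = real (base n 0)" "m' 21 = real (base n 1)" "m' 23 = real (base n 3)" "m' 24 = real (base n 4)"
      "m' 25 = real (base n 5)" "m' 26 = real (base n 6)" "m' 27 = real (base n 7)" "m' 28 = real B"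
      using I ok' s agree_reg[OF ag, of 17] bse[of 0] bse[of 1] bse[of 3] bse[of 4] bse[of 5] bse[of 6] bse[of 7] bse[of 8]
      by (simp_all add: I_def regs_ok_def scratch_def v_def B_def)
    have kq: "m' (base n 0 + v) = k0 v" "m' (base n (Suc 0) + v) = k1 v" "m' (base n 3 + v) = k3 v"
      "m' (base n 4 + v) = q0 v" "m' (base n 5 + v) = q1 v" "m' (base n 6 + v) = q2 v" "m' (base n 7 + v) = q3 v"
      using k q[THEN agree_arr[OF ag, rotated]] k[THEN agree_arr[OF ag, rotated]] v by (simp_all add: arr_def)
    define m1 where "m1 = m'(31 := k0 v, 32 := k1 v, 33 := k3 v, 34 := q0 v, 35 := q1 v, 36 := q2 v,
       4 := real (base n 7) + real v, 37 := q3 v)"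
    have e1: "exec \<tau> (Blk [Add 4 20 2, Load 31 4, Add 4 21 2, Load 32 4, Add 4 23 2, Load 33 4, Add 4 24 2, Load 34 4,
         Add 4 25 2, Load 35 4, Add 4 26 2, Load 36 4, Add 4 27 2, Load 37 4]) m' 14 m1"
      by (rule exec_BlkI) (simp_all add: m1_def r kq)
    define m2 where "m2 = m1(8 := X v)"
    have e2: "exec \<tau> (Ite 31 33 (Blk [Sub 8 34 35]) (Blk [Sub 8 37 36])) m1 3 m2"
      apply (rule exec_Ite[where t = 1])
      by ((rule exec_BlkI)?; simp add: m1_def m2_def X_def)+
    define m3 where "m3 = m2(9 := Y v)"
    have e3: "exec \<tau> (Ite 31 32 (Blk [Sub 9 34 37]) (Blk [Sub 9 35 36])) m2 3 m3"
      apply (rule exec_Ite[where t = 1])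
      by ((rule exec_BlkI)?; simp add: m1_def m2_def m3_def Y_def)+
    have ad: "addr (2 * real v + real B) = B + 2 * v" "addr (2 * real v + real B + 1) = Suc (B + 2 * v)"
      using addr_simps(1)[of "B + 2 * v"] addr_simps(1)[of "B + 2 * v + 1"] by (simp_all add: add_ac)
    define m4 where "m4 = m3(8 := X v * s, 9 := Y v * s, B + 2 * v := X v * s,
       4 := real B + real v + real v + 1, B + 2 * v + 1 := Y v * s, 2 := real v + 1)"
    have e4: "exec \<tau> (Blk [Mul 8 8 17, Mul 9 9 17, Add 4 28 2, Add 4 4 2, Store 4 8, Add 4 4 1, Store 4 9, Add 2 2 1]) m3 8 m4"
      by (rule exec_BlkI) (use B in \<open>simp_all add: m1_def m2_def m3_def m4_def r ad Bne\<close>)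
    have "exec \<tau> ?body m' 28 m4" unfolding outloop_body_def
      by (rule exec_Seq[OF e1 exec_Seq[OF e2 exec_Seq[OF e3 e4 order_refl] order_refl]]) simp
    moreover have "I (Suc i) m4"
      unfolding I_def
    proof (intro conjI ballI)
      have "agree n 8 m' m4"
        unfolding agree_def
      proof (intro allI impI)
        fix x assume x: "x \<notin> scratch \<and> x \<notin> {base n 8 + 1..base n 8 + (2 * n + 1)}"
        have "x \<notin> {2, 4, 8, 9, 31, 32, 33, 34, 35, 36, 37}" using x by (auto simp: scratch_def)
        moreover have "x \<noteq> B + 2 * v" "x \<noteq> B + 2 * v + 1" using x v by (auto simp: B_def)
        ultimately show "m4 x = m' x" by (simp add: m1_def m2_def m3_def m4_def)
      qed
      then show "agree n 8 m m4" by (rule agree_trans[OF ag])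
      show "m4 2 = real (Suc (Suc i))" by (simp add: m4_def v_def)
      fix k assume "k \<in> {1..Suc i}"
      then consider "k = v" | "k \<in> {1..i}" "k < v" by (cases "k = v") (auto simp: v_def)
      then show "m4 (B + 2 * k) = X k * s" "m4 (B + 2 * k + 1) = Y k * s"
        using I by (cases; simp add: I_def m1_def m2_def m3_def m4_def Bne; presburger)+
    qed
    ultimately show "m' 2 < m' 7 \<and> (\<exists>m''. exec \<tau> ?body m' 28 m'' \<and> I (Suc i) m'')"
      using r i by (auto simp: v_def)
  next
    fix m' assume I: "I n m'"
    then have "regs_ok n m'" using ok agree_regs_ok unfolding I_def by blast
    then show "\<not> m' 2 < m' 7" using I by (simp add: I_def regs_ok_def)
  qed
  then obtain m' where m': "exec \<tau> (Whl 2 7 ?body) m0 (n * (28 + 2) + 2) m'" "I n m'" by blast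
  have "exec \<tau> outloop m (40 * n + 10) m'"
    unfolding outloop_def by (rule exec_Seq[OF 0 m'(1)]) simp
  then show ?thesis using m'(2) unfolding I_def B_def X_def Y_def by blast
qed

text \<open>Cells below 40 must remain registers while a loop runs, so only the output cells from 40
  on are moved here; straight-line code finishes the rest.\<close>

definition copyloop :: com where
  "copyloop = Blk [Const 2 40, Add 3 7 7] %; Whl 2 3 (Blk [Add 4 28 2, Load 8 4, Store 2 8, Add 2 2 1])"

lemma exec_copyloop:
  assumes ok: "regs_ok n m"
  shows "\<exists>m'. exec \<tau> copyloop m (12 * n + 20) m' \<and> m' 28 = real (base n 8) \<and> m' 6 = 0 \<and>
    (\<forall>x\<in>{40..2 * n + 1}. m' x = m (base n 8 + x)) \<and> (\<forall>x\<in>{2..<40}. m' (base n 8 + x) = m (base n 8 + x))"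
proof -
  let ?is = "[Add 4 28 2, Load 8 4, Store 2 8, Add 2 2 1]"
  define B where "B = base n 8"
  have B: "B \<ge> 100" "B \<ge> 2 * n + 100" by (simp_all add: B_def base_def)
  \<comment> \<open>Truncated subtraction: for n at most 19 there is nothing to move and the loop is
    skipped.\<close>
  define N where "N = 2 * n + 2 - 40"
  define I where "I = (\<lambda>i m'. (\<forall>x. x \<notin> {2, 3, 4, 8} \<and> x \<notin> {40..<40 + i} \<longrightarrow> m' x = m x) \<and>
    m' 2 = real (40 + i) \<and> m' 3 = real (2 * n + 2) \<and> (\<forall>x\<in>{40..<40 + i}. m' x = m (B + x)))"
  define m0 where "m0 = m(2 := 40, 3 := real (2 * n + 2))"
  have r0: "m 7 = real n + 1" "m 1 = 1" "m 6 = 0" "m 28 = real B"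
    using ok spec[of "\<lambda>j. j < 10 \<longrightarrow> m (20 + j) = real (base n j)" 8] by (simp_all add: regs_ok_def B_def)
  have 0: "exec \<tau> (Blk [Const 2 40, Add 3 7 7]) m 2 m0"
    unfolding m0_def using r0 by (intro exec_BlkI) (simp_all add: algebra_simps)
  have I0: "I 0 m0" unfolding I_def m0_def by simp
  have "\<exists>m'. exec \<tau> (Whl 2 3 (Blk ?is)) m0 (N * (4 + 2) + 2) m' \<and> I N m'"
  proof (rule exec_Whl[where I = I])
    show "I 0 m0" by (rule I0)
  next
    fix i m' assume i: "i < N" and I: "I i m'"
    define v where "v = 40 + i"
    have v: "v \<ge> 40" "v < 2 * n + 2" using i by (simp_all add: v_def N_def)
    have r: "m' 28 = real B" "m' 1 = 1" "m' 2 = real v" "m' (B + v) = m (B + v)"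
      using I r0 B v by (auto simp: I_def v_def)
    have Bne: "(B + v = 4) = False" using B by auto
    define m1 where "m1 = m'(4 := real B + real v, 8 := m (B + v), v := m (B + v), 2 := real v + 1)"
    have "exec \<tau> (Blk ?is) m' 4 m1"
      using r v Bne by (intro exec_BlkI) (simp_all add: m1_def)
    moreover have "I (Suc i) m1"
      using I v unfolding I_def m1_def by (auto simp: v_def)
    ultimately show "m' 2 < m' 3 \<and> (\<exists>m''. exec \<tau> (Blk ?is) m' 4 m'' \<and> I (Suc i) m'')"
      using I i by (auto simp: I_def N_def)
  next
    fix m' assume "I N m'"
    then show "\<not> m' 2 < m' 3" by (simp add: I_def N_def)
  qed
  then obtain m' where m': "exec \<tau> (Whl 2 3 (Blk ?is)) m0 (N * (4 + 2) + 2) m'" "I N m'" by blast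
  have "exec \<tau> copyloop m (12 * n + 20) m'"
    unfolding copyloop_def by (rule exec_Seq[OF 0 m'(1)]) (simp add: N_def)
  moreover have "m' 28 = real B" "m' 6 = 0" using m'(2) r0 by (simp_all add: I_def)
  moreover have "\<forall>x\<in>{40..2 * n + 1}. m' x = m (B + x)" using m'(2) by (simp add: I_def N_def)
  moreover have "\<forall>x\<in>{2..<40}. m' (B + x) = m (B + x)" using m'(2) B by (simp add: I_def N_def)
  ultimately show ?thesis unfolding B_def by blast
qed

text \<open>Each output cell serves as its own address register. Only register 0 is needed besides,
  to hold the base, and the outputs start at cell 2.\<close>

definition fixup :: com where
  "fixup = Blk (Add 0 28 6 # concat (map (\<lambda>i. [Const i (int i), Add i i 0, Load i i]) [2..<40]))"

text \<open>The written cells lie below 40 and the sources above 100, so no source is destroyed by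
  an earlier copy.\<close>

lemma fold_fixup:
  assumes "m 0 = real B" "B \<ge> 100" "set xs \<subseteq> {2..<40}" "distinct xs"
  shows "fold (eff \<tau>) (concat (map (\<lambda>i. [Const i (int i), Add i i 0, Load i i]) xs)) m =
    (\<lambda>x. if x \<in> set xs then m (B + x) else m x)"
  using assms
proof (induction xs arbitrary: m)
  case (Cons i xs)
  define m1 where "m1 = m(i := m (B + i))"
  have "addr (real i + real B) = B + i" by (simp add: add.commute)
  then have "fold (eff \<tau>) [Const i (int i), Add i i 0, Load i i] m = m1"
    using Cons.prems by (auto simp: m1_def fun_eq_iff add.commute)
  moreover have "m1 0 = real B" using Cons.prems by (auto simp: m1_def)
  ultimately have "fold (eff \<tau>) (concat (map (\<lambda>i. [Const i (int i), Add i i 0, Load i i]) (i # xs))) m =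
      (\<lambda>x. if x \<in> set xs then m1 (B + x) else m1 x)"
    using Cons.prems Cons.IH[of m1] by (simp only: list.map concat.simps fold_append comp_apply) simp
  also have "\<dots> = (\<lambda>x. if x \<in> set (i # xs) then m (B + x) else m x)"
    using Cons.prems by (auto simp: m1_def fun_eq_iff)
  finally show ?case .
qed simp

lemma exec_fixup:
  assumes "m 28 = real B" "m 6 = 0" "B \<ge> 100"
  shows "\<exists>m'. exec \<tau> fixup m 200 m' \<and> (\<forall>x\<in>{2..<40}. m' x = m (B + x)) \<and> (\<forall>x\<ge>40. m' x = m x)"
proof -
  define ys where "ys = concat (map (\<lambda>i. [Const i (int i), Add i i 0, Load i i]) [2..<40])"
  have "list_all basic (Add 0 28 6 # ys)" by (auto simp: list_all_iff ys_def)
  moreover have "length (Add 0 28 6 # ys) \<le> 200"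
    by (simp add: ys_def length_concat comp_def sum_list_triv)
  moreover have "fold (eff \<tau>) (Add 0 28 6 # ys) m = (\<lambda>x. if x \<in> set [2..<40] then (m(0 := real B)) (B + x) else (m(0 := real B)) x)"
  proof -
    have "fold (eff \<tau>) (Add 0 28 6 # ys) m = fold (eff \<tau>) ys (m(0 := real B))"
      using assms by simp
    also have "\<dots> = (\<lambda>x. if x \<in> set [2..<40] then (m(0 := real B)) (B + x) else (m(0 := real B)) x)"
      unfolding ys_def by (rule fold_fixup) (use assms in auto)
    finally show ?thesis .
  qed
  ultimately show ?thesis
    unfolding fixup_def ys_def[symmetric] using assms(3)
    by (intro exec_Blk_ex) (simp_all del: upt_rec_numeral fold_Cons fold.simps)
qed

text \<open>Registers 10 to 13 hold \<open>a, b, c, d\<close>, register 14 the vertex that leads to \<open>d\<close>, register 15 the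
  reference rank of \<open>b\<close> in \<open>\<tau>\<^sub>a\<close> and register 17 the final scaling factor.\<close>
definition main_prog :: com where
  "main_prog =
     Blk [Const 1 1, Const 6 0, Add 7 0 1, Const 18 100, Add 19 0 0, Add 19 19 18, Add 20 19 6,
       Add 21 20 19, Add 22 21 19, Add 23 22 19, Add 24 23 19, Add 25 24 19, Add 26 25 19, Add 27 26 19,
       Add 28 27 19, Add 29 28 19, Const 30 1] %;
     walk 30 29 %; Blk [Add 10 5 6] %; walk 10 20 %; Blk [Add 12 5 6] %; walk 12 22 %;
     maxmin %; Blk [Add 14 5 6] %; walk 14 29 %; Blk [Add 13 5 6] %; walk 13 23 %; Blk [Add 11 5 6] %;
     walk 11 21 %; Blk [Add 4 20 11, Load 15 4] %;
     calib 10 21 23 22 24 %; calib 11 20 22 23 25 %; calib 12 21 23 20 26 %; calib 13 20 22 21 27 %;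
     Blk [Sqrt 17 0, Dv 17 17 15, Const 18 2, Dv 17 17 18] %;
     outloop %; copyloop %; fixup"

text \<open>The estimate is proportional to the squared distance from the source of \<open>l\<close>; \<open>l1\<close> and
  \<open>l2\<close> belong to the neighbouring corners, \<open>l3\<close> to the opposite one.\<close>
definition est :: "real \<Rightarrow> nat list \<Rightarrow> nat list \<Rightarrow> nat list \<Rightarrow> nat list \<Rightarrow> nat \<Rightarrow> real" where
  "est K l l1 l2 l3 = qval K (\<lambda>w. real (pos l1 w)) (\<lambda>w. real (pos l2 w)) (\<lambda>w. real (pos l3 w)) l"

text \<open>The squared distances to the two ends of a horizontal side differ by 2x - 1 in the unit
  square. The comparison of ranks picks the side nearer to \<open>v\<close>, so that both distances
  stay in the range where \<open>est\<close> is accurate.\<close>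

definition out_x :: "real \<Rightarrow> nat list \<Rightarrow> nat list \<Rightarrow> nat list \<Rightarrow> nat list \<Rightarrow> nat \<Rightarrow> real" where
  "out_x K A B C D v = (if pos A v < pos D v then est K A B D C v - est K B A C D v
     else est K D A C B v - est K C B D A v)"

definition out_y :: "real \<Rightarrow> nat list \<Rightarrow> nat list \<Rightarrow> nat list \<Rightarrow> nat list \<Rightarrow> nat \<Rightarrow> real" where
  "out_y K A B C D v = (if pos A v < pos B v then est K A B D C v - est K D A C B v
     else est K B A C D v - est K C B D A v)"

text \<open>The existential over \<open>e\<close> admits any maximiser, so the tie breaking of the
  loop does not enter. Since \<open>K\<close> is about \<kappa> n, the differences divided by
  \<open>2 * K\<close> are coordinates in a unit square centred at the origin, and sqrt n restores
  the scale.\<close>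

definition alg :: "nat \<Rightarrow> (nat \<Rightarrow> nat list) \<Rightarrow> (nat \<Rightarrow> real \<times> real) \<Rightarrow> bool" where
  "alg n \<tau> out \<longleftrightarrow> (\<exists>a b c d e. a = last (\<tau> 1) \<and> c = last (\<tau> a) \<and> e \<in> {1..n} \<and>
     (\<forall>v\<in>{1..n}. min (pos (\<tau> a) v) (pos (\<tau> c) v) \<le> min (pos (\<tau> a) e) (pos (\<tau> c) e)) \<and>
     d = last (\<tau> e) \<and> b = last (\<tau> d) \<and>
     (let K = real (pos (\<tau> a) b); s = sqrt (real n) / K / 2 in
     \<forall>v\<in>{1..n}. out v = (out_x K (\<tau> a) (\<tau> b) (\<tau> c) (\<tau> d) v * s, out_y K (\<tau> a) (\<tau> b) (\<tau> c) (\<tau> d) v * s)))"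

lemma last_in: 
  assumes "perm_lists n \<tau>" "u \<in> {1..n}"
  shows "last (\<tau> u) \<in> {1..n}"
proof -
  have "\<tau> u \<noteq> []" using perm_listsD[OF assms] assms(2) by auto
  then show ?thesis using perm_listsD[OF assms] last_in_set by blast
qed

lemma exec_set_reg:
  assumes "regs_ok n m" "r \<in> {10..<20}" "r \<notin> scratch"
  shows "exec \<tau> (Blk [Add r 5 6]) m 1 (m(r := m 5))" "regs_ok n (m(r := m 5))"
    "arr n j f m \<Longrightarrow> arr n j f (m(r := m 5))"
  using assms by (auto simp: regs_ok_def arr_def intro!: exec_BlkI)

text \<open>After each block the frame lemmas \<open>agree_regs_ok\<close>, \<open>agree_arr\<close>
  and \<open>agree_reg\<close> carry the registers and the finished arrays over to the next
  state.\<close>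

lemma exec_main:
  assumes n: "n \<ge> 1" and pl: "perm_lists n \<tau>"
  shows "\<exists>m'. exec \<tau> main_prog ((\<lambda>_. 0)(0 := real n)) (300 * n + 1000) m' \<and>
     alg n \<tau> (\<lambda>v. (m' (2 * v), m' (2 * v + 1)))"
proof -
  let ?k = "\<lambda>u w. real (pos (\<tau> u) w)"
  define a where "a = last (\<tau> 1)"
  define c where "c = last (\<tau> a)"
  have 1: "1 \<in> {1..n}" using n by auto
  have a: "a \<in> {1..n}" unfolding a_def by (rule last_in[OF pl 1])
  have c: "c \<in> {1..n}" unfolding c_def by (rule last_in[OF pl a])
  define is0 where "is0 = [Const 1 1, Const 6 0, Add 7 0 1, Const 18 100, Add 19 0 0, Add 19 19 18, Add 20 19 6,
       Add 21 20 19, Add 22 21 19, Add 23 22 19, Add 24 23 19, Add 25 24 19, Add 26 25 19, Add 27 26 19,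
       Add 28 27 19, Add 29 28 19, Const 30 1]"
  define m0 where "m0 = fold (eff \<tau>) is0 ((\<lambda>_. 0)(0 := real n))"
  have e0: "exec \<tau> (Blk is0) ((\<lambda>_. 0)(0 := real n)) 17 m0"
    unfolding m0_def by (rule exec_Blk) (simp_all add: is0_def)
  have c10: "j < 10 \<Longrightarrow> j \<in> {0,1,2,3,4,5,6,7,8,9}" for j :: nat by auto
  have ok0: "regs_ok n m0" and "m0 30 = real 1"
    unfolding m0_def is0_def regs_ok_def by (auto dest!: c10 simp: base_def algebra_simps)
  then obtain m1 where e1: "exec \<tau> (walk 30 29) m0 (9 * n + 10) m1" and g1: "agree n 9 m0 m1" and r1: "m1 5 = real a"
    using exec_walk[OF pl 1 ok0, of 30 9] by (auto simp: scratch_def a_def)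
  note ok1 = agree_regs_ok[OF g1 ok0]
  define m2 where "m2 = m1(10 := m1 5)"
  have e2: "exec \<tau> (Blk [Add 10 5 6]) m1 1 m2" and ok2: "regs_ok n m2"
    unfolding m2_def using exec_set_reg[OF ok1, of 10] by (auto simp: scratch_def)
  have r2: "m2 10 = real a" using r1 by (simp add: m2_def)
  obtain m3 where e3: "exec \<tau> (walk 10 20) m2 (9 * n + 10) m3" and g3: "agree n 0 m2 m3" and r3: "m3 5 = real c"
    and k03: "arr n 0 (?k a) m3"
    using exec_walk[OF pl a ok2, of 10 0] r2 by (auto simp: scratch_def c_def)
  note ok3 = agree_regs_ok[OF g3 ok2]
  define m4 where "m4 = m3(12 := m3 5)"
  have e4: "exec \<tau> (Blk [Add 12 5 6]) m3 1 m4" and ok4: "regs_ok n m4"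
    and k04: "arr n 0 (?k a) m4"
    unfolding m4_def using exec_set_reg[OF ok3, of 12] k03 by (auto simp: scratch_def)
  have r4: "m4 10 = real a" "m4 12 = real c" using r2 r3 agree_reg[OF g3, of 10] by (auto simp: m4_def scratch_def)
  obtain m5 where e5: "exec \<tau> (walk 12 22) m4 (9 * n + 10) m5" and g5: "agree n 2 m4 m5"
    and k25: "arr n 2 (?k c) m5"
    using exec_walk[OF pl c ok4, of 12 2] r4 by (auto simp: scratch_def)
  note ok5 = agree_regs_ok[OF g5 ok4]
  have k05: "arr n 0 (?k a) m5" by (rule agree_arr[OF g5 _ k04]) simp
  have r5: "m5 10 = real a" "m5 12 = real c" using r4 agree_reg[OF g5] by (auto simp: scratch_def)
  obtain m6 e where e6: "exec \<tau> maxmin m5 (20 * n + 10) m6" and g6: "agree n 9 m5 m6" and e: "e \<in> {1..n}" and r6: "m6 5 = real e"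
    and mx: "\<forall>v\<in>{1..n}. min (real (pos (\<tau> a) v)) (real (pos (\<tau> c) v)) \<le> min (real (pos (\<tau> a) e)) (real (pos (\<tau> c) e))"
    using exec_maxmin[OF n ok5 k05 k25, of \<tau>] by auto
  have mx': "min (pos (\<tau> a) v) (pos (\<tau> c) v) \<le> min (pos (\<tau> a) e) (pos (\<tau> c) e)" if "v \<in> {1..n}" for v
    using bspec[OF mx that] by (auto simp: min_def split: if_splits)
  define d where "d = last (\<tau> e)"
  define b where "b = last (\<tau> d)"
  have d: "d \<in> {1..n}" unfolding d_def by (rule last_in[OF pl e])
  have b: "b \<in> {1..n}" unfolding b_def by (rule last_in[OF pl d])
  note ok6 = agree_regs_ok[OF g6 ok5]
  have k6: "arr n 0 (?k a) m6" "arr n 2 (?k c) m6"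
    by (rule agree_arr[OF g6 _ k05] agree_arr[OF g6 _ k25], simp)+
  define m7 where "m7 = m6(14 := m6 5)"
  have e7: "exec \<tau> (Blk [Add 14 5 6]) m6 1 m7" and ok7: "regs_ok n m7"
    and k7: "arr n 0 (?k a) m7" "arr n 2 (?k c) m7"
    unfolding m7_def using exec_set_reg[OF ok6, of 14] k6 by (auto simp: scratch_def)
  have r7: "m7 10 = real a" "m7 12 = real c" "m7 14 = real e" using r5 r6 agree_reg[OF g6] by (auto simp: m7_def scratch_def)
  obtain m8 where e8: "exec \<tau> (walk 14 29) m7 (9 * n + 10) m8" and g8: "agree n 9 m7 m8" and d8: "m8 5 = real d"
    using exec_walk[OF pl e ok7, of 14 9] r7 by (auto simp: scratch_def d_def)
  note ok8 = agree_regs_ok[OF g8 ok7]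
  have k8: "arr n 0 (?k a) m8" "arr n 2 (?k c) m8"
    by (rule k7[THEN agree_arr[OF g8, rotated]], simp)+
  have r8: "m8 10 = real a" "m8 12 = real c" using r7 agree_reg[OF g8] by (auto simp: scratch_def)
  define m9 where "m9 = m8(13 := m8 5)"
  have e9: "exec \<tau> (Blk [Add 13 5 6]) m8 1 m9" and ok9: "regs_ok n m9"
    and k9: "arr n 0 (?k a) m9" "arr n 2 (?k c) m9"
    unfolding m9_def using exec_set_reg[OF ok8, of 13] k8 by (auto simp: scratch_def)
  have r9: "m9 10 = real a" "m9 12 = real c" "m9 13 = real d" using r8 d8 by (auto simp: m9_def)
  obtain m10 where e10: "exec \<tau> (walk 13 23) m9 (9 * n + 10) m10" and g10: "agree n 3 m9 m10" and b10: "m10 5 = real b"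
    and k310: "arr n 3 (?k d) m10"
    using exec_walk[OF pl d ok9, of 13 3] r9 by (auto simp: scratch_def b_def)
  note ok10 = agree_regs_ok[OF g10 ok9]
  have k10: "arr n 0 (?k a) m10" "arr n 2 (?k c) m10"
    by (rule k9[THEN agree_arr[OF g10, rotated]], simp)+
  have r10: "m10 10 = real a" "m10 12 = real c" "m10 13 = real d" using r9 agree_reg[OF g10] by (auto simp: scratch_def)
  define m11 where "m11 = m10(11 := m10 5)"
  have e11: "exec \<tau> (Blk [Add 11 5 6]) m10 1 m11" and ok11: "regs_ok n m11"
    and k11: "arr n 0 (?k a) m11" "arr n 2 (?k c) m11" "arr n 3 (?k d) m11"
    unfolding m11_def using exec_set_reg[OF ok10, of 11] k10 k310 by (auto simp: scratch_def)
  have r11: "m11 10 = real a" "m11 12 = real c" "m11 13 = real d" "m11 11 = real b" using r10 b10 by (auto simp: m11_def)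
  obtain m12 where e12: "exec \<tau> (walk 11 21) m11 (9 * n + 10) m12" and g12: "agree n 1 m11 m12"
    and k112: "arr n 1 (?k b) m12"
    using exec_walk[OF pl b ok11, of 11 1] r11 by (auto simp: scratch_def)
  note ok12 = agree_regs_ok[OF g12 ok11]
  have k12: "arr n 0 (?k a) m12" "arr n 2 (?k c) m12" "arr n 3 (?k d) m12"
    by (rule k11[THEN agree_arr[OF g12, rotated]], simp)+
  have r12: "m12 10 = real a" "m12 12 = real c" "m12 13 = real d" "m12 11 = real b" using r11 agree_reg[OF g12] by (auto simp: scratch_def)
  define K where "K = real (pos (\<tau> a) b)"
  define m13 where "m13 = m12(4 := real (base n 0) + real b, 15 := K)"
  have "m12 (base n 0 + b) = K" using k12(1) b by (simp add: arr_def K_def)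
  moreover have "m12 20 = real (base n 0)" using ok12 spec[of "\<lambda>j. j < 10 \<longrightarrow> m12 (20 + j) = real (base n j)" 0]
    by (simp add: regs_ok_def)
  ultimately have e13: "exec \<tau> (Blk [Add 4 20 11, Load 15 4]) m12 2 m13"
    using r12 by (intro exec_BlkI) (simp_all add: m13_def)
  have ok13: "regs_ok n m13" using ok12 by (simp add: regs_ok_def m13_def)
  have k13: "arr n 0 (?k a) m13" "arr n 1 (?k b) m13"
     "arr n 2 (?k c) m13" "arr n 3 (?k d) m13"
    using k12 k112 by (simp_all add: arr_def m13_def)
  have r13: "m13 10 = real a" "m13 11 = real b" "m13 12 = real c" "m13 13 = real d" "m13 15 = K" using r12 by (simp_all add: m13_def)
  obtain m14 where e14: "exec \<tau> (calib 10 21 23 22 24) m13 (25 * n + 10) m14" and g14: "agree n 4 m13 m14"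
    and q414: "arr n 4 (est K (\<tau> a) (\<tau> b) (\<tau> d) (\<tau> c)) m14"
    using exec_calib[OF pl a ok13 r13(1) _ _ r13(5) _ _ _ _ _ _ _ k13(2) k13(4) k13(3), of 4] by (auto simp: scratch_def est_def)
  note ok14 = agree_regs_ok[OF g14 ok13]
  note k14 = k13[THEN agree_arr[OF g14, rotated]]
  have r14: "m14 10 = real a" "m14 11 = real b" "m14 12 = real c" "m14 13 = real d" "m14 15 = K" using r13 agree_reg[OF g14] by (auto simp: scratch_def)
  obtain m15 where e15: "exec \<tau> (calib 11 20 22 23 25) m14 (25 * n + 10) m15" and g15: "agree n 5 m14 m15"
    and q515: "arr n 5 (est K (\<tau> b) (\<tau> a) (\<tau> c) (\<tau> d)) m15"
    using exec_calib[OF pl b ok14 r14(2) _ _ r14(5) _ _ _ _ _ _ _ k14(1) k14(3) k14(4), of 5] by (auto simp: scratch_def est_def)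
  note ok15 = agree_regs_ok[OF g15 ok14]
  note k15 = k14[THEN agree_arr[OF g15, rotated]]
  have r15: "m15 10 = real a" "m15 11 = real b" "m15 12 = real c" "m15 13 = real d" "m15 15 = K" using r14 agree_reg[OF g15] by (auto simp: scratch_def)
  obtain m16 where e16: "exec \<tau> (calib 12 21 23 20 26) m15 (25 * n + 10) m16" and g16: "agree n 6 m15 m16"
    and q616: "arr n 6 (est K (\<tau> c) (\<tau> b) (\<tau> d) (\<tau> a)) m16"
    using exec_calib[OF pl c ok15 r15(3) _ _ r15(5) _ _ _ _ _ _ _ k15(2) k15(4) k15(1), of 6] by (auto simp: scratch_def est_def)
  note ok16 = agree_regs_ok[OF g16 ok15]
  note k16 = k15[THEN agree_arr[OF g16, rotated]]
  have r16: "m16 10 = real a" "m16 11 = real b" "m16 12 = real c" "m16 13 = real d" "m16 15 = K" using r15 agree_reg[OF g16] by (auto simp: scratch_def)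
  obtain m17 where e17: "exec \<tau> (calib 13 20 22 21 27) m16 (25 * n + 10) m17" and g17: "agree n 7 m16 m17"
    and q717: "arr n 7 (est K (\<tau> d) (\<tau> a) (\<tau> c) (\<tau> b)) m17"
    using exec_calib[OF pl d ok16 r16(4) _ _ r16(5) _ _ _ _ _ _ _ k16(1) k16(3) k16(2), of 7] by (auto simp: scratch_def est_def)
  note ok17 = agree_regs_ok[OF g17 ok16]
  have k17: "arr n 0 (?k a) m17" "arr n 1 (?k b) m17" "arr n 3 (?k d) m17"
    using k16[THEN agree_arr[OF g17, rotated]] by simp_all
  have q17: "arr n 4 (est K (\<tau> a) (\<tau> b) (\<tau> d) (\<tau> c)) m17" "arr n 5 (est K (\<tau> b) (\<tau> a) (\<tau> c) (\<tau> d)) m17"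
    "arr n 6 (est K (\<tau> c) (\<tau> b) (\<tau> d) (\<tau> a)) m17"
    using q414 q515 q616 agree_arr[OF g15] agree_arr[OF g16] agree_arr[OF g17] by simp_all
  have r17: "m17 15 = K" "m17 0 = real n" using r16 agree_reg[OF g17] ok17 by (auto simp: scratch_def regs_ok_def)
  define s where "s = sqrt (real n) / K / 2"
  define m18 where "m18 = m17(18 := 2, 17 := s)"
  have e18: "exec \<tau> (Blk [Sqrt 17 0, Dv 17 17 15, Const 18 2, Dv 17 17 18]) m17 4 m18"
    using r17 by (intro exec_BlkI) (simp_all add: m18_def s_def)
  have ok18: "regs_ok n m18" using ok17 by (simp add: regs_ok_def m18_def)
  have kq18: "arr n j f m17 \<Longrightarrow> arr n j f m18" for j f by (simp add: arr_def m18_def)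
  have s18: "m18 17 = s" by (simp add: m18_def)
  obtain m19 where e19: "exec \<tau> outloop m18 (40 * n + 10) m19" and g19: "agree n 8 m18 m19"
    and o19: "\<forall>v\<in>{1..n}. m19 (base n 8 + 2 * v) = out_x K (\<tau> a) (\<tau> b) (\<tau> c) (\<tau> d) v * s \<and>
       m19 (base n 8 + 2 * v + 1) = out_y K (\<tau> a) (\<tau> b) (\<tau> c) (\<tau> d) v * s"
    using exec_outloop[OF n ok18 s18 k17[THEN kq18] q17[THEN kq18] kq18[OF q717], of \<tau>]
    unfolding out_x_def out_y_def of_nat_less_iff by blast
  obtain m20 where e20: "exec \<tau> copyloop m19 (12 * n + 20) m20" and r20: "m20 28 = real (base n 8)" "m20 6 = 0"
    and c20: "\<forall>x\<in>{40..2 * n + 1}. m20 x = m19 (base n 8 + x)" "\<forall>x\<in>{2..<40}. m20 (base n 8 + x) = m19 (base n 8 + x)"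
    using exec_copyloop[OF agree_regs_ok[OF g19 ok18], of \<tau>] by blast
  obtain m21 where e21: "exec \<tau> fixup m20 200 m21" and c21: "\<forall>x\<in>{2..<40}. m21 x = m20 (base n 8 + x)" "\<forall>x\<ge>40. m21 x = m20 x"
    using exec_fixup[OF r20 base_ge] by blast
  have o21: "m21 x = m19 (base n 8 + x)" if "x \<in> {2..2 * n + 1}" for x
    using that c20 c21 by (cases "x < 40") auto
  have "exec \<tau> main_prog ((\<lambda>_. 0)(0 := real n)) (300 * n + 1000) m21"
    unfolding main_prog_def is0_def[symmetric]
    by (rule exec_Seq[OF e0 exec_Seq[OF e1 exec_Seq[OF e2 exec_Seq[OF e3 exec_Seq[OF e4 exec_Seq[OF e5
       exec_Seq[OF e6 exec_Seq[OF e7 exec_Seq[OF e8 exec_Seq[OF e9 exec_Seq[OF e10 exec_Seq[OF e11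
       exec_Seq[OF e12 exec_Seq[OF e13 exec_Seq[OF e14 exec_Seq[OF e15 exec_Seq[OF e16 exec_Seq[OF e17
       exec_Seq[OF e18 exec_Seq[OF e19 exec_Seq[OF e20 e21
       order_refl] order_refl] order_refl] order_refl] order_refl] order_refl] order_refl] order_refl]
       order_refl] order_refl] order_refl] order_refl] order_refl] order_refl] order_refl] order_refl]
       order_refl] order_refl] order_refl] order_refl]]) simp
  moreover have "alg n \<tau> (\<lambda>v. (m21 (2 * v), m21 (2 * v + 1)))"
    unfolding alg_def Let_def
  proof (rule exI[of _ a], rule exI[of _ b], rule exI[of _ c], rule exI[of _ d], rule exI[of _ e], intro conjI ballI)
    fix v assume v: "v \<in> {1..n}"
    have "m21 (2 * v) = m19 (base n 8 + 2 * v)" "m21 (2 * v + 1) = m19 (base n 8 + (2 * v + 1))"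
      by (rule o21; use v in auto)+
    then show "(m21 (2 * v), m21 (2 * v + 1)) = 
      (out_x (real (pos (\<tau> a) b)) (\<tau> a) (\<tau> b) (\<tau> c) (\<tau> d) v * (sqrt (real n) / real (pos (\<tau> a) b) / 2),
       out_y (real (pos (\<tau> a) b)) (\<tau> a) (\<tau> b) (\<tau> c) (\<tau> d) v * (sqrt (real n) / real (pos (\<tau> a) b) / 2))"
      using bspec[OF o19 v] by (simp add: s_def K_def)
  qed (use e mx' in \<open>auto simp: a_def c_def d_def b_def\<close>)
  ultimately show ?thesis by blast
qed

lemma run_halted:
  assumes "halted P c"
  shows "run P \<tau> k c = c"
proof (induction k)
  case (Suc k)
  obtain pc m where "c = (pc, m)" by (cases c)
  then show ?case using Suc assms by (simp add: run_Suc halted_def)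
qed simp

text \<open>For n at least 1 the cost 300 n + 1000 is at most 1300 n, and a halted configuration no
  longer changes, so reading the output at time 1300 n is correct.\<close>

theorem ram_alg:
  "\<exists>P C. \<forall>n\<ge>1. \<forall>\<tau>. perm_lists n \<tau> \<longrightarrow> halts_within P \<tau> n (C * n) \<and> alg n \<tau> (ram_output P \<tau> n (C * n))"
proof (intro exI[of _ "compile 0 main_prog"] exI[of _ "1300"] allI impI)
  fix n :: nat and \<tau> assume n: "n \<ge> 1" and pl: "perm_lists n \<tau>"
  let ?P = "compile 0 main_prog"
  obtain m where e: "exec \<tau> main_prog ((\<lambda>_. 0)(0 := real n)) (300 * n + 1000) m"
    and o: "alg n \<tau> (\<lambda>v. (m (2 * v), m (2 * v + 1)))" using exec_main[OF n pl] by blast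
  have "code_at ?P 0 ?P" by (auto simp: code_at_def)
  then obtain k where k: "k \<le> 300 * n + 1000" and r: "run ?P \<tau> k (init n) = (length ?P, m)"
    using e unfolding exec_def init_def by fastforce
  have h: "halted ?P (length ?P, m)" by (simp add: halted_def cur_def)
  have k': "k \<le> 1300 * n" using k n by simp
  have "run ?P \<tau> (k + (1300 * n - k)) (init n) = (length ?P, m)"
    unfolding run_add r by (rule run_halted[OF h])
  then have "run ?P \<tau> (1300 * n) (init n) = (length ?P, m)" using k' by simp
  then have "ram_output ?P \<tau> n (1300 * n) = (\<lambda>v. (m (2 * v), m (2 * v + 1)))"
    by (simp add: ram_output_def fun_eq_iff)
  then show "halts_within ?P \<tau> n (1300 * n) \<and> alg n \<tau> (ram_output ?P \<tau> n (1300 * n))"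
    using o r h k' unfolding halts_within_def by auto
qed

section \<open>Areas of discs at a corner of the unit square\<close>

definition usq :: "(real \<times> real) set" where "usq = {0..1} \<times> {0..1}"

definition disc_area :: "real \<Rightarrow> real" where
  "disc_area r = measure lborel (cball 0 r \<inter> usq)"

definition quadrant :: "(real \<times> real) set" where "quadrant = {p. 0 \<le> fst p \<and> 0 \<le> snd p}"

text \<open>The part of this sector close to the unit circle lies in the lens of points at distance less than 1
  from the two neighbouring corners.\<close>
definition wedge :: "(real \<times> real) set" where
  "wedge = {p. 3 * fst p \<le> 4 * snd p \<and> 3 * snd p \<le> 4 * fst p}"

text \<open>This is pi / 4. Its value is unknown to the program and cancels when ranks are divided
  by the reference rank.\<close>

definition kappa :: real where "kappa = measure lborel (quadrant \<inter> cball 0 1)"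

definition wedge_area :: real where "wedge_area = measure lborel (wedge \<inter> cball 0 1)"

lemma closed_regions: "closed usq" "closed quadrant" "closed wedge"
proof -
  show "closed usq" unfolding usq_def by (intro closed_Times) auto
  show "closed quadrant" "closed wedge" unfolding quadrant_def wedge_def
    by (intro closed_Collect_conj closed_Collect_le continuous_intros)+
qed

lemma borel_regions [measurable]: "usq \<in> sets borel" "quadrant \<in> sets borel" "wedge \<in> sets borel"
  using closed_regions by (auto intro: borel_closed)

lemma fmeasurable_cball_Int:
  fixes A :: "(real \<times> real) set"
  assumes "A \<in> sets borel" shows "A \<inter> cball 0 r \<in> fmeasurable lborel"
proof (rule fmeasurableI)
  have "bounded (A \<inter> cball 0 r)" by (meson bounded_cball bounded_subset inf_le2)
  then show "emeasure lborel (A \<inter> cball 0 r) < \<infinity>" by (rule emeasure_bounded_finite)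
qed (use assms in simp)

lemma measure_lborel_affine:
  fixes A :: "(real \<times> real) set"
  assumes "A \<in> sets borel" "c \<noteq> 0"
  shows "measure lborel A = c\<^sup>2 * measure lborel ((\<lambda>x. t + c *\<^sub>R x) -` A)"
proof -
  have [measurable]: "(\<lambda>x. t + c *\<^sub>R x) \<in> borel_measurable (borel :: (real \<times> real) measure)" by measurable
  have "emeasure lborel A = emeasure (density (distr lborel borel (\<lambda>x. t + c *\<^sub>R x)) (\<lambda>_. ennreal (\<bar>c\<bar> ^ DIM(real \<times> real)))) A"
    by (subst lborel_affine[of c t]) (use assms in auto)
  also have "\<dots> = ennreal (c\<^sup>2) * emeasure lborel ((\<lambda>x. t + c *\<^sub>R x) -` A)"
    using assms by (subst emeasure_density_const) (auto simp: emeasure_distr power2_eq_square)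
  finally show ?thesis by (simp add: measure_def enn2real_mult)
qed

text \<open>Dilation by \<open>r\<close> maps the unit part of a cone onto its part of radius
  \<open>r\<close>; in the plane it multiplies areas by the square of \<open>r\<close>.\<close>

lemma measure_cone_scale:
  assumes C: "C \<in> sets borel" and sc: "\<And>p c. c > 0 \<Longrightarrow> (c *\<^sub>R p \<in> C) = (p \<in> C)" and r: "r \<ge> 0"
  shows "measure lborel (C \<inter> cball (0 :: real \<times> real) r) = measure lborel (C \<inter> cball 0 1) * r\<^sup>2"
proof (cases "r = 0")
  case True
  have "measure lborel (C \<inter> {0}) \<le> measure lborel {0 :: real \<times> real}"
    by (rule measure_mono_fmeasurable) (use C in \<open>auto simp: fmeasurable_def\<close>)
  also have "\<dots> = 0" by (simp add: measure_def)
  finally have "measure lborel (C \<inter> {0}) = 0" by (intro antisym) simp_all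
  then show ?thesis using True by simp
next
  case False
  have "(\<lambda>x. 0 + r *\<^sub>R x) -` (C \<inter> cball 0 r) = C \<inter> cball 0 1"
  proof (rule set_eqI)
    fix x :: "real \<times> real"
    have "norm (r *\<^sub>R x) \<le> r \<longleftrightarrow> norm x \<le> 1" using False r by simp
    then show "x \<in> (\<lambda>x. 0 + r *\<^sub>R x) -` (C \<inter> cball 0 r) \<longleftrightarrow> x \<in> C \<inter> cball 0 1"
      using sc[of r x] False r by (simp del: norm_scaleR)
  qed
  then show ?thesis using measure_lborel_affine[of "C \<inter> cball 0 r" r 0] C False by simp
qed

lemma measure_quadrant: "r \<ge> 0 \<Longrightarrow> measure lborel (quadrant \<inter> cball 0 r) = kappa * r\<^sup>2"
  unfolding kappa_def by (rule measure_cone_scale, rule borel_regions) (auto simp: quadrant_def zero_le_mult_iff)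

lemma measure_wedge: "r \<ge> 0 \<Longrightarrow> measure lborel (wedge \<inter> cball 0 r) = wedge_area * r\<^sup>2"
  unfolding wedge_area_def
proof (rule measure_cone_scale)
  fix p :: "real \<times> real" and c :: real assume "c > 0"
  then show "(c *\<^sub>R p \<in> wedge) = (p \<in> wedge)"
    by (simp add: wedge_def mult.left_commute[of _ c])
qed auto

lemma annulus:
  fixes C :: "(real \<times> real) set"
  assumes "C \<in> sets borel" "r1 \<le> r2"
  shows "measure lborel (C \<inter> cball 0 r2 - cball 0 r1) = measure lborel (C \<inter> cball 0 r2) - measure lborel (C \<inter> cball 0 r1)"
proof -
  have "C \<inter> cball 0 r2 - cball 0 r1 = C \<inter> cball 0 r2 - C \<inter> cball 0 r1" by auto
  moreover have "C \<inter> cball 0 r1 \<subseteq> C \<inter> cball 0 r2" using assms(2) by auto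
  ultimately show ?thesis
    using measurable_measure_Diff[of "C \<inter> cball 0 r2" lborel "C \<inter> cball 0 r1"]
      fmeasurable_cball_Int[OF assms(1)] by (metis fmeasurableD)
qed

lemma usq_quadrant: "usq \<subseteq> quadrant" by (auto simp: usq_def quadrant_def)

text \<open>The boundary ray of the wedge through (1, 3/4) leaves the unit square at distance
  exactly 5/4.\<close>

lemma wedge_usq: "wedge \<inter> cball 0 (5/4) \<subseteq> usq"
proof
  fix p assume p: "p \<in> wedge \<inter> cball 0 (5/4)"
  obtain x y where xy: "p = (x, y)" by (cases p)
  have c: "3 * x \<le> 4 * y" "3 * y \<le> 4 * x" using p by (auto simp: wedge_def xy)
  have "x\<^sup>2 + y\<^sup>2 \<le> (5/4)\<^sup>2" using p by (simp add: xy norm_Pair real_sqrt_le_iff' real_sqrt_le_iff sqrt_le_D)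
  then have s: "x\<^sup>2 + y\<^sup>2 \<le> 25/16" by (simp add: power2_eq_square)
  have 0: "x \<ge> 0" "y \<ge> 0" using c by linarith+
  have "(3 * x)\<^sup>2 \<le> (4 * y)\<^sup>2" "(3 * y)\<^sup>2 \<le> (4 * x)\<^sup>2" using c 0 by (intro power_mono; simp)+
  then have "x\<^sup>2 \<le> 1\<^sup>2" "y\<^sup>2 \<le> 1\<^sup>2" using s by (simp_all add: power_mult_distrib)
  then have "x \<le> 1" "y \<le> 1" by (auto intro: power2_le_imp_le)
  then show "p \<in> usq" using 0 by (simp add: usq_def xy)
qed

lemma disc_area_commute: "disc_area r = measure lborel (usq \<inter> cball 0 r)"
  by (simp add: disc_area_def Int_commute)

lemma disc_area_le1: 
  assumes "0 \<le> r" "r \<le> 1" shows "disc_area r = kappa * r\<^sup>2"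
proof -
  have "usq \<inter> cball 0 r = quadrant \<inter> cball 0 r"
  proof (intro equalityI subsetI)
    fix p assume p: "p \<in> quadrant \<inter> cball 0 r"
    have "\<bar>fst p\<bar> \<le> norm p" "\<bar>snd p\<bar> \<le> norm p" using norm_fst_le[of "fst p" "snd p"] norm_snd_le[of "snd p" "fst p"] by auto
    then show "p \<in> usq \<inter> cball 0 r" using p assms by (cases p) (auto simp: usq_def quadrant_def)
  qed (use usq_quadrant in auto)
  then show ?thesis by (simp add: disc_area_commute measure_quadrant assms)
qed

text \<open>The part of an annulus inside the square is contained in its part inside the
  quadrant.\<close>

lemma disc_area_upper:
  assumes "0 \<le> r1" "r1 \<le> r2" shows "disc_area r2 - disc_area r1 \<le> kappa * (r2\<^sup>2 - r1\<^sup>2)"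
proof -
  have "disc_area r2 - disc_area r1 = measure lborel (usq \<inter> cball 0 r2 - cball 0 r1)"
    unfolding disc_area_commute by (rule annulus[symmetric]) (use assms in auto)
  also have "\<dots> \<le> measure lborel (quadrant \<inter> cball 0 r2 - cball 0 r1)"
    using usq_quadrant fmeasurable_cball_Int[of quadrant r2]
    by (intro measure_mono_fmeasurable) (auto intro: fmeasurable_Diff)
  also have "\<dots> = kappa * (r2\<^sup>2 - r1\<^sup>2)"
    using assms by (subst annulus) (auto simp: measure_quadrant algebra_simps)
  finally show ?thesis .
qed

text \<open>Up to radius 5/4 the wedge lies in the square, so every annulus contributes at least its
  wedge part. This strict growth beyond radius 1 is what turns ranks back into distances
  there.\<close>

lemma disc_area_lower:
  assumes "0 \<le> r1" "r1 \<le> r2" "r2 \<le> 5/4" shows "disc_area r2 - disc_area r1 \<ge> wedge_area * (r2\<^sup>2 - r1\<^sup>2)"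
proof -
  have "wedge_area * (r2\<^sup>2 - r1\<^sup>2) = measure lborel (wedge \<inter> cball 0 r2 - cball 0 r1)"
    using assms by (subst annulus) (auto simp: measure_wedge algebra_simps)
  also have "\<dots> \<le> measure lborel (usq \<inter> cball 0 r2 - cball 0 r1)"
    using wedge_usq assms fmeasurable_cball_Int[of usq r2]
    by (intro measure_mono_fmeasurable) (auto intro: fmeasurable_Diff)
  also have "\<dots> = disc_area r2 - disc_area r1"
    unfolding disc_area_commute by (rule annulus) (use assms in auto)
  finally show ?thesis .
qed

lemma disc_area_mono: "r1 \<le> r2 \<Longrightarrow> disc_area r1 \<le> disc_area r2"
  unfolding disc_area_commute using fmeasurable_cball_Int[of usq r2]
  by (intro measure_mono_fmeasurable) auto

lemma measure_box: "a \<le> b \<Longrightarrow> c \<le> d \<Longrightarrow> measure lborel ({a..b} \<times> {c..d} :: (real \<times> real) set) = (b - a) * (d - c)"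
proof -
  assume "a \<le> b" "c \<le> d"
  moreover have "{a..b} \<times> {c..d} = cbox (a, c) (b, d)" by (simp add: cbox_Pair_eq)
  ultimately show ?thesis by (simp only: content_Pair) simp
qed

lemma borel_box: "{a..b} \<times> {c..d} \<in> sets (borel :: (real \<times> real) measure)"
  by (intro borel_closed closed_Times) auto

lemma disc_area_big: "r \<ge> 3/2 \<Longrightarrow> disc_area r = 1"
proof -
  assume r: "r \<ge> 3/2"
  have "norm p \<le> r" if "p \<in> usq" for p
  proof -
    have "(fst p)\<^sup>2 \<le> 1" "(snd p)\<^sup>2 \<le> 1" using that by (auto simp: usq_def power_le_one)
    then have "(norm p)\<^sup>2 \<le> (3/2)\<^sup>2" by (simp add: norm_prod_def power2_eq_square)
    then have "norm p \<le> 3/2" by (rule power2_le_imp_le) simp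
    then show ?thesis using r by simp
  qed
  then have "cball 0 r \<inter> usq = usq" by auto
  then show ?thesis using measure_box[of 0 1 0 1] by (simp add: disc_area_def usq_def)
qed

lemma box_in_cball: "0 \<le> x \<Longrightarrow> x \<le> 7/10 \<Longrightarrow> 0 \<le> y \<Longrightarrow> y \<le> 7/10 \<Longrightarrow> norm (x, y) \<le> 1" for x y :: real
proof -
  assume "0 \<le> x" "x \<le> 7/10" "0 \<le> y" "y \<le> 7/10"
  then have "x\<^sup>2 \<le> (7/10)\<^sup>2" "y\<^sup>2 \<le> (7/10)\<^sup>2" by (auto intro!: power_mono)
  then have "(norm (x, y))\<^sup>2 \<le> 1\<^sup>2" by (simp add: norm_Pair power_divide)
  then show ?thesis by (rule power2_le_imp_le) simp
qed

lemma kappa_bounds: "49/100 \<le> kappa" "kappa \<le> 1"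
proof -
  have "kappa = disc_area 1" by (simp add: disc_area_le1)
  also have "\<dots> \<le> disc_area 2" by (rule disc_area_mono) simp
  finally show "kappa \<le> 1" by (simp add: disc_area_big)
  \<comment> \<open>An inscribed square of side 7/10, whose diagonal is below 1.\<close>
  have "{0..7/10} \<times> {0..7/10} \<subseteq> quadrant \<inter> cball 0 1"
    using box_in_cball by (auto simp: quadrant_def)
  then have "measure lborel ({0..7/10} \<times> {0..7/10} :: (real \<times> real) set) \<le> kappa"
    unfolding kappa_def using fmeasurable_cball_Int[of quadrant 1] by (intro measure_mono_fmeasurable) (auto simp: borel_box)
  then show "49/100 \<le> kappa" by (simp add: measure_box)
qed

lemma wedge_area_ge: "1/100 \<le> wedge_area"
proof -
  have "{6/10..7/10} \<times> {6/10..7/10} \<subseteq> wedge \<inter> cball 0 1"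
    using box_in_cball by (auto simp: wedge_def)
  then have "measure lborel ({6/10..7/10} \<times> {6/10..7/10} :: (real \<times> real) set) \<le> wedge_area"
    unfolding wedge_area_def using fmeasurable_cball_Int[of wedge 1] by (intro measure_mono_fmeasurable) (auto simp: borel_box)
  then show ?thesis by (simp add: measure_box)
qed

section \<open>Vertex orderings and the typical configuration\<close>

lemma perm_lists_tau: "perm_lists n (tau n Y)"
  by (auto simp: perm_lists_def tau_def)

lemma tau_pos_mono:
  assumes u: "u \<in> {1..n}" "v \<in> {1..n}" "w \<in> {1..n}"
    and p: "pos (tau n Y u) v \<le> pos (tau n Y u) w"
  shows "dist (Y v) (Y u) \<le> dist (Y w) (Y u)"
proof -
  let ?l = "tau n Y u" and ?f = "\<lambda>w. dist (Y w) (Y u)"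
  note L = perm_listsD[OF perm_lists_tau[of n Y] u(1)]
  have "sorted (map ?f ?l)" using u by (simp add: tau_def)
  moreover have "pos ?l v < n \<and> ?l ! pos ?l v = v" "pos ?l w < n \<and> ?l ! pos ?l w = w"
    using nth_pos[OF L(1)] L u by auto
  ultimately show ?thesis using p sorted_nth_mono[of "map ?f ?l" "pos ?l v" "pos ?l w"] L(3) by auto
qed

lemma tau_last:
  assumes u: "u \<in> {1..n}" "v \<in> {1..n}"
  shows "dist (Y v) (Y u) \<le> dist (Y (last (tau n Y u))) (Y u)"
proof (rule tau_pos_mono[OF u])
  note L = perm_listsD[OF perm_lists_tau[of n Y] u(1)]
  show "last (tau n Y u) \<in> {1..n}" by (rule last_in[OF perm_lists_tau u(1)])
  have "tau n Y u \<noteq> []" using L u by auto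
  then have "pos (tau n Y u) (last (tau n Y u)) = n - 1"
    using pos_nth[OF L(1), of "n - 1"] L u by (simp add: last_conv_nth)
  then show "pos (tau n Y u) v \<le> pos (tau n Y u) (last (tau n Y u))"
    using nth_pos[OF L(1), of v] L u by auto
qed

text \<open>Ranks start at 0. Counting the open disc below and the closed disc above sandwiches the
  rank however ties are broken.\<close>

lemma tau_pos_bounds:
  assumes u: "u \<in> {1..n}" "v \<in> {1..n}"
  shows "card {w \<in> {1..n}. dist (Y w) (Y u) < dist (Y v) (Y u)} \<le> pos (tau n Y u) v"
    "pos (tau n Y u) v < card {w \<in> {1..n}. dist (Y w) (Y u) \<le> dist (Y v) (Y u)}"
proof -
  let ?l = "tau n Y u"
  note L = perm_listsD[OF perm_lists_tau[of n Y] u(1)]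
  have inj: "inj_on (pos ?l) {1..n}" using nth_pos[OF L(1)] L by (metis inj_onI)
  have "pos ?l ` {w \<in> {1..n}. dist (Y w) (Y u) < dist (Y v) (Y u)} \<subseteq> {..<pos ?l v}"
    using tau_pos_mono[OF u(1,2)] by (force simp: not_less[symmetric])
  then have "card (pos ?l ` {w \<in> {1..n}. dist (Y w) (Y u) < dist (Y v) (Y u)}) \<le> pos ?l v"
    by (metis card_lessThan card_mono finite_lessThan)
  then show "card {w \<in> {1..n}. dist (Y w) (Y u) < dist (Y v) (Y u)} \<le> pos ?l v"
    using inj by (subst (asm) card_image) (auto intro: inj_on_subset)
  have pv: "pos ?l v < n" using nth_pos[OF L(1)] L u by auto
  have "(!) ?l ` {..pos ?l v} \<subseteq> {w \<in> {1..n}. dist (Y w) (Y u) \<le> dist (Y v) (Y u)}"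
  proof safe
    fix i assume "i \<le> pos ?l v"
    then have i: "i < length ?l" using pv L by simp
    then show m: "?l ! i \<in> {1..n}" using L nth_mem by blast
    show "dist (Y (?l ! i)) (Y u) \<le> dist (Y v) (Y u)"
      using tau_pos_mono[OF u(1) m u(2)] pos_nth[OF L(1) i] \<open>i \<le> pos ?l v\<close> by simp
  qed
  then have "card ((!) ?l ` {..pos ?l v}) \<le> card {w \<in> {1..n}. dist (Y w) (Y u) \<le> dist (Y v) (Y u)}"
    by (intro card_mono) auto
  moreover have "inj_on ((!) ?l) {..pos ?l v}"
    using pv L by (auto simp: inj_on_def nth_eq_iff_index_eq)
  ultimately show "pos ?l v < card {w \<in> {1..n}. dist (Y w) (Y u) \<le> dist (Y v) (Y u)}"
    by (simp add: card_image)
qed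

text \<open>Only the place of the contributing entry matters: trapped in the list between a known
  lens vertex and the vertex itself, it has almost the same distance from the corner.\<close>

lemma cal_last:
  assumes "i \<le> k" "S (l ! i)"
  shows "\<exists>j. i \<le> j \<and> j \<le> k \<and> S (l ! j) \<and> cal S f l (Suc k) = f (l ! j)"
  using assms
proof (induction k)
  case (Suc k)
  show ?case
  proof (cases "S (l ! Suc k)")
    case False
    then have "i \<le> k" using Suc.prems by (metis le_Suc_eq)
    then show ?thesis using Suc False by (metis cal.simps(2) le_SucI)
  qed (use Suc.prems in auto)
qed auto

text \<open>Lens membership is tested by ranks, so distances slightly above 1 occur; the quadratic
  law still holds there, with a deficit of at most \<kappa> (r^2 - 1).\<close>

lemma disc_area_near_square:
  assumes "0 \<le> r" "r\<^sup>2 \<le> 1 + \<delta>" "0 \<le> \<delta>"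
  shows "\<bar>disc_area r - kappa * r\<^sup>2\<bar> \<le> \<delta>"
proof (cases "r \<le> 1")
  case False
  have "disc_area r - disc_area 1 \<le> kappa * (r\<^sup>2 - 1\<^sup>2)" using False by (intro disc_area_upper) auto
  moreover have "disc_area 1 \<le> disc_area r" using False by (intro disc_area_mono) simp
  moreover have "kappa * (r\<^sup>2 - 1) \<le> 1 * (r\<^sup>2 - 1)" using kappa_bounds False by (intro mult_right_mono) auto
  ultimately show ?thesis using assms disc_area_le1[of 1] by (simp add: algebra_simps abs_le_iff)
qed (use assms disc_area_le1 in simp)

text \<open>The factor 100 inverts the lower bound 1/100 of \<open>wedge_area\<close>. A radius
  above 5/4 would exceed the area \<kappa> by at least 9/1600, more than the allowed 1/200.\<close>

lemma disc_area_le_imp: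
  assumes "0 \<le> r" "disc_area r \<le> kappa + \<delta>" "0 \<le> \<delta>" "\<delta> < 1/200"
  shows "r\<^sup>2 \<le> 1 + 100 * \<delta>"
proof (cases "r \<le> 1")
  case True
  then have "r\<^sup>2 \<le> 1" using assms(1) by (simp add: power_le_one)
  then show ?thesis using assms by simp
next
  case False
  have k: "disc_area 1 = kappa" by (simp add: disc_area_le1)
  have low: "1/100 * (s\<^sup>2 - 1\<^sup>2) \<le> disc_area s - kappa" if "1 \<le> s" "s \<le> 5/4" for s
  proof -
    have "1/100 * (s\<^sup>2 - 1\<^sup>2) \<le> wedge_area * (s\<^sup>2 - 1\<^sup>2)"
      using wedge_area_ge that by (intro mult_right_mono) auto
    also have "\<dots> \<le> disc_area s - disc_area 1" using that by (intro disc_area_lower) auto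
    finally show ?thesis using k by simp
  qed
  have "r \<le> 5/4"
  proof (rule ccontr)
    assume "\<not> r \<le> 5/4"
    then have "disc_area (5/4) \<le> disc_area r" by (intro disc_area_mono) simp
    then show False using low[of "5/4"] assms by (simp add: power_divide)
  qed
  then show ?thesis using low[of r] False assms by simp
qed

lemma disc_area_ge_imp:
  assumes "0 \<le> r" "kappa - \<delta> \<le> disc_area r" "0 \<le> \<delta>"
  shows "1 - 100/49 * \<delta> \<le> r\<^sup>2"
proof (cases "r \<le> 1")
  case True
  then have "kappa * (1 - r\<^sup>2) \<le> \<delta>" using assms disc_area_le1[of r] by (simp add: algebra_simps)
  moreover have "r\<^sup>2 \<le> 1" using True assms by (simp add: power_le_one)
  then have "49/100 * (1 - r\<^sup>2) \<le> kappa * (1 - r\<^sup>2)" using kappa_bounds by (intro mult_right_mono) auto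
  ultimately show ?thesis by simp
next
  case False
  then have "1\<^sup>2 \<le> r\<^sup>2" by (intro power_mono) auto
  then show ?thesis using assms by simp
qed

text \<open>The slope of \<kappa> r^2 is at most 3 on this range; 16/5 leaves room for the increment
  \<open>d\<close>.\<close>

lemma disc_area_lipschitz:
  assumes "0 \<le> r" "r \<le> 3/2" "0 \<le> d" "d \<le> 1/10"
  shows "disc_area (r + d) \<le> disc_area r + 16/5 * d"
proof -
  have "disc_area (r + d) - disc_area r \<le> kappa * ((r + d)\<^sup>2 - r\<^sup>2)"
    using assms by (intro disc_area_upper) auto
  also have "\<dots> \<le> 1 * ((r + d)\<^sup>2 - r\<^sup>2)" using kappa_bounds assms by (intro mult_right_mono) (auto intro: power_mono)
  also have "(r + d)\<^sup>2 - r\<^sup>2 = d * (2 * r + d)" by (simp add: power2_eq_square algebra_simps)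
  also have "d * (2 * r + d) \<le> d * (16/5)" using assms by (intro mult_left_mono) auto
  finally show ?thesis by simp
qed

section \<open>Typical configurations and the symmetries of the square\<close>

definition corners :: "(real \<times> real) set" where "corners = {0, 1} \<times> {0, 1}"

definition flip :: "real \<times> real \<Rightarrow> real \<times> real \<Rightarrow> real \<times> real" where
  "flip z p = (if fst z = 0 then fst p else 1 - fst p, if snd z = 0 then snd p else 1 - snd p)"

text \<open>The deterministic event on which the algorithm succeeds. The radii from 9/10 to 57/50
  cover every place where the calibration looks for a lens vertex, from just below 1 to just below
  113/100.\<close>

definition nice :: "nat \<Rightarrow> real \<Rightarrow> (nat \<Rightarrow> real \<times> real) \<Rightarrow> bool" where
  "nice n \<epsilon> Y \<longleftrightarrow> (\<forall>v\<in>{1..n}. Y v \<in> usq) \<and> (\<forall>z\<in>corners.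
     (\<exists>v\<in>{1..n}. norm (flip z (Y v)) \<le> \<epsilon>) \<and>
     (\<forall>r\<ge>0. \<bar>real (card {v\<in>{1..n}. norm (flip z (Y v)) \<le> r}) / real n - disc_area r\<bar> \<le> \<epsilon>) \<and>
     (\<forall>r\<in>{9/10..57/50}. \<exists>v\<in>{1..n}. flip z (Y v) \<in> wedge \<and> norm (flip z (Y v)) \<in> {r..r + \<epsilon>}))"

lemma norm_flip: "z \<in> corners \<Longrightarrow> norm (flip z p) = dist p z"
  by (cases z; cases p) (auto simp: corners_def flip_def dist_Pair_Pair norm_Pair dist_real_def power2_commute)

lemma flip_flip: "z \<in> corners \<Longrightarrow> w \<in> corners \<Longrightarrow> \<exists>z'\<in>corners. \<forall>p. flip z (flip w p) = flip z' p"
  by (rule bexI[of _ "(if fst z = fst w then 0 else 1, if snd z = snd w then 0 else 1)"])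
    (auto simp: corners_def flip_def)

lemma nice_flip:
  assumes "nice n \<epsilon> Y" "w \<in> corners"
  shows "nice n \<epsilon> (flip w \<circ> Y)"
  unfolding nice_def
proof (intro conjI ballI)
  fix v assume "v \<in> {1..n}"
  then have "Y v \<in> usq" using assms by (simp add: nice_def)
  then show "(flip w \<circ> Y) v \<in> usq" by (cases "Y v") (auto simp: usq_def flip_def)
next
  fix z assume "z \<in> corners"
  from flip_flip[OF this assms(2)] obtain z' where z': "z' \<in> corners" "flip z (flip w p) = flip z' p" for p by blast
  have "flip z ((flip w \<circ> Y) v) = flip z' (Y v)" for v using z' by simp
  then show "\<exists>v\<in>{1..n}. norm (flip z ((flip w \<circ> Y) v)) \<le> \<epsilon>"
    "\<forall>r\<ge>0. \<bar>real (card {v\<in>{1..n}. norm (flip z ((flip w \<circ> Y) v)) \<le> r}) / real n - disc_area r\<bar> \<le> \<epsilon>"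
    "\<And>r. r \<in> {9/10..57/50} \<Longrightarrow> \<exists>v\<in>{1..n}. flip z ((flip w \<circ> Y) v) \<in> wedge \<and> norm (flip z ((flip w \<circ> Y) v)) \<in> {r..r + \<epsilon>}"
    using assms(1) z'(1) unfolding nice_def by simp_all
qed

lemma nice_swap:
  assumes "nice n \<epsilon> Y"
  shows "nice n \<epsilon> (prod.swap \<circ> Y)"
  unfolding nice_def
proof (intro conjI ballI)
  fix v assume "v \<in> {1..n}"
  then have "Y v \<in> usq" using assms by (simp add: nice_def)
  then show "(prod.swap \<circ> Y) v \<in> usq" by (cases "Y v") (auto simp: usq_def)
next
  fix z assume z: "z \<in> corners"
  have z': "prod.swap z \<in> corners" using z by (auto simp: corners_def)
  have e: "flip z ((prod.swap \<circ> Y) v) = prod.swap (flip (prod.swap z) (Y v))" for v by (simp add: flip_def)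
  have sw: "norm (prod.swap p) = norm p" "prod.swap p \<in> wedge \<longleftrightarrow> p \<in> wedge" for p :: "real \<times> real"
    by (auto simp: norm_prod_def add.commute wedge_def)
  show "\<exists>v\<in>{1..n}. norm (flip z ((prod.swap \<circ> Y) v)) \<le> \<epsilon>"
    "\<forall>r\<ge>0. \<bar>real (card {v\<in>{1..n}. norm (flip z ((prod.swap \<circ> Y) v)) \<le> r}) / real n - disc_area r\<bar> \<le> \<epsilon>"
    "\<And>r. r \<in> {9/10..57/50} \<Longrightarrow> \<exists>v\<in>{1..n}. flip z ((prod.swap \<circ> Y) v) \<in> wedge \<and> norm (flip z ((prod.swap \<circ> Y) v)) \<in> {r..r + \<epsilon>}"
    unfolding e sw using assms(1) z' unfolding nice_def by simp_all
qed

text \<open>Both terms are nonnegative, and in t (1 - t) one factor is at least 1/2, so the other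
  factor, the distance to the nearer end, is at most 2 \<mu>.\<close>

lemma near_corner:
  assumes "(x, y) \<in> usq" "x * (1 - x) + y * (1 - y) \<le> \<mu>"
  shows "\<exists>z\<in>corners. dist (x, y) z \<le> 4 * \<mu>"
proof -
  have xy: "0 \<le> x" "x \<le> 1" "0 \<le> y" "y \<le> 1" using assms(1) by (auto simp: usq_def)
  have p: "0 \<le> x * (1 - x)" "0 \<le> y * (1 - y)" using xy by auto
  have key: "\<bar>t - (if t \<le> 1/2 then 0 else 1)\<bar> \<le> 2 * \<mu>" if "0 \<le> t" "t \<le> 1" "t * (1 - t) \<le> \<mu>" for t
  proof (cases "t \<le> 1/2")
    case True
    have "t * (1/2) \<le> t * (1 - t)" using True that by (intro mult_left_mono) auto
    then show ?thesis using True that by simp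
  next
    case False
    have "(1/2) * (1 - t) \<le> t * (1 - t)" using False that by (intro mult_right_mono) auto
    then show ?thesis using False that by simp
  qed
  define z1 :: real where "z1 = (if x \<le> 1/2 then 0 else 1)"
  define z2 :: real where "z2 = (if y \<le> 1/2 then 0 else 1)"
  have "dist (x, y) (z1, z2) \<le> \<bar>x - z1\<bar> + \<bar>y - z2\<bar>"
    unfolding dist_Pair_Pair dist_real_def using sqrt_sum_squares_le_sum_abs by force
  also have "\<dots> \<le> 2 * \<mu> + 2 * \<mu>"
    unfolding z1_def z2_def using key[of x] key[of y] xy p assms(2) by (intro add_mono) auto
  finally show ?thesis by (intro bexI[of _ "(z1, z2)"]) (auto simp: corners_def z1_def z2_def)
qed

section \<open>Locating the corners\<close>

lemma dist_sq: "(dist (x, y) (a, b))\<^sup>2 = (x - a)\<^sup>2 + (y - b)\<^sup>2" for x y a b :: real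
  by (simp add: dist_Pair_Pair dist_real_def)

definition hflip :: "real \<times> real \<Rightarrow> real \<times> real" where "hflip z = (1 - fst z, snd z)"
definition vflip :: "real \<times> real \<Rightarrow> real \<times> real" where "vflip z = (fst z, 1 - snd z)"
definition opp :: "real \<times> real \<Rightarrow> real \<times> real" where "opp z = (1 - fst z, 1 - snd z)"

lemma corner_flips: "z \<in> corners \<Longrightarrow> hflip z \<in> corners" "z \<in> corners \<Longrightarrow> vflip z \<in> corners" "z \<in> corners \<Longrightarrow> opp z \<in> corners"
  by (auto simp: corners_def hflip_def vflip_def opp_def)

text \<open>Distances between corners are 0, 1 or sqrt 2.\<close>

lemma corner_far: "z \<in> corners \<Longrightarrow> z' \<in> corners \<Longrightarrow> dist z z' > 1 \<Longrightarrow> z = opp z'"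
  by (auto simp: corners_def opp_def dist_Pair_Pair dist_real_def)

lemma dist_opp: "z \<in> corners \<Longrightarrow> dist (opp z) z \<ge> 7/5"
proof -
  assume z: "z \<in> corners"
  have "(dist (opp z) z)\<^sup>2 = 2"
    using z by (cases z) (auto simp: opp_def dist_sq corners_def)
  then have "(7/5)\<^sup>2 \<le> (dist (opp z) z)\<^sup>2" by (simp add: power_divide)
  then show ?thesis by (rule power2_le_imp_le) simp
qed

lemma british_flag:
  "(dist p z)\<^sup>2 + (dist p (opp z))\<^sup>2 = (dist p (hflip z))\<^sup>2 + (dist p (vflip z))\<^sup>2"
  by (cases p; cases z) (simp add: opp_def hflip_def vflip_def dist_sq)

lemma dist_usq: "p \<in> usq \<Longrightarrow> q \<in> usq \<Longrightarrow> dist p q \<le> 3/2"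
proof -
  assume pq: "p \<in> usq" "q \<in> usq"
  obtain x y a b where e: "p = (x, y)" "q = (a, b)" by (cases p, cases q)
  have "\<bar>x - a\<bar> \<le> 1" "\<bar>y - b\<bar> \<le> 1" using pq by (auto simp: e usq_def)
  then have "(x - a)\<^sup>2 \<le> 1" "(y - b)\<^sup>2 \<le> 1" by (auto simp: abs_square_le_1)
  then have "(dist p q)\<^sup>2 \<le> 2" by (simp add: e dist_sq)
  then have "(dist p q)\<^sup>2 \<le> (3/2)\<^sup>2" by (simp add: power_divide)
  then show ?thesis by (rule power2_le_imp_le) simp
qed

lemma corners_usq: "z \<in> corners \<Longrightarrow> z \<in> usq"
  by (auto simp: corners_def usq_def)

locale nice_points =
  fixes n :: nat and \<epsilon> :: real and Y :: "nat \<Rightarrow> real \<times> real"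
  assumes nice: "nice n \<epsilon> Y" and eps: "0 < \<epsilon>" "\<epsilon> \<le> 1 / 10 ^ 7"
begin

abbreviation "V \<equiv> {1..n}"
abbreviation "\<tau> \<equiv> tau n Y"

lemma eps': "\<epsilon> \<le> 1 / 10000000" using eps(2) by simp

lemma in_usq: "v \<in> V \<Longrightarrow> Y v \<in> usq"
  using nice by (simp add: nice_def)

lemma vertex_near: "z \<in> corners \<Longrightarrow> \<exists>v\<in>V. dist (Y v) z \<le> \<epsilon>"
  using nice norm_flip by (auto simp: nice_def)

lemma n_pos: "n > 0"
  using vertex_near[of "(0, 0)"] by (auto simp: corners_def)

lemma count: "z \<in> corners \<Longrightarrow> r \<ge> 0 \<Longrightarrow> \<bar>real (card {v\<in>V. dist (Y v) z \<le> r}) / real n - disc_area r\<bar> \<le> \<epsilon>"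
  using nice by (simp add: nice_def norm_flip)

text \<open>In the wedge both coordinates are at least 3/5 of the distance d (the 3-4-5 triangle),
  so the squared distance to a neighbouring corner is at most 1 - d (6/5 - d). On the given range
  this stays below 98/100.\<close>

lemma lens_vertex:
  assumes z: "z \<in> corners" and r: "9/10 \<le> r" "r \<le> 57/50"
  shows "\<exists>w\<in>V. r \<le> dist (Y w) z \<and> dist (Y w) z \<le> r + \<epsilon> \<and>
    (dist (Y w) (hflip z))\<^sup>2 \<le> 98/100 \<and> (dist (Y w) (vflip z))\<^sup>2 \<le> 98/100"
proof -
  have "\<forall>r\<in>{9/10..57/50}. \<exists>v\<in>V. flip z (Y v) \<in> wedge \<and> norm (flip z (Y v)) \<in> {r..r + \<epsilon>}"
    using nice z unfolding nice_def by simp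
  moreover have "r \<in> {9/10..57/50}" using r by simp
  ultimately obtain w where w: "w \<in> V" "flip z (Y w) \<in> wedge" "norm (flip z (Y w)) \<in> {r..r + \<epsilon>}"
    by blast
  obtain s t where st: "flip z (Y w) = (s, t)" by (cases "flip z (Y w)")
  define d where "d = dist (Y w) z"
  have d: "r \<le> d" "d \<le> r + \<epsilon>" using w(3) by (auto simp: norm_flip[OF z] d_def)
  have "d = sqrt (s\<^sup>2 + t\<^sup>2)" using norm_flip[OF z, of "Y w"] by (simp add: st d_def norm_Pair)
  then have dd: "d\<^sup>2 = s\<^sup>2 + t\<^sup>2" by simp
  have wd: "3 * s \<le> 4 * t" "3 * t \<le> 4 * s" using w(2) by (auto simp: st wedge_def)
  then have 0: "s \<ge> 0" "t \<ge> 0" by linarith+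
  have "(3 * t)\<^sup>2 \<le> (4 * s)\<^sup>2" "(3 * s)\<^sup>2 \<le> (4 * t)\<^sup>2" using wd 0 by (intro power_mono; simp)+
  then have "(3 * d)\<^sup>2 \<le> (5 * s)\<^sup>2" "(3 * d)\<^sup>2 \<le> (5 * t)\<^sup>2" by (simp_all add: power_mult_distrib dd)
  then have sd: "3 * d \<le> 5 * s" "3 * d \<le> 5 * t" using 0 by (auto intro: power2_le_imp_le)
  have "9/10 * (1/25) \<le> d * (6/5 - d)" using d r eps' by (intro mult_mono) auto
  then have "1 - 6/5 * d + d\<^sup>2 \<le> 98/100" by (simp add: power2_eq_square algebra_simps)
  then have "(1 - s)\<^sup>2 + t\<^sup>2 \<le> 98/100" "s\<^sup>2 + (1 - t)\<^sup>2 \<le> 98/100"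
    using sd dd by (simp_all add: power2_eq_square algebra_simps)
  moreover have "(dist (Y w) (hflip z))\<^sup>2 = (1 - s)\<^sup>2 + t\<^sup>2" "(dist (Y w) (vflip z))\<^sup>2 = s\<^sup>2 + (1 - t)\<^sup>2"
    using z st by (cases "Y w"; auto simp: corners_def hflip_def vflip_def flip_def dist_sq power2_commute)+
  ultimately show ?thesis using w(1) d by (auto simp: d_def)
qed

text \<open>Moving (x, y) to the corner far from \<open>p\<close> raises the squared distance from
  \<open>p\<close> by at least x (1 - x) + y (1 - y), by convexity in each coordinate. A vertex
  within \<epsilon> of that corner limits the gain to 3 \<epsilon>, as distances are at most 3/2;
  then \<open>near_corner\<close> applies.\<close>

lemma farthest_near_corner:
  assumes p: "p \<in> usq" and w: "w \<in> V" and mx: "\<And>v. v \<in> V \<Longrightarrow> dist (Y v) p \<le> dist (Y w) p"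
  shows "\<exists>z\<in>corners. dist (Y w) z \<le> 12 * \<epsilon>"
proof -
  obtain p1 p2 where pe: "p = (p1, p2)" by (cases p)
  obtain x y where xe: "Y w = (x, y)" by (cases "Y w")
  have b: "0 \<le> p1" "p1 \<le> 1" "0 \<le> p2" "p2 \<le> 1" using p by (auto simp: pe usq_def)
  have c: "0 \<le> x" "x \<le> 1" "0 \<le> y" "y \<le> 1" using in_usq[OF w] by (auto simp: xe usq_def)
  define z1 :: real where "z1 = (if p1 \<le> 1/2 then 1 else 0)"
  define z2 :: real where "z2 = (if p2 \<le> 1/2 then 1 else 0)"
  have z: "(z1, z2) \<in> corners" by (auto simp: corners_def z1_def z2_def)
  obtain v where v: "v \<in> V" "dist (Y v) (z1, z2) \<le> \<epsilon>" using vertex_near[OF z] by blast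
  define a where "a = dist (Y w) p"
  define g where "g = dist (z1, z2) p"
  have ag: "a \<ge> g - \<epsilon>" using mx[OF v(1)] v(2) dist_triangle3[of "(z1, z2)" p "Y v"]
    unfolding a_def g_def by linarith
  have g: "g \<le> 3/2" "g \<ge> 0" "a \<ge> 0" "a \<le> 3/2"
    unfolding g_def a_def using dist_usq[OF corners_usq[OF z] p] dist_usq[OF in_usq[OF w] p] by auto
  have "g\<^sup>2 - a\<^sup>2 \<le> 3 * \<epsilon>"
  proof (cases "a \<ge> g")
    case True
    then have "g\<^sup>2 \<le> a\<^sup>2" using g by (intro power_mono) auto
    then show ?thesis using eps by simp
  next
    case False
    have "g\<^sup>2 - a\<^sup>2 = (g - a) * (g + a)" by (simp add: power2_eq_square algebra_simps)
    also have "\<dots> \<le> \<epsilon> * 3" using False ag g eps by (intro mult_mono) auto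
    finally show ?thesis by simp
  qed
  moreover have "g\<^sup>2 = (z1 - p1)\<^sup>2 + (z2 - p2)\<^sup>2" "a\<^sup>2 = (x - p1)\<^sup>2 + (y - p2)\<^sup>2"
    by (simp_all add: g_def a_def pe xe dist_sq)
  moreover have key: "t * (1 - t) \<le> ((if q \<le> 1/2 then 1 else 0) - q)\<^sup>2 - (t - q)\<^sup>2"
    if "0 \<le> t" "t \<le> 1" for t q :: real
  proof (cases "q \<le> 1/2")
    case True
    have "(1 - t) * t \<le> (1 - t) * (1 + t - 2 * q)" using True that by (intro mult_left_mono) auto
    then show ?thesis using True by (simp add: power2_eq_square algebra_simps)
  next
    case False
    have "t * (1 - t) \<le> t * (2 * q - t)" using False that by (intro mult_left_mono) auto
    then show ?thesis using False by (simp add: power2_eq_square algebra_simps)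
  qed
  ultimately have "x * (1 - x) + y * (1 - y) \<le> 3 * \<epsilon>"
    using key[of x p1] key[of y p2] c unfolding z1_def z2_def by linarith
  then show ?thesis using near_corner[of x y "3 * \<epsilon>"] in_usq[OF w] by (simp add: xe)
qed

text \<open>The corner near the farthest vertex must be more than 1 away from \<open>z\<close>,
  which leaves only the opposite one.\<close>

lemma farthest_opp:
  assumes p: "p \<in> usq" and z: "z \<in> corners" "dist p z \<le> 1/10" and w: "w \<in> V"
    and mx: "\<And>v. v \<in> V \<Longrightarrow> dist (Y v) p \<le> dist (Y w) p"
  shows "dist (Y w) (opp z) \<le> 12 * \<epsilon>"
proof -
  obtain z' where z': "z' \<in> corners" "dist (Y w) z' \<le> 12 * \<epsilon>" using farthest_near_corner[OF p w mx] by blast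
  obtain v where v: "v \<in> V" "dist (Y v) (opp z) \<le> \<epsilon>" using vertex_near[OF corner_flips(3)[OF z(1)]] by blast
  have "dist (Y v) p \<le> dist (Y w) p" by (rule mx[OF v(1)])
  moreover have "dist (opp z) z \<le> dist (Y v) (opp z) + dist (Y v) p + dist p z"
    by (smt (verit) dist_commute dist_triangle)
  moreover have "dist (Y w) p \<le> dist (Y w) z' + dist z' z + dist p z"
    by (smt (verit) dist_commute dist_triangle)
  ultimately have "dist z' z > 1" using dist_opp[OF z(1)] v(2) z'(2) z(2) eps' by linarith
  then show ?thesis using corner_far[OF z'(1) z(1)] z'(2) by simp
qed

text \<open>Replacing the centre \<open>Y u\<close> by the corner costs 12 \<epsilon> in the radius
  on each side; the Lipschitz bound turns this into area.\<close>

lemma rank_disc_area: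
  assumes u: "u \<in> V" and z: "z \<in> corners" "dist (Y u) z \<le> 12 * \<epsilon>" and v: "v \<in> V"
  shows "\<bar>real (pos (\<tau> u) v) / real n - disc_area (dist (Y v) z)\<bar> \<le> 100 * \<epsilon>"
proof -
  define R where "R = dist (Y v) z"
  have R: "0 \<le> R" "R \<le> 3/2" unfolding R_def using dist_usq[OF in_usq[OF v] corners_usq[OF z(1)]] by auto
  have tri: "dist (Y w) z \<le> dist (Y w) (Y u) + 12 * \<epsilon>" "dist (Y w) (Y u) \<le> dist (Y w) z + 12 * \<epsilon>" for w
    using z(2) by (smt (verit) dist_commute dist_triangle)+
  have "pos (\<tau> u) v \<le> card {w \<in> V. dist (Y w) (Y u) \<le> dist (Y v) (Y u)}"
    using tau_pos_bounds(2)[OF u v, of Y] by simp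
  also have "\<dots> \<le> card {w \<in> V. dist (Y w) z \<le> R + 24 * \<epsilon>}"
  proof (intro card_mono subsetI)
    fix w assume "w \<in> {w \<in> V. dist (Y w) (Y u) \<le> dist (Y v) (Y u)}"
    then show "w \<in> {w \<in> V. dist (Y w) z \<le> R + 24 * \<epsilon>}"
      using tri(1)[of w] tri(2)[of v] by (auto simp: R_def)
  qed simp
  finally have "real (pos (\<tau> u) v) / real n \<le> real (card {w \<in> V. dist (Y w) z \<le> R + 24 * \<epsilon>}) / real n"
    by (intro divide_right_mono) auto
  also have "\<dots> \<le> disc_area (R + 24 * \<epsilon>) + \<epsilon>"
    using count[OF z(1), of "R + 24 * \<epsilon>"] R eps by (simp add: abs_le_iff)
  also have "\<dots> \<le> disc_area R + 16/5 * (24 * \<epsilon>) + \<epsilon>"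
    using disc_area_lipschitz[of R "24 * \<epsilon>"] R eps eps' by simp
  finally have up: "real (pos (\<tau> u) v) / real n \<le> disc_area R + 100 * \<epsilon>" using eps by simp
  have lo: "disc_area R - 100 * \<epsilon> \<le> real (pos (\<tau> u) v) / real n"
  proof (cases "R \<le> 25 * \<epsilon>")
    case True
    have "disc_area R \<le> disc_area 0 + 16/5 * R"
      using disc_area_lipschitz[of 0 R] True R eps' by simp
    then have "disc_area R - 100 * \<epsilon> \<le> 0" using True disc_area_le1[of 0] eps by simp
    also have "0 \<le> real (pos (\<tau> u) v) / real n" by simp
    finally show ?thesis .
  next
    case False
    \<comment> \<open>25 instead of 24 makes the comparison with the distance of \<open>v\<close>
      strict.\<close>
    have "card {w \<in> V. dist (Y w) z \<le> R - 25 * \<epsilon>} \<le> card {w \<in> V. dist (Y w) (Y u) < dist (Y v) (Y u)}"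
    proof (intro card_mono subsetI)
      fix w assume "w \<in> {w \<in> V. dist (Y w) z \<le> R - 25 * \<epsilon>}"
      then show "w \<in> {w \<in> V. dist (Y w) (Y u) < dist (Y v) (Y u)}"
        using tri(2)[of w] tri(1)[of v] eps by (auto simp: R_def)
    qed simp
    also have "\<dots> \<le> pos (\<tau> u) v" by (rule tau_pos_bounds(1)[OF u v])
    finally have "real (card {w \<in> V. dist (Y w) z \<le> R - 25 * \<epsilon>}) / real n \<le> real (pos (\<tau> u) v) / real n"
      by (intro divide_right_mono) auto
    moreover have "disc_area (R - 25 * \<epsilon>) - \<epsilon> \<le> real (card {w \<in> V. dist (Y w) z \<le> R - 25 * \<epsilon>}) / real n"
      using count[OF z(1), of "R - 25 * \<epsilon>"] False by (simp add: abs_le_iff)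
    moreover have "disc_area (R - 25 * \<epsilon> + 25 * \<epsilon>) \<le> disc_area (R - 25 * \<epsilon>) + 16/5 * (25 * \<epsilon>)"
      using False R eps eps' by (intro disc_area_lipschitz) auto
    ultimately show ?thesis using eps by simp
  qed
  show ?thesis using up lo by (simp add: R_def abs_le_iff)
qed

end

section \<open>Squared distances from ranks\<close>

context nice_points
begin

lemma tau_last_in: "u \<in> V \<Longrightarrow> last (\<tau> u) \<in> V"
  by (rule last_in[OF perm_lists_tau])

text \<open>The distance is within 12 \<epsilon> of 1, which changes the area by at most 40
  \<epsilon>; the rank error adds 100 \<epsilon>.\<close>

lemma rank_reference:
  assumes a: "a \<in> V" "z \<in> corners" "dist (Y a) z \<le> 12 * \<epsilon>"
    and b: "b \<in> V" "z' \<in> corners" "dist (Y b) z' \<le> 12 * \<epsilon>" and z: "dist z' z = 1"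
  shows "\<bar>real (pos (\<tau> a) b) / real n - kappa\<bar> \<le> 140 * \<epsilon>"
proof -
  define R where "R = dist (Y b) z"
  have R: "1 - 12 * \<epsilon> \<le> R" "R \<le> 1 + 12 * \<epsilon>"
    unfolding R_def using b(3) z by (smt (verit) dist_commute dist_triangle)+
  have k1: "disc_area 1 = kappa" by (simp add: disc_area_le1)
  have "disc_area R \<le> disc_area (1 + 12 * \<epsilon>)" using R by (intro disc_area_mono) simp
  also have "\<dots> \<le> kappa + 16/5 * (12 * \<epsilon>)" using disc_area_lipschitz[of 1 "12 * \<epsilon>"] eps eps' k1 by simp
  finally have 1: "disc_area R \<le> kappa + 40 * \<epsilon>" using eps by simp
  have "kappa \<le> disc_area (1 - 12 * \<epsilon>) + 16/5 * (12 * \<epsilon>)"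
    using disc_area_lipschitz[of "1 - 12 * \<epsilon>" "12 * \<epsilon>"] eps eps' k1 by simp
  also have "disc_area (1 - 12 * \<epsilon>) \<le> disc_area R" using R by (intro disc_area_mono) simp
  finally have 2: "kappa - 40 * \<epsilon> \<le> disc_area R" using eps by simp
  show ?thesis using rank_disc_area[OF a b(1)] 1 2 unfolding R_def[symmetric] by linarith
qed

text \<open>A rank not above the reference still permits an area excess of 240 \<epsilon>, hence a
  squared distance of up to 1 + 24000 \<epsilon>.\<close>

lemma rank_near_square:
  assumes u: "u \<in> V" "z \<in> corners" "dist (Y u) z \<le> 12 * \<epsilon>" and v: "v \<in> V"
    and k: "real (pos (\<tau> u) v) / real n \<le> kappa + 140 * \<epsilon>"
  shows "(dist (Y v) z)\<^sup>2 \<le> 1 + 24000 * \<epsilon>"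
    "\<bar>real (pos (\<tau> u) v) / real n - kappa * (dist (Y v) z)\<^sup>2\<bar> \<le> 24100 * \<epsilon>"
proof -
  note r = rank_disc_area[OF u v]
  have "disc_area (dist (Y v) z) \<le> kappa + 240 * \<epsilon>" using r k by linarith
  from disc_area_le_imp[OF zero_le_dist this] show i: "(dist (Y v) z)\<^sup>2 \<le> 1 + 24000 * \<epsilon>"
    using eps eps' by simp
  show "\<bar>real (pos (\<tau> u) v) / real n - kappa * (dist (Y v) z)\<^sup>2\<bar> \<le> 24100 * \<epsilon>"
    using disc_area_near_square[OF zero_le_dist i] r eps by simp
qed

text \<open>In the far case \<open>v\<close> inherits the value of a lens vertex \<open>x\<close>
  whose distance r is trapped near R. Its ranks for the neighbouring corners are below
  \<open>K\<close>, hence quadratic; as r is almost at least 1, the flag identity puts the opposite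
  corner within about 1, so that rank is quadratic as well.\<close>

lemma est_bound:
  assumes z: "z \<in> corners" and z12: "z1 = hflip z \<and> z2 = vflip z \<or> z1 = vflip z \<and> z2 = hflip z"
    and u: "u \<in> V" "dist (Y u) z \<le> 12 * \<epsilon>" and u1: "u1 \<in> V" "dist (Y u1) z1 \<le> 12 * \<epsilon>"
    and u2: "u2 \<in> V" "dist (Y u2) z2 \<le> 12 * \<epsilon>" and u3: "u3 \<in> V" "dist (Y u3) (opp z) \<le> 12 * \<epsilon>"
    and K: "\<bar>K / real n - kappa\<bar> \<le> 140 * \<epsilon>" and v: "v \<in> V" "dist (Y v) z \<le> 113/100"
  shows "\<bar>est K (\<tau> u) (\<tau> u1) (\<tau> u2) (\<tau> u3) v / real n - kappa * (dist (Y v) z)\<^sup>2\<bar> \<le> 100000 * \<epsilon>"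
proof -
  have zs: "z1 \<in> corners" "z2 \<in> corners" "opp z \<in> corners" using z12 corner_flips[OF z] by auto
  have np: "real n > 0" using n_pos by simp
  define k where "k = pos (\<tau> u) v"
  define S where "S = (\<lambda>w. real (pos (\<tau> u1) w) < K \<and> real (pos (\<tau> u2) w) < K)"
  define f where "f = (\<lambda>w. real (pos (\<tau> u1) w) + real (pos (\<tau> u2) w) - real (pos (\<tau> u3) w))"
  have e: "est K (\<tau> u) (\<tau> u1) (\<tau> u2) (\<tau> u3) v = (if K < real k then cal S f (\<tau> u) (Suc k) else real k)"
    by (simp add: est_def qval_def k_def S_def f_def)
  define R where "R = dist (Y v) z"
  have dom: "x / real n \<le> kappa + 140 * \<epsilon>" if "x \<le> K" for x
  proof -
    have "x / real n \<le> K / real n" using that np by (intro divide_right_mono) auto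
    then show ?thesis using K by linarith
  qed
  show ?thesis
  proof (cases "K < real k")
    case False
    then have "\<bar>real k / real n - kappa * R\<^sup>2\<bar> \<le> 24100 * \<epsilon>"
      using rank_near_square(2)[OF u(1) z u(2) v(1)] dom[of "real k"] by (simp add: k_def R_def)
    then show ?thesis using False e eps by (simp add: R_def)
  next
    case True
    have "K / real n \<le> real k / real n" using True np by (intro divide_right_mono) auto
    then have dR: "disc_area R \<ge> kappa - 240 * \<epsilon>"
      using rank_disc_area[OF u(1) z u(2) v(1)] K unfolding k_def[symmetric] R_def[symmetric] by linarith
    have R0: "R \<ge> 0" by (simp add: R_def)
    \<comment> \<open>490 bounds 240 * 100/49, and for R at most 1 the square of R is at most
      R.\<close>
    have R1: "R \<ge> 1 - 490 * \<epsilon>"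
    proof (cases "R \<le> 1")
      case True
      then have "R\<^sup>2 \<le> R * 1" unfolding power2_eq_square using R0 by (intro mult_left_mono) auto
      then show ?thesis using disc_area_ge_imp[OF R0 dR] eps by simp
    qed (use eps in simp)
    have R2: "R \<le> 113/100" using v(2) by (simp add: R_def)
    \<comment> \<open>Being at least 29 \<epsilon> closer than \<open>v\<close>, more than twice the
      offset 12 \<epsilon> of the centre, forces \<open>w\<close> to precede \<open>v\<close> in the
      list.\<close>
    obtain w where w: "w \<in> V" "R - 30 * \<epsilon> \<le> dist (Y w) z" "dist (Y w) z \<le> R - 30 * \<epsilon> + \<epsilon>"
      "(dist (Y w) z1)\<^sup>2 \<le> 98/100" "(dist (Y w) z2)\<^sup>2 \<le> 98/100"
      using lens_vertex[OF z, of "R - 30 * \<epsilon>"] R1 R2 eps eps' z12 by auto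
    have lens: "real (pos (\<tau> u') w) < K"
      if u': "u' \<in> V" "z' \<in> corners" "dist (Y u') z' \<le> 12 * \<epsilon>" "(dist (Y w) z')\<^sup>2 \<le> 98/100" for u' z'
    proof -
      have "(dist (Y w) z')\<^sup>2 \<le> 1\<^sup>2" using u'(4) by simp
      then have "dist (Y w) z' \<le> 1" by (rule power2_le_imp_le) simp
      then have "disc_area (dist (Y w) z') = kappa * (dist (Y w) z')\<^sup>2" by (simp add: disc_area_le1)
      moreover have "kappa * (dist (Y w) z')\<^sup>2 \<le> kappa * (98/100)" using u'(4) kappa_bounds by (intro mult_left_mono) auto
      ultimately have "real (pos (\<tau> u') w) / real n < K / real n"
        using rank_disc_area[OF u'(1-3) w(1)] K kappa_bounds eps' by linarith
      then show ?thesis using np by (simp add: divide_less_cancel)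
    qed
    have Sw: "S w" unfolding S_def using lens[OF u1(1) zs(1) u1(2) w(4)] lens[OF u2(1) zs(2) u2(2) w(5)] by simp
    note L = perm_listsD[OF perm_lists_tau[of n Y] u(1)]
    have tri: "dist (Y x) z \<le> dist (Y x) (Y u) + 12 * \<epsilon>" "dist (Y x) (Y u) \<le> dist (Y x) z + 12 * \<epsilon>" for x
      using u(2) by (smt (verit) dist_commute dist_triangle)+
    have pw: "pos (\<tau> u) w < length (\<tau> u)" "\<tau> u ! pos (\<tau> u) w = w" using nth_pos[OF L(1)] L w(1) by auto
    have "pos (\<tau> u) w \<le> k"
    proof (rule ccontr)
      assume "\<not> pos (\<tau> u) w \<le> k"
      then have "dist (Y v) (Y u) \<le> dist (Y w) (Y u)"
        using tau_pos_mono[OF u(1) v(1) w(1), of Y] by (simp add: k_def)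
      then show False using tri(1)[of v] tri(2)[of w] w(3) eps unfolding R_def by linarith
    qed
    then obtain j where j: "pos (\<tau> u) w \<le> j" "j \<le> k" "S (\<tau> u ! j)" "cal S f (\<tau> u) (Suc k) = f (\<tau> u ! j)"
      using cal_last[of "pos (\<tau> u) w" k S "\<tau> u" f] Sw pw by auto
    have kl: "k < length (\<tau> u)" "\<tau> u ! k = v" using nth_pos[OF L(1)] L v(1) by (auto simp: k_def)
    then have jl: "j < length (\<tau> u)" using j by simp
    define x where "x = \<tau> u ! j"
    have x: "x \<in> V" "pos (\<tau> u) x = j" unfolding x_def using jl L nth_mem pos_nth by blast+
    have "dist (Y w) (Y u) \<le> dist (Y x) (Y u)" "dist (Y x) (Y u) \<le> dist (Y v) (Y u)"
      using tau_pos_mono[OF u(1) w(1) x(1), of Y] tau_pos_mono[OF u(1) x(1) v(1), of Y] j x by (auto simp: k_def)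
    \<comment> \<open>The centre offset is paid twice on each side, and below it adds to the 30
      \<epsilon> of \<open>w\<close>.\<close>
    then have rx: "R - 54 * \<epsilon> \<le> dist (Y x) z" "dist (Y x) z \<le> R + 24 * \<epsilon>"
      using tri(1)[of x] tri(2)[of w] tri(2)[of v] tri(1)[of w] tri(2)[of x] w(2) unfolding R_def by linarith+
    define r where "r = dist (Y x) z"
    have r: "R - 54 * \<epsilon> \<le> r" "r \<le> R + 24 * \<epsilon>" "r \<ge> 0" using rx by (auto simp: r_def)
    have Kx: "real (pos (\<tau> u1) x) / real n \<le> kappa + 140 * \<epsilon>" "real (pos (\<tau> u2) x) / real n \<le> kappa + 140 * \<epsilon>"
      using j(3) dom by (auto simp: x_def S_def)
    note n1 = rank_near_square[OF u1(1) zs(1) u1(2) x(1) Kx(1)] and n2 = rank_near_square[OF u2(1) zs(2) u2(2) x(1) Kx(2)]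
    have bf: "r\<^sup>2 + (dist (Y x) (opp z))\<^sup>2 = (dist (Y x) z1)\<^sup>2 + (dist (Y x) z2)\<^sup>2"
      using british_flag[of "Y x" z] z12 by (auto simp: r_def)
    have r2: "r\<^sup>2 \<ge> 1 - 1200 * \<epsilon>"
    proof -
      have "(1 - 600 * \<epsilon>)\<^sup>2 \<le> r\<^sup>2" using r R1 eps' by (intro power_mono) auto
      moreover have "(1 - 600 * \<epsilon>)\<^sup>2 = 1 - 1200 * \<epsilon> + (600 * \<epsilon>)\<^sup>2" by (simp add: power2_eq_square algebra_simps)
      moreover have "(600 * \<epsilon>)\<^sup>2 \<ge> 0" by simp
      ultimately show ?thesis by linarith
    qed
    have n3: "\<bar>real (pos (\<tau> u3) x) / real n - kappa * (dist (Y x) (opp z))\<^sup>2\<bar> \<le> 49300 * \<epsilon>"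
    proof -
      define q where "q = dist (Y x) (opp z)"
      \<comment> \<open>Twice 24000 from the neighbouring corners plus 1200 from the lower bound on
        r^2.\<close>
      have q2: "q\<^sup>2 \<le> 1 + 49200 * \<epsilon>" using bf n1(1) n2(1) r2 unfolding q_def by linarith
      have "\<bar>disc_area q - kappa * q\<^sup>2\<bar> \<le> 49200 * \<epsilon>"
        by (rule disc_area_near_square[OF _ q2]) (use eps in \<open>simp_all add: q_def\<close>)
      then show ?thesis using rank_disc_area[OF u3(1) zs(3) u3(2) x(1)] unfolding q_def by linarith
    qed
    have fx: "f x / real n = real (pos (\<tau> u1) x) / real n + real (pos (\<tau> u2) x) / real n - real (pos (\<tau> u3) x) / real n"
      by (simp add: f_def add_divide_distrib diff_divide_distrib)
    have "kappa * r\<^sup>2 + kappa * (dist (Y x) (opp z))\<^sup>2 = kappa * (dist (Y x) z1)\<^sup>2 + kappa * (dist (Y x) z2)\<^sup>2"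
      using bf by (metis distrib_left)
    then have 1: "\<bar>f x / real n - kappa * r\<^sup>2\<bar> \<le> 97500 * \<epsilon>"
      using n1(2) n2(2) n3 unfolding fx by linarith
    have "\<bar>r\<^sup>2 - R\<^sup>2\<bar> = \<bar>r - R\<bar> * (r + R)"
    proof -
      have "r\<^sup>2 - R\<^sup>2 = (r - R) * (r + R)" by (simp add: power2_eq_square algebra_simps)
      then show ?thesis using r R0 by (simp add: abs_mult)
    qed
    also have "\<dots> \<le> (54 * \<epsilon>) * 3" using r R0 R2 eps eps' by (intro mult_mono) auto
    finally have rR: "\<bar>r\<^sup>2 - R\<^sup>2\<bar> \<le> 162 * \<epsilon>" by simp
    have "\<bar>kappa * r\<^sup>2 - kappa * R\<^sup>2\<bar> = kappa * \<bar>r\<^sup>2 - R\<^sup>2\<bar>"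
      using kappa_bounds by (simp add: abs_mult flip: right_diff_distrib)
    also have "\<dots> \<le> 1 * \<bar>r\<^sup>2 - R\<^sup>2\<bar>" using kappa_bounds by (intro mult_right_mono) auto
    finally have 2: "\<bar>kappa * r\<^sup>2 - kappa * R\<^sup>2\<bar> \<le> 162 * \<epsilon>" using rR by simp
    have ex: "est K (\<tau> u) (\<tau> u1) (\<tau> u2) (\<tau> u3) v = f x" using True e j(4) by (simp add: x_def)
    show ?thesis unfolding ex R_def[symmetric] using 1 2 eps(1) by linarith
  qed
qed

text \<open>The wedge makes the growth of the area quantitative. Cutting \<open>s\<close> off at 5/4
  keeps the annulus where the wedge bound is available, and monotonicity covers the rest.\<close>

lemma disc_area_gap:
  assumes "0 \<le> r" "0 \<le> s" "r\<^sup>2 \<le> 5/4" "s\<^sup>2 \<ge> r\<^sup>2 + 2/100"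
  shows "disc_area s > disc_area r + 200 * \<epsilon>"
proof -
  define t where "t = min s (5/4)"
  have s54: "r\<^sup>2 + 2/100 \<le> (5/4 :: real)\<^sup>2" using assms(3) by (simp add: power_divide)
  have t2: "r\<^sup>2 + 2/100 \<le> t\<^sup>2" using s54 assms(4) by (auto simp: t_def min_def)
  then have "r\<^sup>2 \<le> t\<^sup>2" by linarith
  then have rt: "r \<le> t" by (rule power2_le_imp_le) (use assms in \<open>simp add: t_def\<close>)
  have "wedge_area * (t\<^sup>2 - r\<^sup>2) \<le> disc_area t - disc_area r"
    using rt assms by (intro disc_area_lower) (auto simp: t_def)
  moreover have "1/100 * (2/100) \<le> wedge_area * (t\<^sup>2 - r\<^sup>2)" using wedge_area_ge t2 by (intro mult_mono) auto
  moreover have "disc_area t \<le> disc_area s" by (rule disc_area_mono) (simp add: t_def)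
  ultimately show ?thesis using eps' by linarith
qed

text \<open>Comparing two ranks compares two distances up to a small slack, except when
  \<open>v\<close> is so far from \<open>z'\<close> that areas no longer separate distances.\<close>

lemma closer_rank:
  assumes u: "u \<in> V" "z \<in> corners" "dist (Y u) z \<le> 12 * \<epsilon>" and u': "u' \<in> V" "z' \<in> corners" "dist (Y u') z' \<le> 12 * \<epsilon>"
    and v: "v \<in> V" "pos (\<tau> u) v \<le> pos (\<tau> u') v"
  shows "(dist (Y v) z')\<^sup>2 > 5/4 \<or> (dist (Y v) z)\<^sup>2 < (dist (Y v) z')\<^sup>2 + 2/100"
proof (rule ccontr)
  assume "\<not> ?thesis"
  then have "disc_area (dist (Y v) z) > disc_area (dist (Y v) z') + 200 * \<epsilon>"
    by (intro disc_area_gap) auto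
  moreover have "real (pos (\<tau> u) v) / real n \<le> real (pos (\<tau> u') v) / real n"
    using v by (intro divide_right_mono) auto
  ultimately show False using rank_disc_area[OF u v(1)] rank_disc_area[OF u' v(1)] by linarith
qed

end

text \<open>Both numerator and denominator are ranks, so the factors n and \<kappa> cancel; the
  quotient stays stable because \<kappa> is at least 49/100.\<close>

lemma ratio_bound:
  fixes o' K N \<Delta> \<epsilon> :: real
  assumes "\<bar>o' / N - kappa * \<Delta>\<bar> \<le> 200000 * \<epsilon>" "\<bar>K / N - kappa\<bar> \<le> 140 * \<epsilon>" "\<bar>\<Delta>\<bar> \<le> 1" "N > 0"
    "0 < \<epsilon>" "\<epsilon> \<le> 1 / 10000000"
  shows "\<bar>o' / (2 * K) - \<Delta> / 2\<bar> \<le> 300000 * \<epsilon>"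
proof -
  define p where "p = o' / N"
  define k where "k = K / N"
  have k: "k \<ge> 48/100" using assms(2,6) kappa_bounds unfolding k_def by linarith
  have "\<bar>k * \<Delta> - kappa * \<Delta>\<bar> = \<bar>k - kappa\<bar> * \<bar>\<Delta>\<bar>" by (simp flip: left_diff_distrib abs_mult)
  also have "\<dots> \<le> (140 * \<epsilon>) * 1" using assms by (intro mult_mono) (auto simp: k_def)
  finally have 1: "\<bar>p - k * \<Delta>\<bar> \<le> 200140 * \<epsilon>" using assms(1) unfolding p_def by linarith
  have "o' / (2 * K) - \<Delta> / 2 = (p - k * \<Delta>) / (2 * k)"
    using k assms(4) by (simp add: p_def k_def field_simps)
  then have "\<bar>o' / (2 * K) - \<Delta> / 2\<bar> = \<bar>p - k * \<Delta>\<bar> / (2 * k)" using k by simp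
  also have "\<dots> \<le> (200140 * \<epsilon>) / (2 * (48/100))" using 1 k by (intro frac_le) auto
  also have "\<dots> \<le> 300000 * \<epsilon>" using assms by simp
  finally show ?thesis .
qed

section \<open>From squared distances to coordinates\<close>

context nice_points
begin

lemma embedding_bound:
  assumes a: "a \<in> V" "dist (Y a) (0, 0) \<le> 12 * \<epsilon>" and b: "b \<in> V" "dist (Y b) (1, 0) \<le> 12 * \<epsilon>"
    and c: "c \<in> V" "dist (Y c) (1, 1) \<le> 12 * \<epsilon>" and d: "d \<in> V" "dist (Y d) (0, 1) \<le> 12 * \<epsilon>"
    and K: "K = real (pos (\<tau> a) b)" and v: "v \<in> V"
  shows "dist (Y v) (1/2 + out_x K (\<tau> a) (\<tau> b) (\<tau> c) (\<tau> d) v / (2 * K),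
    1/2 + out_y K (\<tau> a) (\<tau> b) (\<tau> c) (\<tau> d) v / (2 * K)) \<le> 1000000 * \<epsilon>"
proof -
  let ?oy = "out_y K (\<tau> a) (\<tau> b) (\<tau> c) (\<tau> d) v"
  let ?ox = "out_x K (\<tau> a) (\<tau> b) (\<tau> c) (\<tau> d) v"
  let ?ED = "est K (\<tau> d) (\<tau> a) (\<tau> c) (\<tau> b) v"
  let ?EC = "est K (\<tau> c) (\<tau> b) (\<tau> d) (\<tau> a) v"
  let ?EB = "est K (\<tau> b) (\<tau> a) (\<tau> c) (\<tau> d) v"
  let ?EA = "est K (\<tau> a) (\<tau> b) (\<tau> d) (\<tau> c) v"
  have cn: "(0, 0) \<in> corners" "(1, 0) \<in> corners" "(1, 1) \<in> corners" "(0, 1) \<in> corners" by (auto simp: corners_def)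
  have np: "real n > 0" using n_pos by simp
  obtain x y where xy: "Y v = (x, y)" by (cases "Y v")
  have xy1: "0 \<le> x" "x \<le> 1" "0 \<le> y" "y \<le> 1" using in_usq[OF v] by (auto simp: xy usq_def)
  have KK: "\<bar>K / real n - kappa\<bar> \<le> 140 * \<epsilon>"
    unfolding K by (rule rank_reference[OF a(1) cn(1) a(2) b(1) cn(2) b(2)]) (simp add: dist_Pair_Pair)
  have D: "(dist (Y v) (0, 0))\<^sup>2 = x\<^sup>2 + y\<^sup>2" "(dist (Y v) (1, 0))\<^sup>2 = (1 - x)\<^sup>2 + y\<^sup>2"
    "(dist (Y v) (1, 1))\<^sup>2 = (1 - x)\<^sup>2 + (1 - y)\<^sup>2" "(dist (Y v) (0, 1))\<^sup>2 = x\<^sup>2 + (1 - y)\<^sup>2"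
    by (simp_all add: xy dist_sq power2_commute)
  \<comment> \<open>A point at most 51/100 away from a side has both ends of that side within
    113/100, as 1 + 0.51^2 = 1.2601 < 1.2769.\<close>
  have sm: "t \<le> 113/100" if "t\<^sup>2 = p\<^sup>2 + q\<^sup>2" "0 \<le> p" "p \<le> 1" "0 \<le> q" "q \<le> 51/100" for t p q :: real
  proof -
    have "p\<^sup>2 \<le> 1\<^sup>2" "q\<^sup>2 \<le> (51/100)\<^sup>2" using that by (intro power_mono; simp)+
    then have "t\<^sup>2 \<le> (113/100)\<^sup>2" using that(1) by (simp add: power_divide)
    then show ?thesis by (rule power2_le_imp_le) simp
  qed
  have EA: "\<bar>?EA / real n - kappa * (x\<^sup>2 + y\<^sup>2)\<bar> \<le> 100000 * \<epsilon>" if "dist (Y v) (0, 0) \<le> 113/100"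
    unfolding D[symmetric] by (rule est_bound[OF cn(1) _ a b d _ _ KK v that, of c]) (use c in \<open>auto simp: hflip_def vflip_def opp_def\<close>)
  have EB: "\<bar>?EB / real n - kappa * ((1 - x)\<^sup>2 + y\<^sup>2)\<bar> \<le> 100000 * \<epsilon>" if "dist (Y v) (1, 0) \<le> 113/100"
    unfolding D[symmetric] by (rule est_bound[OF cn(2) _ b a c _ _ KK v that, of d]) (use d in \<open>auto simp: hflip_def vflip_def opp_def\<close>)
  have EC: "\<bar>?EC / real n - kappa * ((1 - x)\<^sup>2 + (1 - y)\<^sup>2)\<bar> \<le> 100000 * \<epsilon>" if "dist (Y v) (1, 1) \<le> 113/100"
    unfolding D[symmetric] by (rule est_bound[OF cn(3) _ c b d _ _ KK v that, of a]) (use a in \<open>auto simp: hflip_def vflip_def opp_def\<close>)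
  have ED: "\<bar>?ED / real n - kappa * (x\<^sup>2 + (1 - y)\<^sup>2)\<bar> \<le> 100000 * \<epsilon>" if "dist (Y v) (0, 1) \<le> 113/100"
    unfolding D[symmetric] by (rule est_bound[OF cn(4) _ d a c _ _ KK v that, of b]) (use b in \<open>auto simp: hflip_def vflip_def opp_def\<close>)
  have diff: "\<bar>(p - q) / real n - kappa * (2 * t - 1)\<bar> \<le> 200000 * \<epsilon>"
    if "\<bar>p / real n - kappa * s\<bar> \<le> 100000 * \<epsilon>" "\<bar>q / real n - kappa * s'\<bar> \<le> 100000 * \<epsilon>" "s - s' = 2 * t - 1" for p q s s' t
  proof -
    have "kappa * (2 * t - 1) = kappa * s - kappa * s'" unfolding that(3)[symmetric] by (rule right_diff_distrib)
    then show ?thesis using that(1,2) by (simp add: diff_divide_distrib)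
  qed
  \<comment> \<open>This absorbs the exceptional case of \<open>closer_rank\<close>: more than 5/4
    in squared distance from a corner of the other side already means more than 1/2 from that
    side.\<close>
  have half: "y < 51/100" if "x\<^sup>2 + (1 - y)\<^sup>2 > 5/4 \<or> (1 - x)\<^sup>2 + (1 - y)\<^sup>2 > 5/4 \<or> y\<^sup>2 < (1 - y)\<^sup>2 + 2/100"
    and "0 \<le> x" "x \<le> 1" "0 \<le> y" "y \<le> 1" for x y :: real
  proof (rule ccontr)
    assume "\<not> y < 51/100"
    then have "(1 - y)\<^sup>2 \<le> (1/2)\<^sup>2" using that by (intro power_mono) auto
    moreover have "x\<^sup>2 \<le> 1" "(1 - x)\<^sup>2 \<le> 1" using that by (auto intro: power_le_one)
    ultimately have "y\<^sup>2 < (1 - y)\<^sup>2 + 2/100" using that(1) by (simp add: power_divide)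
    then have "2 * y < 1 + 2/100" by (simp add: power2_eq_square algebra_simps)
    then show False using \<open>\<not> y < 51/100\<close> by simp
  qed
  have X: "\<bar>?ox / real n - kappa * (2 * x - 1)\<bar> \<le> 200000 * \<epsilon>"
  proof (cases "pos (\<tau> a) v < pos (\<tau> d) v")
    case True
    have "y < 51/100"
      using closer_rank[OF a(1) cn(1) a(2) d(1) cn(4) d(2) v] True xy1 unfolding D by (intro half[of x y]) auto
    then have "dist (Y v) (0, 0) \<le> 113/100" "dist (Y v) (1, 0) \<le> 113/100"
      using xy1 sm[OF D(1)] sm[OF D(2)] by auto
    note E = EA[OF this(1)] EB[OF this(2)]
    have "\<bar>(?EA - ?EB) / real n - kappa * (2 * x - 1)\<bar> \<le> 200000 * \<epsilon>"
      by (rule diff[OF E]) (simp add: power2_eq_square algebra_simps)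
    then show ?thesis using True by (simp add: out_x_def)
  next
    case False
    have "1 - y < 51/100"
      using closer_rank[OF d(1) cn(4) d(2) a(1) cn(1) a(2) v] False xy1 unfolding D by (intro half[of x "1 - y"]) auto
    then have "dist (Y v) (0, 1) \<le> 113/100" "dist (Y v) (1, 1) \<le> 113/100"
      using xy1 sm[OF D(4)] sm[OF D(3)] by auto
    note E = ED[OF this(1)] EC[OF this(2)]
    have "\<bar>(?ED - ?EC) / real n - kappa * (2 * x - 1)\<bar> \<le> 200000 * \<epsilon>"
      by (rule diff[OF E]) (simp add: power2_eq_square algebra_simps)
    then show ?thesis using False by (simp add: out_x_def)
  qed
  have Y: "\<bar>?oy / real n - kappa * (2 * y - 1)\<bar> \<le> 200000 * \<epsilon>"
  proof (cases "pos (\<tau> a) v < pos (\<tau> b) v")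
    case True
    have "x < 51/100"
      using closer_rank[OF a(1) cn(1) a(2) b(1) cn(2) b(2) v] True xy1 unfolding D by (intro half[of y x]) auto
    then have "dist (Y v) (0, 0) \<le> 113/100" "dist (Y v) (0, 1) \<le> 113/100"
      using xy1 sm[of "dist (Y v) (0, 0)" y x] sm[of "dist (Y v) (0, 1)" "1 - y" x] D by auto
    note E = EA[OF this(1)] ED[OF this(2)]
    have "\<bar>(?EA - ?ED) / real n - kappa * (2 * y - 1)\<bar> \<le> 200000 * \<epsilon>"
      by (rule diff[OF E]) (simp add: power2_eq_square algebra_simps)
    then show ?thesis using True by (simp add: out_y_def)
  next
    case False
    have "1 - x < 51/100"
      using closer_rank[OF b(1) cn(2) b(2) a(1) cn(1) a(2) v] False xy1 unfolding D by (intro half[of y "1 - x"]) auto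
    then have "dist (Y v) (1, 0) \<le> 113/100" "dist (Y v) (1, 1) \<le> 113/100"
      using xy1 sm[of "dist (Y v) (1, 0)" y "1 - x"] sm[of "dist (Y v) (1, 1)" "1 - y" "1 - x"] D by auto
    note E = EB[OF this(1)] EC[OF this(2)]
    have "\<bar>(?EB - ?EC) / real n - kappa * (2 * y - 1)\<bar> \<le> 200000 * \<epsilon>"
      by (rule diff[OF E]) (simp add: power2_eq_square algebra_simps)
    then show ?thesis using False by (simp add: out_y_def)
  qed
  have 1: "\<bar>2 * x - 1\<bar> \<le> 1" "\<bar>2 * y - 1\<bar> \<le> 1" using xy1 by auto
  define p where "p = ?ox / (2 * K)"
  define q where "q = ?oy / (2 * K)"
  have "\<bar>p - (2 * x - 1) / 2\<bar> \<le> 300000 * \<epsilon>" "\<bar>q - (2 * y - 1) / 2\<bar> \<le> 300000 * \<epsilon>"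
    unfolding p_def q_def using ratio_bound[OF X KK 1(1) np eps(1) eps'] ratio_bound[OF Y KK 1(2) np eps(1) eps'] by auto
  moreover have "x - (1/2 + p) = - (p - (2 * x - 1) / 2)" "y - (1/2 + q) = - (q - (2 * y - 1) / 2)"
    by (simp_all add: field_simps)
  ultimately have "\<bar>x - (1/2 + p)\<bar> + \<bar>y - (1/2 + q)\<bar> \<le> 1000000 * \<epsilon>"
    unfolding abs_minus_cancel using eps(1) by (simp only: abs_minus_cancel)
  moreover have "dist (x, y) (1/2 + p, 1/2 + q) \<le> \<bar>x - (1/2 + p)\<bar> + \<bar>y - (1/2 + q)\<bar>"
    unfolding dist_Pair_Pair dist_real_def using sqrt_sum_squares_le_sum_abs by force
  ultimately show ?thesis unfolding p_def q_def xy by linarith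
qed

text \<open>A vertex near (1, 0) has both ranks about \<kappa> n, so the maximiser is at distance
  almost 1 or more from (0, 0) and from (1, 1). Adding the two squared distances confines it to a
  corner, which must be another one.\<close>

lemma maxmin_corner:
  assumes a: "a \<in> V" "dist (Y a) (0, 0) \<le> 12 * \<epsilon>" and c: "c \<in> V" "dist (Y c) (1, 1) \<le> 12 * \<epsilon>"
    and e: "e \<in> V" "\<forall>v\<in>V. min (pos (\<tau> a) v) (pos (\<tau> c) v) \<le> min (pos (\<tau> a) e) (pos (\<tau> c) e)"
  shows "dist (Y e) (1, 0) \<le> 1/10 \<or> dist (Y e) (0, 1) \<le> 1/10"
proof -
  have cn: "(0, 0) \<in> corners" "(1, 0) \<in> corners" "(1, 1) \<in> corners" by (auto simp: corners_def)
  obtain v where v: "v \<in> V" "dist (Y v) (1, 0) \<le> \<epsilon>" using vertex_near[OF cn(2)] by blast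
  have m: "pos (\<tau> a) v \<le> pos (\<tau> a) e \<or> pos (\<tau> c) v \<le> pos (\<tau> a) e" "pos (\<tau> a) v \<le> pos (\<tau> c) e \<or> pos (\<tau> c) v \<le> pos (\<tau> c) e"
    using bspec[OF e(2) v(1)] by (auto simp: min_def split: if_splits)
  have v12: "dist (Y v) (1, 0) \<le> 12 * \<epsilon>" using v(2) eps by simp
  have lo: "kappa - 140 * \<epsilon> \<le> real (pos (\<tau> a) v) / real n" "kappa - 140 * \<epsilon> \<le> real (pos (\<tau> c) v) / real n"
    using rank_reference[OF a(1) cn(1) a(2) v(1) cn(2) v12] rank_reference[OF c(1) cn(3) c(2) v(1) cn(2) v12]
    by (simp_all add: dist_Pair_Pair dist_real_def abs_le_iff)
  have lo_e: "kappa - 140 * \<epsilon> \<le> real k / real n" if "pos (\<tau> a) v \<le> k \<or> pos (\<tau> c) v \<le> k" for k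
  proof -
    have "real (pos (\<tau> a) v) / real n \<le> real k / real n \<or> real (pos (\<tau> c) v) / real n \<le> real k / real n"
      using that by (auto intro: divide_right_mono)
    then show ?thesis using lo by linarith
  qed
  have far: "(dist (Y e) z)\<^sup>2 \<ge> 1 - 490 * \<epsilon>" if u: "u \<in> V" "z \<in> corners" "dist (Y u) z \<le> 12 * \<epsilon>"
    and k: "kappa - 140 * \<epsilon> \<le> real (pos (\<tau> u) e) / real n" for u z
  proof -
    have "kappa - 240 * \<epsilon> \<le> disc_area (dist (Y e) z)" using rank_disc_area[OF u e(1)] k by linarith
    from disc_area_ge_imp[OF zero_le_dist this] show ?thesis using eps by simp
  qed
  obtain x y where xy: "Y e = (x, y)" by (cases "Y e")
  have A: "x\<^sup>2 + y\<^sup>2 \<ge> 1 - 490 * \<epsilon>"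
    using far[OF a(1) cn(1) a(2) lo_e[OF m(1)]] by (simp add: xy dist_sq)
  have C: "(1 - x)\<^sup>2 + (1 - y)\<^sup>2 \<ge> 1 - 490 * \<epsilon>"
    using far[OF c(1) cn(3) c(2) lo_e[OF m(2)]] by (simp add: xy dist_sq power2_commute)
  \<comment> \<open>The two squared distances add up to 2 - 2 (x (1 - x) + y (1 - y)).\<close>
  have "x * (1 - x) + y * (1 - y) \<le> 490 * \<epsilon>" using A C by (simp add: power2_eq_square algebra_simps)
  then obtain z where z: "z \<in> corners" "dist (Y e) z \<le> 4 * (490 * \<epsilon>)"
    using near_corner[of x y "490 * \<epsilon>"] in_usq[OF e(1)] by (auto simp: xy)
  have big: "dist (Y e) z > 1/10" if "(dist (Y e) z)\<^sup>2 \<ge> 1 - 490 * \<epsilon>" for z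
  proof (rule ccontr)
    assume "\<not> dist (Y e) z > 1/10"
    then have "(dist (Y e) z)\<^sup>2 \<le> (1/10)\<^sup>2" by (intro power_mono) auto
    then show False using that eps' by (simp add: power_divide)
  qed
  have "z \<noteq> (0, 0)" "z \<noteq> (1, 1)"
    using big[of z] z(2) far[OF a(1) cn(1) a(2) lo_e[OF m(1)]] far[OF c(1) cn(3) c(2) lo_e[OF m(2)]] eps' by auto
  then have "z = (1, 0) \<or> z = (0, 1)" using z(1) by (auto simp: corners_def)
  then show ?thesis using z(2) eps' by auto
qed

text \<open>The position of \<open>e\<close> is used only with precision 1/10. Passing to the
  farthest vertex sharpens this: \<open>d\<close> and then \<open>b\<close> are within 12 \<epsilon>
  of their corners.\<close>

lemma alg_bound_oriented:
  assumes a: "a \<in> V" "dist (Y a) (0, 0) \<le> 12 * \<epsilon>" and e: "e \<in> V" "dist (Y e) (1, 0) \<le> 1/10"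
    and c: "c = last (\<tau> a)" and d: "d = last (\<tau> e)" and b: "b = last (\<tau> d)" and K: "K = real (pos (\<tau> a) b)" and v: "v \<in> V"
  shows "dist (Y v) (1/2 + out_x K (\<tau> a) (\<tau> b) (\<tau> c) (\<tau> d) v / (2 * K),
    1/2 + out_y K (\<tau> a) (\<tau> b) (\<tau> c) (\<tau> d) v / (2 * K)) \<le> 1000000 * \<epsilon>"
proof (rule embedding_bound[OF a _ _ _ _ _ _ K v])
  have opp: "dist (Y (last (\<tau> u))) (opp z) \<le> 12 * \<epsilon>" if "u \<in> V" "z \<in> corners" "dist (Y u) z \<le> 1/10" for u z
    using that tau_last[of u n _ Y] tau_last_in by (intro farthest_opp[OF in_usq]) auto
  show c': "c \<in> V" unfolding c by (rule tau_last_in[OF a(1)])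
  show d': "d \<in> V" unfolding d by (rule tau_last_in[OF e(1)])
  show "b \<in> V" unfolding b by (rule tau_last_in[OF d'])
  have s: "x \<le> 1/10" if "x \<le> 12 * \<epsilon>" for x using that eps' by linarith
  show "dist (Y c) (1, 1) \<le> 12 * \<epsilon>" using opp[OF a(1) _ s[OF a(2)]] by (simp add: c opp_def corners_def)
  show dd: "dist (Y d) (0, 1) \<le> 12 * \<epsilon>" using opp[OF e(1) _ e(2)] by (simp add: d opp_def corners_def)
  show "dist (Y b) (1, 0) \<le> 12 * \<epsilon>" using opp[OF d' _ s[OF dd]] by (simp add: b opp_def corners_def)
qed

end

section \<open>Removing the orientation by symmetry\<close>

lemma tau_isometry:
  assumes "\<And>p q. dist (f p) (f q) = dist p q"
  shows "tau n (f \<circ> Y) = tau n Y"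
  by (simp add: tau_def fun_eq_iff assms)

lemma dist_flip: "dist (flip z p) (flip z q) = dist p q"
  by (cases p; cases q) (auto simp: flip_def dist_Pair_Pair dist_real_def power2_commute)

lemma dist_swap: "dist (prod.swap p) (prod.swap q) = dist p q" for p q :: "real \<times> real"
  by (cases p; cases q) (simp add: dist_Pair_Pair add.commute)

text \<open>The lists are invariant under isometries, so the configuration may be reflected until
  \<open>a\<close> sits at the origin without changing the output; the symmetry used reappears in
  the conclusion.\<close>

theorem alg_bound:
  assumes nice: "nice n \<epsilon> Y" and eps: "0 < \<epsilon>" "\<epsilon> \<le> 1 / 10 ^ 7" and alg: "alg n (tau n Y) out"
  shows "\<exists>z\<in>corners. \<exists>s\<in>{id, prod.swap}. \<forall>v\<in>{1..n}.
    dist (s (flip z (Y v))) ((1/2, 1/2) + (1 / sqrt (real n)) *\<^sub>R out v) \<le> 1000000 * \<epsilon>"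
proof -
  interpret Y: nice_points n \<epsilon> Y using assms by unfold_locales
  let ?\<tau> = "tau n Y"
  obtain a b c d e where abcd: "a = last (?\<tau> 1)" "c = last (?\<tau> a)" "e \<in> {1..n}"
     and mx: "\<forall>v\<in>{1..n}. min (pos (?\<tau> a) v) (pos (?\<tau> c) v) \<le> min (pos (?\<tau> a) e) (pos (?\<tau> c) e)"
     and db: "d = last (?\<tau> e)" "b = last (?\<tau> d)"
     and out: "\<forall>v\<in>{1..n}. out v = (out_x (real (pos (?\<tau> a) b)) (?\<tau> a) (?\<tau> b) (?\<tau> c) (?\<tau> d) v * (sqrt (real n) / real (pos (?\<tau> a) b) / 2),
        out_y (real (pos (?\<tau> a) b)) (?\<tau> a) (?\<tau> b) (?\<tau> c) (?\<tau> d) v * (sqrt (real n) / real (pos (?\<tau> a) b) / 2))"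
    using alg unfolding alg_def Let_def by blast
  have np: "n > 0" by (rule Y.n_pos)
  have 1: "1 \<in> {1..n}" using np by simp
  have a: "a \<in> {1..n}" unfolding abcd(1) by (rule Y.tau_last_in[OF 1])
  have c: "c \<in> {1..n}" unfolding abcd(2) by (rule Y.tau_last_in[OF a])
  define K where "K = real (pos (?\<tau> a) b)"
  have out': "(1/2, 1/2) + (1 / sqrt (real n)) *\<^sub>R out v =
     (1/2 + out_x K (?\<tau> a) (?\<tau> b) (?\<tau> c) (?\<tau> d) v / (2 * K), 1/2 + out_y K (?\<tau> a) (?\<tau> b) (?\<tau> c) (?\<tau> d) v / (2 * K))"
    if "v \<in> {1..n}" for v
    using np bspec[OF out that] by (simp add: K_def)
  obtain z where z: "z \<in> corners" "dist (Y a) z \<le> 12 * \<epsilon>"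
    using Y.farthest_near_corner[OF Y.in_usq[OF 1] a] tau_last[OF 1] unfolding abcd(1) by blast
  define Z where "Z = flip z \<circ> Y"
  interpret Z: nice_points n \<epsilon> Z unfolding Z_def using nice_flip[OF nice z(1)] eps by unfold_locales
  have tZ: "tau n Z = ?\<tau>" unfolding Z_def by (rule tau_isometry) (rule dist_flip)
  have aZ: "dist (Z a) (0, 0) \<le> 12 * \<epsilon>" using z by (simp add: Z_def norm_flip flip: zero_prod_def)
  have cZ: "dist (Z c) (1, 1) \<le> 12 * \<epsilon>"
  proof -
    have "dist (Z a) (0, 0) \<le> 1/10" using aZ Y.eps' by linarith
    then have "dist (Z c) (opp (0, 0)) \<le> 12 * \<epsilon>"
      using Z.farthest_opp[OF Z.in_usq[OF a] _ _ c, of "(0, 0)"] tau_last[OF a, of _ Z] unfolding tZ abcd(2) by (auto simp: corners_def)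
    then show ?thesis by (simp add: opp_def)
  qed
  have "dist (Z e) (1, 0) \<le> 1/10 \<or> dist (Z e) (0, 1) \<le> 1/10"
    by (rule Z.maxmin_corner[OF a aZ c cZ abcd(3)]) (use mx in \<open>simp only: tZ\<close>)
  then show ?thesis
  proof
    assume e: "dist (Z e) (1, 0) \<le> 1/10"
    have "dist (Z v) ((1/2, 1/2) + (1 / sqrt (real n)) *\<^sub>R out v) \<le> 1000000 * \<epsilon>" if v: "v \<in> {1..n}" for v
      unfolding out'[OF v] using Z.alg_bound_oriented[OF a aZ abcd(3) e _ _ _ _ v, unfolded tZ, OF abcd(2) db K_def] .
    then show ?thesis using z(1) by (intro bexI[of _ z] bexI[of _ id]) (auto simp: Z_def)
  next
    assume e: "dist (Z e) (0, 1) \<le> 1/10"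
    \<comment> \<open>Swapping the coordinates fixes the corners of \<open>a\<close> and
      \<open>c\<close> and exchanges the other two, which restores the oriented case.\<close>
    define W where "W = prod.swap \<circ> Z"
    interpret W: nice_points n \<epsilon> W unfolding W_def using nice_swap[OF Z.nice] eps by unfold_locales
    have tW: "tau n W = ?\<tau>" unfolding W_def tZ[symmetric] by (rule tau_isometry) (rule dist_swap)
    have aW: "dist (W a) (0, 0) \<le> 12 * \<epsilon>" and eW: "dist (W e) (1, 0) \<le> 1/10"
      using aZ e dist_swap[of "Z a" "(0, 0)"] dist_swap[of "Z e" "(0, 1)"] by (simp_all add: W_def)
    have "dist (W v) ((1/2, 1/2) + (1 / sqrt (real n)) *\<^sub>R out v) \<le> 1000000 * \<epsilon>" if v: "v \<in> {1..n}" for v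
      unfolding out'[OF v] using W.alg_bound_oriented[OF a aW abcd(3) eW _ _ _ _ v, unfolded tW, OF abcd(2) db K_def] .
    then show ?thesis using z(1) by (intro bexI[of _ z] bexI[of _ prod.swap]) (auto simp: Z_def W_def)
  qed
qed

section \<open>Concentration\<close>

text \<open>For negative c = -s the bound follows from (1 + s) (1 - s + s^2) = 1 + s^3 and 1 + s
  \<le> exp s.\<close>

lemma exp_quadratic_bound:
  fixes c :: real
  assumes "\<bar>c\<bar> \<le> 1"
  shows "exp c \<le> 1 + c + c\<^sup>2"
proof (cases "c \<ge> 0")
  case True
  then show ?thesis using assms by (intro exp_bound) auto
next
  case False
  define s where "s = - c"
  have s: "0 < s" "s \<le> 1" using False assms by (auto simp: s_def)
  have "1 \<le> 1 + s ^ 3" using s by simp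
  also have "\<dots> = (1 + s) * (1 - s + s\<^sup>2)" by (simp add: power2_eq_square power3_eq_cube algebra_simps)
  also have "\<dots> \<le> exp s * (1 - s + s\<^sup>2)"
    using s exp_ge_add_one_self[of s] by (intro mult_right_mono) auto
  finally have "exp (- s) \<le> 1 - s + s\<^sup>2" by (simp add: exp_minus field_simps)
  then show ?thesis by (simp add: s_def)
qed

section \<open>Chernoff bounds for the number of points in a set\<close>

locale iid = prob_space M for M :: "'a measure" +
  fixes n :: nat
begin

abbreviation "PM \<equiv> Pi\<^sub>M {1..n} (\<lambda>_. M)"

sublocale P: product_prob_space "\<lambda>_. M" "{1..n}"
  by unfold_locales

definition hits :: "'a set \<Rightarrow> (nat \<Rightarrow> 'a) \<Rightarrow> nat" where
  "hits A X = card {v\<in>{1..n}. X v \<in> A}"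

lemma hits_sum: "real (hits A X) = (\<Sum>v\<in>{1..n}. indicator A (X v))"
  by (simp add: hits_def indicator_def sum.If_cases Int_def)

lemma measurable_hits [measurable]:
  assumes "A \<in> sets M" shows "(\<lambda>X. real (hits A X)) \<in> borel_measurable PM"
  unfolding hits_sum using assms by measurable

text \<open>Exponential Markov inequality; a negative \<open>c\<close> yields the lower tail. An
  upper bound \<open>p\<close> in place of the probability makes the estimate uniform over a family
  of sets.\<close>

lemma chernoff_one_sided:
  assumes A: "A \<in> sets M" "prob A \<le> p" and c: "\<bar>c\<bar> \<le> 1"
  shows "measure PM {X\<in>space PM. t \<le> c * (real (hits A X) - real n * prob A)} \<le> exp (real n * p * c\<^sup>2 - t)"
proof -
  define a where "a = prob A"
  define g where "g = (\<lambda>x. exp (c * (indicator A x - a)))"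
  \<comment> \<open>Affine in the indicator, so the expectation is explicit.\<close>
  have g: "g = (\<lambda>x. exp (- (c * a)) * (1 + (exp c - 1) * indicator A x))"
    by (auto simp: g_def fun_eq_iff indicator_def right_diff_distrib exp_diff exp_minus field_simps)
  have int: "integrable M g" unfolding g using A
    by (intro integrable_mult_right Bochner_Integration.integrable_add integrable_real_indicator) (auto simp: less_top[symmetric])
  have "(\<integral>x. g x \<partial>M) = exp (- (c * a)) * (1 + (exp c - 1) * a)"
  proof -
    have "(\<integral>x. 1 + (exp c - 1) * indicator A x \<partial>M) = (\<integral>x. 1 \<partial>M) + (\<integral>x. (exp c - 1) * indicator A x \<partial>M)"
      using A by (intro Bochner_Integration.integral_add integrable_mult_right integrable_real_indicator) (auto simp: less_top[symmetric])
    then show ?thesis unfolding g using A by (simp add: a_def prob_space)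
  qed
  also have "\<dots> \<le> exp (- (c * a)) * exp ((exp c - 1) * a)"
    by (intro mult_left_mono exp_ge_add_one_self) simp
  also have "\<dots> = exp (a * (exp c - 1 - c))" by (simp add: algebra_simps flip: exp_add)
  also have "\<dots> \<le> exp (p * c\<^sup>2)"
  proof -
    have "a * (exp c - 1 - c) \<le> a * c\<^sup>2"
      using exp_quadratic_bound[OF c] by (intro mult_left_mono) (auto simp: a_def)
    also have "\<dots> \<le> p * c\<^sup>2" using A by (intro mult_right_mono) (auto simp: a_def)
    finally show ?thesis by simp
  qed
  finally have gi: "(\<integral>x. g x \<partial>M) \<le> exp (p * c\<^sup>2)" .
  define u where "u = (\<lambda>X. \<Prod>v\<in>{1..n}. g (X v))"
  have u: "u X = exp (c * (real (hits A X) - real n * a))" for X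
  proof -
    have "(\<Sum>v\<in>{1..n}. c * (indicator A (X v) - a)) = c * (real (hits A X) - real n * a)"
      unfolding hits_sum by (simp only: sum_distrib_left[symmetric] sum_subtractf) simp
    then show ?thesis by (simp add: u_def g_def flip: exp_sum)
  qed
  have iu: "integrable PM u" unfolding u_def by (rule P.product_integrable_prod[OF _ int]) simp
  have "(\<integral>X. u X \<partial>PM) = (\<Prod>v\<in>{1..n}. \<integral>x. g x \<partial>M)"
    unfolding u_def by (rule P.product_integral_prod[OF _ int]) simp
  also have "\<dots> \<le> exp (p * c\<^sup>2) ^ n"
    using gi by (simp add: power_mono g_def)
  finally have "(\<integral>X. u X \<partial>PM) \<le> exp (real n * p * c\<^sup>2)" by (simp add: exp_of_nat_mult mult.assoc)
  moreover have "measure PM {X\<in>space PM. u X \<ge> exp t} \<le> (\<integral>X. u X \<partial>PM) / exp t"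
    by (rule integral_Markov_inequality_measure[OF iu, of "{}"]) (auto simp: u)
  ultimately have "measure PM {X\<in>space PM. u X \<ge> exp t} \<le> exp (real n * p * c\<^sup>2) / exp t"
    by (meson divide_right_mono exp_ge_zero order_trans)
  then show ?thesis by (simp add: u a_def exp_diff)
qed

lemma chernoff:
  assumes A: "A \<in> sets M" "prob A \<le> p" and s: "0 \<le> s" "s \<le> 1"
  shows "measure PM {X\<in>space PM. t < \<bar>real (hits A X) - real n * prob A\<bar>} \<le> 2 * exp (real n * p * s\<^sup>2 - s * t)"
proof -
  let ?S = "\<lambda>c. {X\<in>space PM. s * t \<le> c * (real (hits A X) - real n * prob A)}"
  have m: "?S c \<in> sets PM" for c using A by measurable
  have "measure PM {X\<in>space PM. t < \<bar>real (hits A X) - real n * prob A\<bar>} \<le> measure PM (?S s \<union> ?S (- s))"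
  proof (rule P.finite_measure_mono)
    show "{X\<in>space PM. t < \<bar>real (hits A X) - real n * prob A\<bar>} \<subseteq> ?S s \<union> ?S (- s)"
    proof
      fix X assume X: "X \<in> {X\<in>space PM. t < \<bar>real (hits A X) - real n * prob A\<bar>}"
      have "s * t \<le> s * \<bar>real (hits A X) - real n * prob A\<bar>" using X s by (intro mult_left_mono) auto
      then show "X \<in> ?S s \<union> ?S (- s)" using X by (cases "real (hits A X) - real n * prob A \<ge> 0") (auto simp: abs_if algebra_simps)
    qed
  qed (rule sets.Un[OF m m])
  also have "\<dots> \<le> measure PM (?S s) + measure PM (?S (- s))"
    by (rule measure_Un_le[OF m m])
  also have "\<dots> \<le> exp (real n * p * s\<^sup>2 - s * t) + exp (real n * p * (- s)\<^sup>2 - s * t)"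
    using s chernoff_one_sided[OF A, of s "s * t"] chernoff_one_sided[OF A, of "- s" "s * t"] by (intro add_mono) auto
  finally show ?thesis by simp
qed

lemma no_hit:
  assumes A: "A \<in> sets M"
  shows "{X\<in>space PM. hits A X = 0} \<in> sets PM"
    "measure PM {X\<in>space PM. hits A X = 0} \<le> exp (- (real n * prob A))"
proof -
  \<comment> \<open>Missing \<open>A\<close> is a product event, which gives both measurability and
    the power (1 - prob A)^n.\<close>
  have eq: "{X\<in>space PM. hits A X = 0} = Pi\<^sub>E {1..n} (\<lambda>_. space M - A)"
    by (auto simp: hits_def space_PiM PiE_iff extensional_def)
  show "{X\<in>space PM. hits A X = 0} \<in> sets PM"
    unfolding eq using A by (intro sets_PiM_I_finite) auto
  interpret F: finite_product_prob_space "\<lambda>_. M" "{1..n}" by unfold_locales simp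
  have "measure PM {X\<in>space PM. hits A X = 0} = (1 - prob A) ^ n"
    unfolding eq using A by (subst F.finite_measure_PiM_emb) (auto simp: prob_compl)
  also have "\<dots> \<le> exp (- prob A) ^ n"
    using exp_ge_add_one_self[of "- prob A"] by (intro power_mono) auto
  also have "\<dots> = exp (- (real n * prob A))" by (simp flip: exp_of_nat_mult)
  finally show "measure PM {X\<in>space PM. hits A X = 0} \<le> exp (- (real n * prob A))" .
qed

end

section \<open>Transfer of the uniform distribution to the unit square\<close>

definition to_unit :: "nat \<Rightarrow> real \<times> real \<Rightarrow> real \<times> real" where
  "to_unit n p = (1/2, 1/2) + (1 / sqrt (real n)) *\<^sub>R p"

lemma measurable_to_unit [measurable]: "to_unit n \<in> borel_measurable borel"
  unfolding to_unit_def by measurable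

lemma measurable_flip [measurable]: "flip z \<in> borel_measurable borel"
proof -
  have "continuous_on UNIV (flip z)" unfolding flip_def[abs_def]
    by (cases "fst z = 0"; cases "snd z = 0"; simp; intro continuous_intros)
  then show ?thesis by (rule borel_measurable_continuous_onI)
qed

lemma to_unit_sq: "n \<ge> 1 \<Longrightarrow> flip z (to_unit n p) \<in> usq \<longleftrightarrow> p \<in> sq n"
  by (cases p) (auto simp: to_unit_def flip_def usq_def sq_def field_simps)

text \<open>Rescaling followed by a reflection is a diagonal affine map with entries of modulus 1 /
  sqrt n, so its Jacobian is 1 / n whichever corner is chosen.\<close>

lemma measure_flip_to_unit:
  assumes n: "n \<ge> 1" and A: "A \<in> sets borel"
  shows "measure lborel ((\<lambda>p. flip z (to_unit n p)) -` A) = real n * measure lborel A"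
proof -
  define c where "c = (\<lambda>j :: real \<times> real. (if j = (1, 0) then (if fst z = 0 then 1 else -1) else (if snd z = 0 then 1 else - 1)) / sqrt (real n))"
  define T where "T x = (1/2, 1/2) + (\<Sum>j\<in>Basis. (c j * (x \<bullet> j)) *\<^sub>R j)" for x
  have T: "flip z (to_unit n p) = T p" for p
    by (cases p) (auto simp: T_def c_def to_unit_def flip_def Basis_prod_def sum.union_disjoint)
  have [measurable]: "T \<in> borel_measurable borel" unfolding T[symmetric, abs_def] by measurable
  have p: "(\<Prod>j\<in>Basis. \<bar>c j\<bar>) = 1 / real n"
    using n by (auto simp: Basis_prod_def c_def prod.union_disjoint)
  have "emeasure lborel A = emeasure (density (distr lborel borel T) (\<lambda>_. ennreal (\<Prod>j\<in>Basis. \<bar>c j\<bar>))) A"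
    unfolding T_def by (subst lborel_affine_euclidean[of c "(1/2, 1/2)"]) (use n in \<open>auto simp: c_def\<close>)
  also have "\<dots> = ennreal (1 / real n) * emeasure lborel (T -` A)"
    unfolding p using A by (subst emeasure_density_const) (auto simp: emeasure_distr)
  finally have "measure lborel A = 1 / real n * measure lborel (T -` A)"
    by (simp add: measure_def enn2real_mult)
  then show ?thesis using n by (simp add: T[abs_def] field_simps)
qed

lemma usq_area: "measure lborel usq = 1"
  using measure_box[of 0 1 0 1] by (simp add: usq_def)

lemma sq_area: "n \<ge> 1 \<Longrightarrow> measure lborel (sq n) = real n" "n \<ge> 1 \<Longrightarrow> sq n \<in> sets borel"
proof -
  assume n: "n \<ge> 1"
  have "(\<lambda>p. flip (0, 0) (to_unit n p)) -` usq = sq n" unfolding vimage_def to_unit_sq[OF n] by simp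
  then show "measure lborel (sq n) = real n"
    using measure_flip_to_unit[OF n, of usq "(0, 0)"] usq_area by simp
  show "sq n \<in> sets borel" unfolding sq_def by (rule borel_box)
qed

definition point_dist :: "nat \<Rightarrow> (real \<times> real) measure" where
  "point_dist n = uniform_measure lborel (sq n)"

lemma emeasure_sq: "n \<ge> 1 \<Longrightarrow> emeasure lborel (sq n) = ennreal (real n)"
proof -
  assume n: "n \<ge> 1"
  have "bounded (sq n)" unfolding sq_def by (intro bounded_Times) auto
  then have "emeasure lborel (sq n) < \<infinity>" by (rule emeasure_bounded_finite)
  then show ?thesis using sq_area[OF n] by (simp add: emeasure_eq_ennreal_measure less_top[symmetric])
qed

lemma prob_space_point_dist: "n \<ge> 1 \<Longrightarrow> prob_space (point_dist n)"
  unfolding point_dist_def by (rule prob_space_uniform_measure) (simp_all add: emeasure_sq)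

lemma sets_point_dist [measurable_cong]: "sets (point_dist n) = sets borel"
  by (simp add: point_dist_def)

lemma point_dist_preimage:
  assumes n: "n \<ge> 1" and A: "A \<in> sets borel"
  shows "measure (point_dist n) ((\<lambda>p. flip z (to_unit n p)) -` A) = measure lborel (usq \<inter> A)"
proof -
  let ?T = "\<lambda>p. flip z (to_unit n p)"
  have "?T -` A \<in> sets borel" using measurable_sets_borel[of ?T borel A] A by measurable
  then have "measure (point_dist n) (?T -` A) = measure lborel (sq n \<inter> ?T -` A) / real n"
    unfolding point_dist_def using n by (subst measure_uniform_measure) (simp_all add: emeasure_sq sq_area)
  also have "sq n \<inter> ?T -` A = ?T -` (usq \<inter> A)" unfolding vimage_def using to_unit_sq[OF n, of z] by blast
  also have "measure lborel \<dots> = real n * measure lborel (usq \<inter> A)"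
    using A by (intro measure_flip_to_unit n) auto
  finally show ?thesis using n by simp
qed

lemma corners_finite: "finite corners" "card corners = 4"
  by (simp_all add: corners_def)

lemma pts_eq: "pts n = Pi\<^sub>M {1..n} (\<lambda>_. point_dist n)"
  by (simp add: pts_def point_dist_def)

lemma norm_usq: "p \<in> usq \<Longrightarrow> norm p \<le> 3/2"
proof -
  assume "p \<in> usq"
  moreover have "0 \<in> usq" by (simp add: usq_def zero_prod_def)
  ultimately show ?thesis using dist_usq[of p 0] by simp
qed

text \<open>\<open>M\<close> counts the coarse radii and \<open>p\<close> bounds the area of a ring
  of width 3 / (2 M) with outer radius at most 3/2. The last condition keeps the Chernoff parameter
  of the rings at most 1, and n \<epsilon> \<ge> 10 makes the fine grid dense enough.\<close>

locale unit_points =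
  fixes n :: nat and \<epsilon> p :: real and M :: nat
  assumes n: "n \<ge> 1" and eps: "0 < \<epsilon>" "\<epsilon> \<le> 1/100" and neps: "real n * \<epsilon> \<ge> 10"
    and M: "M > 0" "9/2 / real M \<le> p" and p: "\<epsilon> / (8 * p) \<le> 1"
begin

sublocale iid "point_dist n" n
  unfolding iid_def by (rule prob_space_point_dist[OF n])

section \<open>Radii, bad events and their probabilities\<close>

definition T :: "real \<times> real \<Rightarrow> (real \<times> real) set \<Rightarrow> (real \<times> real) set" where
  "T z A = (\<lambda>p. flip z (to_unit n p)) -` A"

lemma T_sets: "A \<in> sets borel \<Longrightarrow> T z A \<in> sets (point_dist n)"
proof -
  assume A: "A \<in> sets borel"
  have "(\<lambda>p. flip z (to_unit n p)) \<in> borel_measurable borel" by measurable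
  from measurable_sets_borel[OF this A] show ?thesis unfolding T_def sets_point_dist .
qed

lemma prob_T: "A \<in> sets borel \<Longrightarrow> prob (T z A) = measure lborel (usq \<inter> A)"
  unfolding T_def by (rule point_dist_preimage[OF n])

lemma hits_T: "hits (T z A) X = card {v\<in>{1..n}. flip z (to_unit n (X v)) \<in> A}"
  by (simp add: hits_def T_def)

lemma prob_T_cball: "prob (T z (cball 0 r)) = disc_area r"
  by (simp add: prob_T disc_area_commute)

lemma hits_Diff:
  assumes "B \<subseteq> A" shows "hits (T z A) X = hits (T z B) X + hits (T z (A - B)) X"
proof -
  have "{v\<in>{1..n}. flip z (to_unit n (X v)) \<in> A} =
    {v\<in>{1..n}. flip z (to_unit n (X v)) \<in> B} \<union> {v\<in>{1..n}. flip z (to_unit n (X v)) \<in> A - B}" using assms by auto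
  then show ?thesis unfolding hits_T by (subst card_Un_disjoint[symmetric]) auto
qed

text \<open>\<open>j = 0\<close> gives the coarse radii and \<open>j\<close> up to n subdivides the
  step to the next one. The total range is 3/2, more than the diameter of the unit square.\<close>

definition rad :: "nat \<Rightarrow> nat \<Rightarrow> real" where
  "rad i j = 3/2 * (real i + real j / real n) / real M"

definition strip :: "nat \<Rightarrow> real" where "strip j = 9/10 + real j * (\<epsilon> / 2)"

definition ring :: "nat \<Rightarrow> nat \<Rightarrow> (real \<times> real) set" where
  "ring i j = cball 0 (rad i j) - cball 0 (rad i 0)"

text \<open>The radii from 9/10 to 57/50 span 6/25, covered in steps of \<epsilon> / 2.\<close>

definition J :: nat where "J = nat \<lceil>12/25 / \<epsilon>\<rceil>"

text \<open>A quarter of the allowance each for the coarse disc and the ring; the other half is left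
  for rounding a radius to the grid.\<close>

definition dev :: "real \<times> real \<Rightarrow> (real \<times> real) set \<Rightarrow> (nat \<Rightarrow> real \<times> real) set" where
  "dev z A = {X\<in>space PM. real n * \<epsilon> / 4 < \<bar>real (hits (T z A) X) - real n * prob (T z A)\<bar>}"

definition miss :: "real \<times> real \<Rightarrow> (real \<times> real) set \<Rightarrow> (nat \<Rightarrow> real \<times> real) set" where
  "miss z A = {X\<in>space PM. hits (T z A) X = 0}"

definition wedge_part :: "nat \<Rightarrow> (real \<times> real) set" where
  "wedge_part j = wedge \<inter> cball 0 (strip (Suc j)) - cball 0 (strip j)"

definition bad :: "real \<times> real \<Rightarrow> (nat \<Rightarrow> real \<times> real) set" where
  "bad z = miss z (cball 0 \<epsilon>) \<union> (\<Union>i\<in>{..<M}. dev z (cball 0 (rad i 0))) \<union>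
     (\<Union>x\<in>{..<M} \<times> {..n}. dev z (ring (fst x) (snd x))) \<union> (\<Union>j\<in>{..J}. miss z (wedge_part j))"

definition outside :: "(nat \<Rightarrow> real \<times> real) set" where
  "outside = space PM - Pi\<^sub>E {1..n} (\<lambda>_. sq n)"

lemma dev_sets: "A \<in> sets borel \<Longrightarrow> dev z A \<in> sets PM"
proof -
  assume "A \<in> sets borel"
  note T_sets[OF this, measurable]
  show ?thesis unfolding dev_def by measurable
qed

lemma miss_sets: "A \<in> sets borel \<Longrightarrow> miss z A \<in> sets PM"
  unfolding miss_def by (intro no_hit(1) T_sets)

lemma borel_parts: "ring i j \<in> sets borel" "wedge_part j \<in> sets borel"
  unfolding ring_def wedge_part_def by auto

lemma bad_sets: "bad z \<in> sets PM"
  unfolding bad_def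
  by (intro sets.Un sets.finite_UN dev_sets miss_sets borel_parts) simp_all

lemma n_pos: "real n > 0" using n by simp

lemma miss_prob:
  assumes "A \<in> sets borel" "a \<le> measure lborel (usq \<inter> A)"
  shows "measure PM (miss z A) \<le> exp (- (real n * a))"
proof -
  have "measure PM (miss z A) \<le> exp (- (real n * prob (T z A)))"
    unfolding miss_def by (rule no_hit(2)[OF T_sets[OF assms(1)]])
  also have "\<dots> \<le> exp (- (real n * a))" using assms prob_T[OF assms(1), of z] by (simp add: mult_left_mono)
  finally show ?thesis .
qed

text \<open>The choice s = \<epsilon> / (8 q) minimises the exponent n q s^2 - s n \<epsilon> /
  4.\<close>

lemma dev_prob:
  assumes "A \<in> sets borel" "measure lborel (usq \<inter> A) \<le> q" "0 < q" "\<epsilon> / (8 * q) \<le> 1"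
  shows "measure PM (dev z A) \<le> 2 * exp (- (real n * \<epsilon>\<^sup>2 / (64 * q)))"
proof -
  have "measure PM (dev z A) \<le> 2 * exp (real n * q * (\<epsilon> / (8 * q))\<^sup>2 - \<epsilon> / (8 * q) * (real n * \<epsilon> / 4))"
    unfolding dev_def using assms eps prob_T[OF assms(1), of z] T_sets[OF assms(1)]
    by (intro chernoff) auto
  also have "real n * q * (\<epsilon> / (8 * q))\<^sup>2 - \<epsilon> / (8 * q) * (real n * \<epsilon> / 4) = - (real n * \<epsilon>\<^sup>2 / (64 * q))"
    using assms(3) by (simp add: power2_eq_square field_simps)
  finally show ?thesis .
qed

lemma p_pos: "p > 0"
proof -
  have "9/2 / real M > 0" using M by simp
  then show ?thesis using M(2) by linarith
qed

lemma rad_bounds: 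
  assumes "i < M" "j \<le> n"
  shows "0 \<le> rad i j" "rad i j \<le> 3/2" "rad i 0 \<le> rad i j" "rad i j - rad i 0 \<le> 3/2 / real M"
proof -
  have j: "real j / real n \<le> 1" "real j / real n \<ge> 0" using assms n_pos by auto
  have "real i + real j / real n \<le> real M" using j assms by linarith
  then show "rad i j \<le> 3/2" using M by (simp add: rad_def divide_le_eq)
  show "0 \<le> rad i j" by (simp add: rad_def)
  have e: "rad i j - rad i 0 = 3/2 * (real j / real n) / real M"
    by (simp add: rad_def add_divide_distrib diff_divide_distrib algebra_simps)
  show "rad i j - rad i 0 \<le> 3/2 / real M" unfolding e using j M by (intro divide_right_mono) auto
  have "0 \<le> 3/2 * (real j / real n) / real M" by simp
  then show "rad i 0 \<le> rad i j" using e by linarith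
qed

lemma ring_measure:
  assumes "i < M" "j \<le> n" shows "measure lborel (usq \<inter> ring i j) \<le> p"
proof -
  note r = rad_bounds[OF assms] rad_bounds[OF assms(1), of 0]
  have "usq \<inter> ring i j = usq \<inter> cball 0 (rad i j) - cball 0 (rad i 0)" by (auto simp: ring_def)
  then have "measure lborel (usq \<inter> ring i j) = disc_area (rad i j) - disc_area (rad i 0)"
    unfolding disc_area_commute using r by (simp only:) (rule annulus, auto)
  also have "\<dots> \<le> kappa * ((rad i j)\<^sup>2 - (rad i 0)\<^sup>2)" using r by (intro disc_area_upper) auto
  also have "\<dots> \<le> 1 * ((rad i j)\<^sup>2 - (rad i 0)\<^sup>2)" using kappa_bounds r by (intro mult_right_mono) (auto intro: power_mono)
  also have "\<dots> = (rad i j - rad i 0) * (rad i j + rad i 0)" by (simp add: power2_eq_square algebra_simps)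
  \<comment> \<open>Width of the ring times the sum of its two radii.\<close>
  also have "\<dots> \<le> (3/2 / real M) * 3" using r by (intro mult_mono) auto
  also have "\<dots> \<le> p" using M by simp
  finally show ?thesis .
qed

lemma strip_bounds: "j \<le> J \<Longrightarrow> strip (Suc j) \<le> 5/4" "9/10 \<le> strip j" "strip (Suc j) = strip j + \<epsilon> / 2"
proof -
  assume j: "j \<le> J"
  have "real J \<le> 12/25 / \<epsilon> + 1" unfolding J_def using eps by (simp add: of_nat_ceiling)
  then have "real j * (\<epsilon> / 2) \<le> (12/25 / \<epsilon> + 1) * (\<epsilon> / 2)" using j eps by (intro mult_right_mono) auto
  also have "\<dots> = 6/25 + \<epsilon> / 2" using eps by (simp add: field_simps)
  finally have "real j * (\<epsilon> / 2) \<le> 6/25 + \<epsilon> / 2" .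
  moreover have "strip (Suc j) = 9/10 + real j * (\<epsilon> / 2) + \<epsilon> / 2" by (simp add: strip_def algebra_simps)
  ultimately show "strip (Suc j) \<le> 5/4" using eps by linarith
next
  show "9/10 \<le> strip j" "strip (Suc j) = strip j + \<epsilon> / 2" using eps by (simp_all add: strip_def algebra_simps)
qed

lemma wedge_part_measure:
  assumes "j \<le> J" shows "9/1000 * \<epsilon> \<le> measure lborel (usq \<inter> wedge_part j)"
proof -
  note s = strip_bounds(1)[OF assms] strip_bounds(2,3)[of j]
  have "usq \<inter> wedge_part j = wedge \<inter> cball 0 (strip (Suc j)) - cball 0 (strip j)"
    using wedge_usq s by (auto simp: wedge_part_def)
  then have "measure lborel (usq \<inter> wedge_part j) = wedge_area * ((strip (Suc j))\<^sup>2 - (strip j)\<^sup>2)"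
    using s eps by (simp add: annulus measure_wedge right_diff_distrib)
  moreover have "(strip (Suc j))\<^sup>2 - (strip j)\<^sup>2 = \<epsilon> * strip j + (\<epsilon> / 2)\<^sup>2"
    unfolding s(3) by (simp add: power2_eq_square algebra_simps)
  moreover have "\<epsilon> * (9/10) \<le> \<epsilon> * strip j" using s eps by (intro mult_left_mono) auto
  moreover have "(\<epsilon> / 2)\<^sup>2 \<ge> 0" by simp
  ultimately have m: "measure lborel (usq \<inter> wedge_part j) = wedge_area * (\<epsilon> * strip j + (\<epsilon> / 2)\<^sup>2)"
    and le: "\<epsilon> * (9/10) \<le> \<epsilon> * strip j + (\<epsilon> / 2)\<^sup>2" by (simp, linarith)
  have "1/100 * (\<epsilon> * (9/10)) \<le> wedge_area * (\<epsilon> * strip j + (\<epsilon> / 2)\<^sup>2)"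
    using wedge_area_ge le eps by (intro mult_mono) auto
  then show ?thesis unfolding m by simp
qed

text \<open>The second term has slowly decaying summands but only \<open>M\<close> of them; the
  third has order n many, compensated by 1 / p in the exponent.\<close>

definition failure :: real where
  "failure = exp (- (real n * (49/100 * \<epsilon>\<^sup>2))) + real M * (2 * exp (- (real n * \<epsilon>\<^sup>2 / 64))) +
     real (M * Suc n) * (2 * exp (- (real n * \<epsilon>\<^sup>2 / (64 * p)))) + real (Suc J) * exp (- (real n * (9/1000 * \<epsilon>)))"

lemma bad_prob: "measure PM (bad z) \<le> failure"
proof -
  have s1: "miss z (cball 0 \<epsilon>) \<in> sets PM" by (intro miss_sets) simp
  have s2: "(\<Union>i\<in>{..<M}. dev z (cball 0 (rad i 0))) \<in> sets PM" by (intro sets.finite_UN dev_sets) simp_all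
  have s3: "(\<Union>x\<in>{..<M} \<times> {..n}. dev z (ring (fst x) (snd x))) \<in> sets PM"
    by (intro sets.finite_UN dev_sets borel_parts) simp_all
  have s4: "(\<Union>j\<in>{..J}. miss z (wedge_part j)) \<in> sets PM" by (intro sets.finite_UN miss_sets borel_parts) simp_all
  have m1: "measure PM (miss z (cball 0 \<epsilon>)) \<le> exp (- (real n * (49/100 * \<epsilon>\<^sup>2)))"
  proof (rule miss_prob)
    show "49/100 * \<epsilon>\<^sup>2 \<le> measure lborel (usq \<inter> cball 0 \<epsilon>)"
      using kappa_bounds eps by (simp add: disc_area_le1 mult_right_mono flip: disc_area_commute)
  qed simp
  have "measure PM (\<Union>i\<in>{..<M}. dev z (cball 0 (rad i 0))) \<le> (\<Sum>i\<in>{..<M}. measure PM (dev z (cball 0 (rad i 0))))"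
    by (intro measure_UNION_le dev_sets) simp_all
  also have "\<dots> \<le> (\<Sum>i\<in>{..<M}. 2 * exp (- (real n * \<epsilon>\<^sup>2 / 64)))"
  proof (intro sum_mono)
    fix i
    have "disc_area (rad i 0) \<le> disc_area (max (rad i 0) 2)" by (rule disc_area_mono) simp
    then have "measure lborel (usq \<inter> cball 0 (rad i 0)) \<le> 1" by (simp add: disc_area_big flip: disc_area_commute)
    then show "measure PM (dev z (cball 0 (rad i 0))) \<le> 2 * exp (- (real n * \<epsilon>\<^sup>2 / 64))"
      using dev_prob[of "cball 0 (rad i 0)" 1 z] eps by simp
  qed
  finally have m2: "measure PM (\<Union>i\<in>{..<M}. dev z (cball 0 (rad i 0))) \<le> real M * (2 * exp (- (real n * \<epsilon>\<^sup>2 / 64)))" by simp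
  have "measure PM (\<Union>x\<in>{..<M} \<times> {..n}. dev z (ring (fst x) (snd x))) \<le> (\<Sum>x\<in>{..<M} \<times> {..n}. measure PM (dev z (ring (fst x) (snd x))))"
    by (intro measure_UNION_le dev_sets borel_parts) simp_all
  also have "\<dots> \<le> (\<Sum>x\<in>{..<M} \<times> {..n}. 2 * exp (- (real n * \<epsilon>\<^sup>2 / (64 * p))))"
    by (intro sum_mono dev_prob borel_parts ring_measure p_pos p) auto
  finally have m3: "measure PM (\<Union>x\<in>{..<M} \<times> {..n}. dev z (ring (fst x) (snd x))) \<le> real (M * Suc n) * (2 * exp (- (real n * \<epsilon>\<^sup>2 / (64 * p))))"
    by (simp add: card_cartesian_product)
  have "measure PM (\<Union>j\<in>{..J}. miss z (wedge_part j)) \<le> (\<Sum>j\<in>{..J}. measure PM (miss z (wedge_part j)))"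
    by (intro measure_UNION_le miss_sets borel_parts) simp_all
  also have "\<dots> \<le> (\<Sum>j\<in>{..J}. exp (- (real n * (9/1000 * \<epsilon>))))"
    by (intro sum_mono miss_prob borel_parts wedge_part_measure) simp_all
  finally have m4: "measure PM (\<Union>j\<in>{..J}. miss z (wedge_part j)) \<le> real (Suc J) * exp (- (real n * (9/1000 * \<epsilon>)))" by simp
  note le = measure_Un_le[OF sets.Un[OF sets.Un[OF s1 s2] s3] s4] measure_Un_le[OF sets.Un[OF s1 s2] s3] measure_Un_le[OF s1 s2]
  show ?thesis unfolding bad_def failure_def using le m1 m2 m3 m4 by linarith
qed

lemma outside_prob: "outside \<in> sets PM" "measure PM outside = 0"
proof -
  have s: "Pi\<^sub>E {1..n} (\<lambda>_. sq n) \<in> sets PM"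
    using sq_area(2)[OF n] by (intro sets_PiM_I_finite) (auto simp: sets_point_dist)
  then show "outside \<in> sets PM" unfolding outside_def by (rule sets.compl_sets)
  interpret F: finite_product_prob_space "\<lambda>_. point_dist n" "{1..n}" by unfold_locales simp
  have "sq n = T (0, 0) usq" unfolding T_def vimage_def to_unit_sq[OF n] by simp
  then have "prob (sq n) = 1" using prob_T[of usq "(0, 0)"] usq_area by simp
  then have "measure PM (Pi\<^sub>E {1..n} (\<lambda>_. sq n)) = 1"
    using sq_area(2)[OF n] by (subst F.finite_measure_PiM_emb) (auto simp: sets_point_dist)
  then show "measure PM outside = 0" unfolding outside_def P.prob_compl[OF s] by simp
qed

section \<open>From the grid of radii to all radii\<close>

lemma rad_cover:
  assumes "0 \<le> r" "r < 3/2"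
  shows "\<exists>i<M. \<exists>j<n. rad i j \<le> r \<and> r < rad i (Suc j)"
proof -
  define t where "t = r * real M * 2/3"
  have t: "0 \<le> t" "t < real M" using assms M by (auto simp: t_def field_simps)
  define i where "i = nat \<lfloor>t\<rfloor>"
  have i: "real i \<le> t" "t < real i + 1" using t by (auto simp: i_def)
  define s where "s = (t - real i) * real n"
  have s: "0 \<le> s" "s < real n" using i n_pos by (auto simp: s_def)
  define j where "j = nat \<lfloor>s\<rfloor>"
  have j: "real j \<le> s" "s < real j + 1" using s by (auto simp: j_def)
  have "real i < real M" "real j < real n" using i t j s by linarith+
  then have "i < M" "j < n" by simp_all
  moreover have "real j / real n \<le> t - real i" "t - real i < (real j + 1) / real n"
    using j n_pos by (auto simp: s_def divide_le_eq less_divide_eq)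
  then have "rad i j \<le> r" "r < rad i (Suc j)"
    using M by (auto simp: rad_def t_def field_simps)
  ultimately show ?thesis by blast
qed

text \<open>Stated through a measurable exceptional set, which avoids the measurability of
  \<open>nice\<close> itself. The factor 4 counts the corners.\<close>

theorem nice_whp:
  shows "\<exists>B\<in>sets (pts n). measure (pts n) B \<le> 4 * failure \<and>
    (\<forall>X\<in>space (pts n) - B. nice n \<epsilon> (to_unit n \<circ> X))"
proof (intro bexI conjI ballI)
  let ?B = "outside \<union> (\<Union>z\<in>corners. bad z)"
  show "?B \<in> sets (pts n)" unfolding pts_eq
    by (intro sets.Un sets.finite_UN outside_prob bad_sets corners_finite)
  have "measure PM ?B \<le> measure PM outside + measure PM (\<Union>z\<in>corners. bad z)"
    by (intro measure_Un_le sets.finite_UN outside_prob bad_sets corners_finite)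
  also have "measure PM (\<Union>z\<in>corners. bad z) \<le> (\<Sum>z\<in>corners. measure PM (bad z))"
    by (intro measure_UNION_le bad_sets corners_finite)
  also have "\<dots> \<le> (\<Sum>z\<in>corners. failure)" by (intro sum_mono bad_prob)
  finally show "measure (pts n) ?B \<le> 4 * failure" using outside_prob corners_finite by (simp add: pts_eq)
  fix X assume X: "X \<in> space (pts n) - ?B"
  then have sp: "X \<in> space PM" and ins: "\<And>v. v \<in> {1..n} \<Longrightarrow> X v \<in> sq n" and nb: "\<And>z. z \<in> corners \<Longrightarrow> X \<notin> bad z"
    by (auto simp: pts_eq outside_def PiE_iff space_PiM)
  define Y where "Y = to_unit n \<circ> X"
  have U: "flip z (Y v) \<in> usq" if "v \<in> {1..n}" for v z
    using ins[OF that] to_unit_sq[OF n, of z "X v"] by (simp add: Y_def)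
  have hit: "\<exists>v\<in>{1..n}. flip z (Y v) \<in> A" if "X \<notin> miss z A" for z A
  proof -
    have "\<not> (X \<in> space PM \<and> hits (T z A) X = 0)" using that unfolding miss_def mem_Collect_eq .
    with sp have "hits (T z A) X \<noteq> 0" by simp
    then have ne: "card {v\<in>{1..n}. flip z (Y v) \<in> A} \<noteq> 0" by (simp add: hits_T Y_def)
    show ?thesis
    proof (rule ccontr)
      assume "\<not> ?thesis"
      then have "{v\<in>{1..n}. flip z (Y v) \<in> A} = {}" by blast
      then show False using ne by (simp only: card.empty)
    qed
  qed
  have dv: "\<bar>real (hits (T z A) X) - real n * prob (T z A)\<bar> \<le> real n * \<epsilon> / 4" if "X \<notin> dev z A" for z A
    using that sp unfolding dev_def by (simp only: mem_Collect_eq not_less simp_thms)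
  show "nice n \<epsilon> (to_unit n \<circ> X)"
    unfolding nice_def Y_def[symmetric]
  proof (intro conjI ballI allI impI)
    fix v assume "v \<in> {1..n}"
    then show "Y v \<in> usq" using U[of v "(0, 0)"] by (simp add: flip_def)
  next
    fix z assume z: "z \<in> corners"
    note nbz = nb[OF z, unfolded bad_def]
    have "X \<notin> miss z (cball 0 \<epsilon>)" using nbz by blast
    from hit[OF this] show "\<exists>v\<in>{1..n}. norm (flip z (Y v)) \<le> \<epsilon>" by simp
    define N where "N r = real (card {v\<in>{1..n}. norm (flip z (Y v)) \<le> r})" for r
    have N: "N r = real (hits (T z (cball 0 r)) X)" for r by (simp add: N_def hits_T Y_def)
    have N_mono: "N r \<le> N s" if "r \<le> s" for r s
      unfolding N_def of_nat_le_iff using that by (intro card_mono) auto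
    \<comment> \<open>A disc of fine radius is a coarse disc plus a ring, so the two deviations add
      up.\<close>
    have grid: "\<bar>N (rad i j) - real n * disc_area (rad i j)\<bar> \<le> real n * \<epsilon> / 2" if "i < M" "j \<le> n" for i j
    proof -
      have sub: "cball (0 :: real \<times> real) (rad i 0) \<subseteq> cball 0 (rad i j)" using rad_bounds[OF that] by auto
      have 1: "\<bar>real (hits (T z (cball 0 (rad i 0))) X) - real n * prob (T z (cball 0 (rad i 0)))\<bar> \<le> real n * \<epsilon> / 4"
        by (rule dv) (use nbz that in blast)
      have 2: "\<bar>real (hits (T z (ring i j)) X) - real n * prob (T z (ring i j))\<bar> \<le> real n * \<epsilon> / 4"
      proof (rule dv, rule notI)
        assume "X \<in> dev z (ring i j)"
        then have "X \<in> (\<Union>x\<in>{..<M} \<times> {..n}. dev z (ring (fst x) (snd x)))"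
          using that by (intro UN_I[of "(i, j)"]) simp_all
        then show False using nbz by (simp only: Un_iff simp_thms)
      qed
      have h: "real (hits (T z (cball 0 (rad i j))) X) = real (hits (T z (cball 0 (rad i 0))) X) + real (hits (T z (ring i j)) X)"
        using hits_Diff[OF sub, of z X] by (simp add: ring_def)
      have "T z (ring i j) = T z (cball 0 (rad i j)) - T z (cball 0 (rad i 0))" "T z (cball 0 (rad i 0)) \<subseteq> T z (cball 0 (rad i j))"
        using sub by (auto simp: ring_def T_def)
      then have "prob (T z (ring i j)) = prob (T z (cball 0 (rad i j))) - prob (T z (cball 0 (rad i 0)))"
        by (simp add: finite_measure_Diff T_sets)
      then have q: "real n * prob (T z (cball 0 (rad i j))) = real n * prob (T z (cball 0 (rad i 0))) + real n * prob (T z (ring i j))"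
        by (simp only: right_diff_distrib)
      show ?thesis unfolding N prob_T_cball[of z, symmetric] h q using 1 2 by linarith
    qed
    fix r :: real
    { assume r: "0 \<le> r"
      show "\<bar>real (card {v\<in>{1..n}. norm (flip z (Y v)) \<le> r}) / real n - disc_area r\<bar> \<le> \<epsilon>"
      proof (cases "r < 3/2")
        case True
        then obtain i j where ij: "i < M" "j < n" "rad i j \<le> r" "r < rad i (Suc j)" using rad_cover[OF r] by blast
        have "rad i (Suc j) - rad i j = 3/2 / (real M * real n)"
          by (simp add: rad_def add_divide_distrib diff_divide_distrib algebra_simps)
        also have "\<dots> \<le> 3/2 / (1 * real n)" using M n_pos by (intro divide_left_mono mult_right_mono) auto
        finally have gap: "rad i (Suc j) \<le> rad i j + 3/2 / real n" by simp
        \<comment> \<open>Neighbouring fine radii differ by at most 3 / (2 n), so their areas differ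
          by at most (16/5) (3/2) (\<epsilon> / 10), less than \<epsilon> / 2.\<close>
        have n10: "1 / real n \<le> \<epsilon> / 10" using neps n_pos by (simp add: field_simps)
        have n10': "3/2 / real n \<le> 3/2 * (\<epsilon> / 10)" using mult_left_mono[OF n10, of "3/2"] by simp
        then have n15: "3/2 / real n \<le> 1/10" using eps by linarith
        have "disc_area (rad i (Suc j)) \<le> disc_area (rad i j + 3/2 / real n)" by (intro disc_area_mono gap)
        also have "\<dots> \<le> disc_area (rad i j) + 16/5 * (3/2 / real n)"
          using rad_bounds[OF ij(1), of j] ij by (intro disc_area_lipschitz n15) auto
        also have "\<dots> \<le> disc_area (rad i j) + \<epsilon> / 2" using n10' eps by linarith
        finally have F: "disc_area (rad i (Suc j)) \<le> disc_area (rad i j) + \<epsilon> / 2" .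
        have F': "real n * disc_area (rad i (Suc j)) \<le> real n * disc_area (rad i j) + real n * \<epsilon> / 2"
          using mult_left_mono[OF F, of "real n"] by (simp add: algebra_simps)
        have lo: "real n * disc_area (rad i j) \<le> real n * disc_area r" and up: "real n * disc_area r \<le> real n * disc_area (rad i (Suc j))"
          using ij by (auto intro!: mult_left_mono disc_area_mono)
        have "\<bar>N r - real n * disc_area r\<bar> \<le> real n * \<epsilon>"
          using grid[OF ij(1) less_imp_le[OF ij(2)]] grid[OF ij(1) Suc_leI[OF ij(2)]]
            N_mono[OF ij(3)] N_mono[OF less_imp_le[OF ij(4)]] F' lo up by linarith
        then have "\<bar>N r - real n * disc_area r\<bar> / real n \<le> \<epsilon>" using n_pos by (simp add: divide_le_eq mult.commute)
        moreover have "N r / real n - disc_area r = (N r - real n * disc_area r) / real n" using n_pos by (simp add: field_simps)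
        ultimately show ?thesis unfolding N_def[symmetric] by (simp add: abs_divide)
      next
        case False
        have "norm (flip z (Y v)) \<le> r" if "v \<in> {1..n}" for v
          using norm_usq[OF U[OF that, of z]] False by linarith
        then have "{v\<in>{1..n}. norm (flip z (Y v)) \<le> r} = {1..n}" by blast
        then show ?thesis using False n_pos eps by (simp add: disc_area_big)
      qed }
    { assume r: "r \<in> {9/10..57/50}"
      \<comment> \<open>The first strip boundary not below r is less than r + \<epsilon> / 2, so the
        strip after it lies within \<epsilon> of r.\<close>
      define j where "j = nat \<lceil>(r - 9/10) / (\<epsilon> / 2)\<rceil>"
      have nn: "0 \<le> (r - 9/10) / (\<epsilon> / 2)" using r eps by simp
      then have j: "(r - 9/10) / (\<epsilon> / 2) \<le> real j" "real j < (r - 9/10) / (\<epsilon> / 2) + 1"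
        unfolding j_def by (simp_all add: of_nat_ceiling) linarith+
      have "r \<le> strip j" "strip j < r + \<epsilon> / 2"
        using j eps by (simp_all add: strip_def field_simps)
      moreover have "j \<le> J"
      proof -
        have "(r - 9/10) / (\<epsilon> / 2) \<le> (6/25) / (\<epsilon> / 2)" using r eps by (intro divide_right_mono) auto
        also have "\<dots> = 12/25 / \<epsilon>" by simp
        finally show ?thesis unfolding j_def J_def by (intro nat_mono ceiling_mono)
      qed
      then have "X \<notin> miss z (wedge_part j)" using nbz by blast
      from hit[OF this] obtain v where "v \<in> {1..n}" "flip z (Y v) \<in> wedge" "strip j < norm (flip z (Y v))" "norm (flip z (Y v)) \<le> strip (Suc j)"
        by (auto simp: wedge_part_def)
      ultimately show "\<exists>v\<in>{1..n}. flip z (Y v) \<in> wedge \<and> norm (flip z (Y v)) \<in> {r..r + \<epsilon>}"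
        using strip_bounds(3)[of j] by (intro bexI[of _ v]) auto }
  qed
qed

end

section \<open>Measurability and rescaling\<close>

lemma measurable_insort_key:
  fixes f :: "'a \<Rightarrow> nat \<Rightarrow> real"
  assumes "\<And>w. (\<lambda>X. f X w) \<in> borel_measurable M"
  shows "(\<lambda>X. insort_key (f X) x ys) \<in> measurable M (count_space UNIV)"
proof (induction ys)
  case (Cons y ys)
  note assms[measurable] Cons.IH[measurable]
  have "(\<lambda>X. y # insort_key (f X) x ys) \<in> measurable M (count_space UNIV)"
    by (rule measurable_compose_countable[where g = "\<lambda>X. insort_key (f X) x ys"]) measurable
  then show ?case by simp
qed simp

lemma measurable_sort_key:
  fixes f :: "'a \<Rightarrow> nat \<Rightarrow> real"
  assumes "\<And>w. (\<lambda>X. f X w) \<in> borel_measurable M"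
  shows "(\<lambda>X. sort_key (f X) xs) \<in> measurable M (count_space UNIV)"
proof (induction xs)
  case (Cons x xs)
  show ?case unfolding sort_key_simps
    by (rule measurable_compose_countable[where g = "\<lambda>X. sort_key (f X) xs"])
      (intro measurable_insort_key assms Cons.IH)+
qed simp

lemma measurable_map_list:
  fixes g :: "'a \<Rightarrow> 'b \<Rightarrow> nat list"
  assumes "\<And>u. (\<lambda>X. g X u) \<in> measurable M (count_space UNIV)"
  shows "(\<lambda>X. map (g X) us) \<in> measurable M (count_space UNIV)"
proof (induction us)
  case (Cons u us)
  have "(\<lambda>X. a # map (g X) us) \<in> measurable M (count_space UNIV)" for a
    by (rule measurable_compose_countable[where g = "\<lambda>X. map (g X) us"]) (use Cons.IH in simp_all)
  then have "(\<lambda>X. g X u # map (g X) us) \<in> measurable M (count_space UNIV)"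
    by (rule measurable_compose_countable[where g = "\<lambda>X. g X u"]) (use assms in simp_all)
  then show ?case by simp
qed simp

lemma measurable_coordinate [measurable]: "(\<lambda>X. X w) \<in> measurable (pts n) (borel :: (real \<times> real) measure)"
proof (cases "w \<in> {1..n}")
  case True
  then have "(\<lambda>X. X w) \<in> measurable (pts n) (point_dist n)"
    unfolding pts_eq by (rule measurable_component_singleton)
  then show ?thesis by (simp add: measurable_cong_sets[OF refl sets_point_dist])
next
  case False
  have "(\<lambda>_. undefined) \<in> measurable (pts n) (borel :: (real \<times> real) measure)" by simp
  then show ?thesis
    by (subst measurable_cong[of _ _ "\<lambda>_. undefined"]) (use False in \<open>auto simp: pts_eq space_PiM PiE_iff extensional_def\<close>)
qed

lemma square_syms_measurable: "\<sigma> \<in> square_syms \<Longrightarrow> \<sigma> \<in> borel_measurable borel"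
proof -
  assume "\<sigma> \<in> square_syms"
  then have "continuous_on UNIV \<sigma>"
    unfolding square_syms_def by (auto simp: split_beta' intro!: continuous_intros)
  then show ?thesis by (rule borel_measurable_continuous_onI)
qed

lemma finite_square_syms: "finite square_syms" "square_syms \<noteq> {}"
  by (simp_all add: square_syms_def)

lemma dstar_less_iff:
  assumes "finite V" "V \<noteq> {}"
  shows "dstar V \<Phi> \<Psi> < c \<longleftrightarrow> (\<exists>\<sigma>\<in>square_syms. \<forall>v\<in>V. dist (\<sigma> (\<Phi> v)) (\<Psi> v) < c)"
  unfolding dstar_def using assms finite_square_syms by (subst Min_less_iff) (auto simp: Max_less_iff)

text \<open>For fixed lists the machine output is a constant, and the lists take countably many
  values; so the event is assembled from countably many measurable pieces.\<close>

lemma success_measurable: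
  assumes "n \<ge> 1"
  shows "{X\<in>space (pts n). dstar {1..n} X (ram_output P (tau n X) n t) < c} \<in> sets (pts n)"
proof -
  \<comment> \<open>The type \<open>nat list list\<close> is countable, unlike the function type of
    the list family.\<close>
  define dec :: "nat list list \<Rightarrow> nat \<Rightarrow> nat list" where "dec ls u = (if u \<in> {1..n} then ls ! (u - 1) else [])" for ls u
  define L where "L X = map (tau n X) [1..<n + 1]" for X
  have dec: "tau n X = dec (L X)" for X
    by (auto simp: fun_eq_iff dec_def L_def tau_def simp del: upt_Suc)
  have "(\<lambda>X. tau n X u) \<in> measurable (pts n) (count_space UNIV)" for u
  proof (cases "u \<in> {1..n}")
    case True
    have "(\<lambda>X. sort_key (\<lambda>w. dist (X w) (X u)) [1..<n + 1]) \<in> measurable (pts n) (count_space UNIV)"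
      by (rule measurable_sort_key) measurable
    then show ?thesis using True by (simp add: tau_def del: upt_Suc)
  qed (auto simp: tau_def)
  then have L: "L \<in> measurable (pts n) (count_space UNIV)"
    unfolding L_def by (rule measurable_map_list)
  define Q where "Q ls X \<longleftrightarrow> (\<exists>\<sigma>\<in>square_syms. \<forall>v\<in>{1..n}. dist (\<sigma> (X v)) (ram_output P (dec ls) n t v) < c)" for ls X
  have "Measurable.pred (pts n) (Q ls)" for ls
    unfolding Q_def
  proof (intro pred_intros_finite)
    fix \<sigma> v assume "\<sigma> \<in> square_syms"
    note square_syms_measurable[OF this, measurable]
    show "Measurable.pred (pts n) (\<lambda>X. dist (\<sigma> (X v)) (ram_output P (dec ls) n t v) < c)" by measurable
  qed (use finite_square_syms in auto)
  then have "(\<lambda>X. Q (L X) X) \<in> measurable (pts n) (count_space UNIV)"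
    by (rule measurable_compose_countable[OF _ L])
  then have "{X\<in>space (pts n). Q (L X) X} \<in> sets (pts n)" by measurable
  moreover have "Q (L X) X \<longleftrightarrow> dstar {1..n} X (ram_output P (tau n X) n t) < c" for X
    unfolding Q_def dec[symmetric] using assms by (subst dstar_less_iff) auto
  ultimately show ?thesis by simp
qed

section \<open>Invariance under rescaling\<close>

lemma sort_key_scale: "c > 0 \<Longrightarrow> sort_key (\<lambda>w. c * f w) xs = sort_key f xs" for c :: real
proof (induction xs)
  case (Cons x xs)
  have "insort_key (\<lambda>w. c * f w) x ys = insort_key f x ys" for ys
    using Cons.prems by (induction ys) auto
  then show ?case using Cons by simp
qed simp

lemma dist_to_unit: "n \<ge> 1 \<Longrightarrow> dist (to_unit n p) (to_unit n q) = (1 / sqrt (real n)) * dist p q"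
  by (simp add: to_unit_def dist_norm flip: scaleR_diff_right)

lemma tau_to_unit: "n \<ge> 1 \<Longrightarrow> tau n (to_unit n \<circ> X) = tau n X"
  by (simp add: tau_def fun_eq_iff dist_to_unit sort_key_scale del: upt_Suc times_divide_eq_left)

text \<open>Reflections of the unit square become sign changes about the centre of the original
  square.\<close>

lemma unit_symmetry:
  assumes "z \<in> corners" "s \<in> {id, prod.swap}"
  shows "\<exists>\<sigma>\<in>square_syms. \<forall>p. s (flip z (to_unit n p)) = to_unit n (\<sigma> p)"
proof -
  have *: "(\<lambda>p. (if fst z = 0 then fst p else - fst p, if snd z = 0 then snd p else - snd p)) \<in> square_syms"
    "(\<lambda>p. (if snd z = 0 then snd p else - snd p, if fst z = 0 then fst p else - fst p)) \<in> square_syms"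
    by (cases "fst z = 0"; cases "snd z = 0"; simp add: square_syms_def split_beta')+
  show ?thesis
  proof (cases "s = id")
    case True
    then show ?thesis by (intro bexI[OF _ *(1)]) (auto simp: flip_def to_unit_def)
  next
    case False
    then have "s = prod.swap" using assms by auto
    then show ?thesis by (intro bexI[OF _ *(2)]) (auto simp: flip_def to_unit_def)
  qed
qed

definition \<epsilon>\<^sub>0 :: "nat \<Rightarrow> real" where
  "\<epsilon>\<^sub>0 n = sqrt (ln (real n)) / (1000000 * sqrt (real n))"

text \<open>Rescaling turns the error 10^6 \<open>\<epsilon>\<^sub>0\<close> into exactly sqrt (ln
  n), which is strictly below the claimed bound as ln n > 0.\<close>

lemma nice_success:
  assumes n: "n \<ge> 2" and nice: "nice n (\<epsilon>\<^sub>0 n) (to_unit n \<circ> X)" and small: "\<epsilon>\<^sub>0 n \<le> 1 / 10 ^ 7"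
    and alg: "alg n (tau n X) out"
  shows "dstar {1..n} X out < 1.197 * sqrt (ln (real n))"
proof -
  have n1: "n \<ge> 1" using n by simp
  have ln: "sqrt (ln (real n)) > 0" using n by simp
  have s: "sqrt (real n) > 0" using n by simp
  have "\<epsilon>\<^sub>0 n > 0" unfolding \<epsilon>\<^sub>0_def using ln s by simp
  moreover have "alg n (tau n (to_unit n \<circ> X)) out" using alg by (simp only: tau_to_unit[OF n1])
  ultimately obtain z s' where z: "z \<in> corners" "s' \<in> {id, prod.swap}"
    and d: "\<And>v. v \<in> {1..n} \<Longrightarrow> dist (s' (flip z (to_unit n (X v)))) (to_unit n (out v)) \<le> 1000000 * \<epsilon>\<^sub>0 n"
    using alg_bound[OF nice _ small] unfolding to_unit_def[symmetric] comp_apply by blast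
  obtain \<sigma> where \<sigma>: "\<sigma> \<in> square_syms" "\<And>p. s' (flip z (to_unit n p)) = to_unit n (\<sigma> p)"
    using unit_symmetry[OF z] by blast
  have "dist (\<sigma> (X v)) (out v) < 1.197 * sqrt (ln (real n))" if "v \<in> {1..n}" for v
  proof -
    have "1 / sqrt (real n) * dist (\<sigma> (X v)) (out v) \<le> 1000000 * \<epsilon>\<^sub>0 n"
      using d[OF that] unfolding \<sigma>(2) dist_to_unit[OF n1] .
    then have "dist (\<sigma> (X v)) (out v) \<le> 1 * sqrt (ln (real n))"
      using s by (simp add: \<epsilon>\<^sub>0_def field_simps)
    also have "1 * sqrt (ln (real n)) < 1.197 * sqrt (ln (real n))" by (rule mult_strict_right_mono[OF _ ln]) simp
    finally show ?thesis by simp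
  qed
  then show ?thesis using \<sigma>(1) n by (subst dstar_less_iff) (simp, simp, blast)
qed

section \<open>The limit\<close>

text \<open>The factor \<open>10\<^sup>-\<^sup>6\<close> in \<open>\<epsilon>\<^sub>0\<close> compensates the constant of the deterministic bound. The value of \<open>p\<^sub>0\<close> makes
  each of the fine deviations have probability of order \<open>n\<^sup>-\<^sup>2\<close>, and \<open>M\<^sub>0\<close> is the corresponding number of coarse radii.\<close>
definition M\<^sub>0 :: nat where "M\<^sub>0 = 576 * 10 ^ 12"

definition p\<^sub>0 :: real where "p\<^sub>0 = 1 / (128 * 10 ^ 12)"

lemma eps0_eventually:
  "eventually (\<lambda>n. \<epsilon>\<^sub>0 n \<le> 1 / 10 ^ 7 \<and> real n * \<epsilon>\<^sub>0 n \<ge> 10 \<and> \<epsilon>\<^sub>0 n \<le> 8 * p\<^sub>0) sequentially"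
proof (intro eventually_conj)
  have lim: "\<epsilon>\<^sub>0 \<longlonglongrightarrow> 0" unfolding \<epsilon>\<^sub>0_def by real_asymp
  show "eventually (\<lambda>n. \<epsilon>\<^sub>0 n \<le> 1 / 10 ^ 7) sequentially"
    by (rule eventually_mono[OF order_tendstoD(2)[OF lim, of "1 / 10 ^ 7"]]) auto
  show "eventually (\<lambda>n. \<epsilon>\<^sub>0 n \<le> 8 * p\<^sub>0) sequentially"
    by (rule eventually_mono[OF order_tendstoD(2)[OF lim, of "8 * p\<^sub>0"]]) (auto simp: p\<^sub>0_def)
  have "filterlim (\<lambda>n. real n * \<epsilon>\<^sub>0 n) at_top sequentially" unfolding \<epsilon>\<^sub>0_def by real_asymp
  then show "eventually (\<lambda>n. real n * \<epsilon>\<^sub>0 n \<ge> 10) sequentially"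
    by (simp add: filterlim_at_top)
qed

text \<open>The first two terms are tiny negative powers of n, the third is of order 1 / n, and the
  last decays like the exponential of a multiple of -sqrt (n ln n), up to a linear factor.\<close>

definition failure_bound :: "nat \<Rightarrow> real" where
  "failure_bound n = exp (- (49/100 * ln (real n) / 10 ^ 12)) + 2 * real M\<^sub>0 * exp (- (ln (real n) / (64 * 10 ^ 12))) +
     2 * real M\<^sub>0 * (real n + 1) * exp (- (2 * ln (real n))) +
     (real n + 2) * exp (- (9/1000 * (sqrt (real n) * sqrt (ln (real n)) / 1000000)))"

lemma failure_bound_tendsto: "failure_bound \<longlonglongrightarrow> 0"
proof -
  have 1: "(\<lambda>n. exp (- (49/100 * ln (real n) / 10 ^ 12))) \<longlonglongrightarrow> 0" by real_asymp
  have 2: "(\<lambda>n. exp (- (ln (real n) / (64 * 10 ^ 12)))) \<longlonglongrightarrow> 0" by real_asymp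
  have 3: "(\<lambda>n. (real n + 1) * exp (- (2 * ln (real n)))) \<longlonglongrightarrow> 0" by real_asymp
  have 4: "(\<lambda>n. (real n + 2) * exp (- (9/1000 * (sqrt (real n) * sqrt (ln (real n)) / 1000000)))) \<longlonglongrightarrow> 0" by real_asymp
  have "(\<lambda>n. exp (- (49/100 * ln (real n) / 10 ^ 12)) + 2 * real M\<^sub>0 * exp (- (ln (real n) / (64 * 10 ^ 12))) +
     2 * real M\<^sub>0 * ((real n + 1) * exp (- (2 * ln (real n)))) +
     (real n + 2) * exp (- (9/1000 * (sqrt (real n) * sqrt (ln (real n)) / 1000000)))) \<longlonglongrightarrow> 0 + 2 * real M\<^sub>0 * 0 + 2 * real M\<^sub>0 * 0 + 0"
    by (intro tendsto_add tendsto_mult_left 1 2 3 4)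
  then show ?thesis unfolding failure_bound_def by (simp add: mult.assoc)
qed

lemma nice_eventually:
  "eventually (\<lambda>n. \<exists>B\<in>sets (pts n). measure (pts n) B \<le> 4 * failure_bound n \<and>
     (\<forall>X\<in>space (pts n) - B. nice n (\<epsilon>\<^sub>0 n) (to_unit n \<circ> X))) sequentially"
  using eps0_eventually eventually_ge_at_top[of "2 :: nat"]
proof eventually_elim
  case (elim n)
  define e where "e = \<epsilon>\<^sub>0 n"
  have n: "n \<ge> 2" and e: "e \<le> 1 / 10 ^ 7" "real n * e \<ge> 10" "e \<le> 8 * p\<^sub>0" using elim by (auto simp: e_def)
  have ln: "ln (real n) > 0" using n by simp
  have e0: "e > 0" unfolding e_def \<epsilon>\<^sub>0_def using ln n by simp
  \<comment> \<open>Here 9/2 divided by \<open>M\<^sub>0\<close> equals \<open>p\<^sub>0\<close>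
    exactly.\<close>
  interpret unit_points n e p\<^sub>0 M\<^sub>0
    using n e e0 by unfold_locales (auto simp: p\<^sub>0_def M\<^sub>0_def)
  have e2: "real n * e\<^sup>2 = ln (real n) / 10 ^ 12"
    using ln n by (simp add: e_def \<epsilon>\<^sub>0_def power_divide power_mult_distrib)
  have e1: "real n * e = sqrt (real n) * sqrt (ln (real n)) / 1000000"
  proof -
    have "real n = sqrt (real n) * sqrt (real n)" by simp
    then show ?thesis using n unfolding e_def \<epsilon>\<^sub>0_def by (simp add: field_simps)
  qed
  have "real J \<le> 12/25 / e + 1" unfolding J_def using e0 by (simp add: of_nat_ceiling)
  moreover have "12/25 \<le> real n * e" using e(2) by linarith
  then have "12/25 / e \<le> real n" using e0 by (simp only: pos_divide_le_eq)
  ultimately have "real (Suc J) \<le> real n + 2" by simp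
  then have "real (Suc J) * exp (- (real n * (9/1000 * e))) \<le> (real n + 2) * exp (- (9/1000 * (sqrt (real n) * sqrt (ln (real n)) / 1000000)))"
    unfolding e1[symmetric] by (simp add: mult.left_commute)
  moreover have "exp (- (real n * (49/100 * e\<^sup>2))) = exp (- (49/100 * ln (real n) / 10 ^ 12))"
    using e2 by (simp add: mult.left_commute)
  moreover have "real n * e\<^sup>2 / 64 = ln (real n) / (64 * 10 ^ 12)" unfolding e2 by simp
  moreover have "real n * e\<^sup>2 / (64 * p\<^sub>0) = 2 * ln (real n)" unfolding e2 p\<^sub>0_def by simp
  moreover have "real (M\<^sub>0 * Suc n) * (2 * x) = 2 * real M\<^sub>0 * (real n + 1) * x" "real M\<^sub>0 * (2 * x) = 2 * real M\<^sub>0 * x" for x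
    by (simp_all add: algebra_simps)
  ultimately have "failure \<le> failure_bound n"
    unfolding failure_def failure_bound_def by (simp only: add_left_mono)
  with nice_whp show ?case unfolding e_def by (smt (verit))
qed

text \<open>The time bound is deterministic, since \<open>ram_alg\<close> asks only for
  permutations. Probability enters through the exceptional set, and the success event is squeezed
  between its complement and the whole space.\<close>

theorem theorem1p3:
  shows "\<exists>(P::prog) (C::nat).
    (\<forall>n\<ge>1. \<forall>X. (\<forall>v\<in>{1..n}. X v \<in> sq n) \<longrightarrow> halts_within P (tau n X) n (C * n)) \<and>
    ((\<lambda>n. measure (pts n)
        {X \<in> space (pts n).
           dstar {1..n} X (ram_output P (tau n X) n (C * n)) < 1.197 * sqrt (ln (real n))})
      \<longlonglongrightarrow> 1)"
proof -
  obtain P C where PC: "\<And>n \<tau>. n \<ge> 1 \<Longrightarrow> perm_lists n \<tau> \<Longrightarrow>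
      halts_within P \<tau> n (C * n) \<and> alg n \<tau> (ram_output P \<tau> n (C * n))"
    using ram_alg by blast
  define E where "E n = {X \<in> space (pts n).
     dstar {1..n} X (ram_output P (tau n X) n (C * n)) < 1.197 * sqrt (ln (real n))}" for n
  have ps: "prob_space (pts n)" if "n \<ge> 1" for n
    unfolding pts_eq by (rule prob_space_PiM) (rule prob_space_point_dist[OF that])
  have low: "eventually (\<lambda>n. 1 - 4 * failure_bound n \<le> measure (pts n) (E n)) sequentially"
    using nice_eventually eps0_eventually eventually_ge_at_top[of "2 :: nat"]
  proof eventually_elim
    case (elim n)
    then obtain B where B: "B \<in> sets (pts n)" "measure (pts n) B \<le> 4 * failure_bound n"
      "\<And>X. X \<in> space (pts n) - B \<Longrightarrow> nice n (\<epsilon>\<^sub>0 n) (to_unit n \<circ> X)" by blast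
    have n: "n \<ge> 2" "n \<ge> 1" using elim by auto
    interpret prob_space "pts n" by (rule ps[OF n(2)])
    have "space (pts n) - B \<subseteq> E n"
    proof
      fix X assume X: "X \<in> space (pts n) - B"
      have "dstar {1..n} X (ram_output P (tau n X) n (C * n)) < 1.197 * sqrt (ln (real n))"
        using PC[OF n(2) perm_lists_tau] elim by (intro nice_success[OF n(1) B(3)[OF X]]) auto
      then show "X \<in> E n" using X by (simp add: E_def)
    qed
    then have "prob (space (pts n) - B) \<le> prob (E n)"
      by (rule finite_measure_mono) (unfold E_def, rule success_measurable[OF n(2)])
    then show ?case using B prob_compl[OF B(1)] by linarith
  qed
  have up: "eventually (\<lambda>n. measure (pts n) (E n) \<le> 1) sequentially"
    using eventually_ge_at_top[of "1 :: nat"] by eventually_elim (rule prob_space.prob_le_1[OF ps])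
  have "(\<lambda>n. 1 - 4 * failure_bound n) \<longlonglongrightarrow> 1 - 4 * 0"
    by (intro tendsto_intros failure_bound_tendsto)
  then have "(\<lambda>n. measure (pts n) (E n)) \<longlonglongrightarrow> 1"
    by (intro tendsto_sandwich[OF low up]) simp_all
  then show ?thesis
    unfolding E_def using PC perm_lists_tau by (intro exI[of _ P] exI[of _ C]) blast
qed

end
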